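(* For $\theta\in(0,\pi)$, the restriction $\tau_\theta:A_\theta\to\mathbb{P}^3(\mathbb{R})$ of the transition function $\tau$ to $A_\theta$ is homotopic to the function $$[[x,y,x',y']]\mapsto \bigl(\Phi_{\pi-\theta}(x',y')\bigr)^{-1}\,\Phi_\theta(x,y)\qquad\text{for } [[x,y,x',y']]\in A_\theta,$$ where the representative is taken with $(x,y)\in X_\theta$, $(x',y')\in X_{\pi-\theta}$. In particular, the transition function $\tau:U\cap V\to\mathbb{P}^3(\mathbb{R})$ is homotopic to the composite $U\cap V\simeq(\mathbb{P}^3(\mathbb{R})\times\mathbb{P}^3(\mathbb{R}))/T\to\mathbb{P}^3(\mathbb{R})$, where the final map is given by $(g,h)\mapsto g^{-1}h$.
   Context: Elements of $SU(2)$ are written as unit quaternions $z+wj$ ($z,w\in\mathbb{C}$), $T$ is the maximal torus of diagonal matrices $\{e^{i\alpha}\}$, $[g,h]=ghg^{-1}h^{-1}$, and $\mathbb{P}^3(\mathbb{R})\cong PSU(2)=SU(2)/\{\pm I\}$ as a group, with $T$ acting by left multiplication. $[[\cdot]]$ denotes an equivalence class. Spaces. $X_\theta=\{(g,h)\in SU(2)^2\mid[g,h]=e^{i\theta}\}$, with $T$ acting by diagonal conjugation; $W_\theta$ is the set of $(g,h)\in SU(2)^2$ with $[g,h]$ conjugate to $e^{i\theta}$; for $S\subset[0,\pi]$, $X_S$ and $W_S$ are the unions over $\theta\in S$. $M=\{(x,y,x',y')\in SU(2)^4\mid[x,y][x',y']=-I\}$, $A=M/SU(2)$ (diagonal conjugation,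 inducing a free action of $PSU(2)$), and $q:M\to A$ is the bundle projection. $A_\theta\subset A$ is the set of classes $[[x,y,x',y']]$ with $(x,y)\in W_\theta$; $U=A_{[0,\pi)}$ and $V=A_{(0,\pi]}$ are the unions over the indicated $\theta$, so $U\cap V=A_{(0,\pi)}$. For $\theta\in(0,\pi)$ every class in $A_\theta$ has a representative in $X_\theta\times X_{\pi-\theta}$, unique up to $T$, so $A_\theta\cong(X_\theta\times X_{\pi-\theta})/T$. Applying $\Phi_\theta$ and $\Phi_{\pi-\theta}$ (below) to the factors gives $A_\theta\cong(\mathbb{P}^3(\mathbb{R})\times\mathbb{P}^3(\mathbb{R}))/T$ with $T$ acting diagonally by left translation; this is the identification used in $U\cap V\simeq(\mathbb{P}^3(\mathbb{R})\times\mathbb{P}^3(\mathbb{R}))/T$. Coordinates and waves. For $\theta\in(0,\pi]$ each element of $X_\theta$ has the form $(Pe^{i\theta/2}+Raj,\;Qe^{-i\theta/2}+Sbj)$ with $P,Q\in[-1,1]$, $R=\sqrt{1-P^2}$, $S=\sqrt{1-Q^2}$, $a,b\in S^1$. Put $e^{i\phi}=a\bar b$. For $P\ne0$, $\Gamma_{\theta,P}$ is the curve in the cylinder $C=S^1\times[-1,1]$ with coordinates $(\phi,Q)$ that is one period of the graph of $Q=\operatorname{sgn}(P)KR/\sqrt{P^2+K^2R^2}$, where $K=\sin(\theta/2-\phi)/\sin(\theta/2)$; $\Gamma_{\theta,0^+}$ and $\Gamma_{\theta,0^-}$ are the limiting square waves as $P\to0^+$ and $P\to0^-$. These curves pass through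 $(\phi,Q)=(\theta/2,0)$. They are oriented counterclockwise if $P>0$ (and for $0^+$) and clockwise if $P<0$ (and for $0^-$). For $P\neq0$ and $a\in S^1$, a point $(\phi,Q)\in\Gamma_{\theta,P}$ determines a point of $X_\theta$ with $b=ae^{-i\phi}$. The $T$-equivariant homeomorphisms $\Phi_\theta:X_\theta\to\mathbb{P}^3(\mathbb{R})$, $\theta\in(0,\pi]$. The inverse $\Phi_\theta^{-1}$ sends $[[z+wj]]$, with $z=|z|e^{i\zeta}$, $w=|w|e^{i\omega}$, $|z|^2+|w|^2=1$, to $(Pe^{i\theta/2}+Raj,\;Qe^{-i\theta/2}+Sbj)$, where $P=|z|^2-|w|^2$, $Ra=-2e^{i\theta/2}zw$, and $Q$, $S$, $b$ are as follows. Let $\pi:C\to S^2$, $\pi(\phi,Q)=(\sqrt{1-Q^2}\,e^{i\phi},Q)$, and let $\gamma_{\theta,P}:[0,2\pi]\to S^2$ be the parametrization of $\pi(\Gamma_{\theta,P})$ by normalized arc length from $\gamma_{\theta,P}(0)=\pi(\theta/2,0)$ in the direction of the orientation above. If $zw\neq0$, let $s=\operatorname{Arg}(z/w)$ and let $(\phi,Q)$ be defined by $(\sqrt{1-Q^2}\,e^{i\phi},Q)=\gamma_{\theta,P}(s)$ (if $P=0$, use $\gamma_{\theta,0^+}(s)$ or equivalently $\gamma_{\theta,0^-}(s)$); put $S=\sqrt{1-Q^2}$, $b=ae^{-i\phi}$. If $zw=0$, put $Q=0$, $S=1$, $b=e^{i\beta}$ with $\beta=2\omega+\theta/2+\pi$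 if $z=0$ and $\beta=2\zeta+\theta/2+\pi$ if $w=0$. The deformation $r'$. For $P\neq0$ let $\tilde\gamma_{\theta,P}:[0,2\pi]\to C$ parametrize $\Gamma_{\theta,P}$ by normalized arc length in $C$ from $(\theta/2,0)$, measured counterclockwise if $P>0$ and clockwise if $P<0$. For a point of $X_\theta$ ($\theta\in(0,\pi]$) with $P\ne0$ and coordinates $(\phi,Q)=\tilde\gamma_{\theta,P}(s)$, and for $t\in[0,1]$, put $\theta_t=t\theta+(1-t)\pi$, $(\phi_t,Q_t)=\tilde\gamma_{\theta_t,P}(s)$, $S_t=\sqrt{1-Q_t^2}$, $b_t=ae^{-i\phi_t}$, and $$r'\bigl((Pe^{i\theta/2}+Raj,\,Qe^{-i\theta/2}+Sbj),t\bigr)=(Pe^{i\theta_t/2}+Raj,\;Q_te^{-i\theta_t/2}+S_tb_tj)\in X_{\theta_t}.$$ This is extended by continuity to all of $X_{(0,\pi]}$; it is $T$-equivariant and $r'(\cdot,0)$ takes values in $X_\pi$. Define $r'_W$ on $W_{(0,\pi]}\times[0,1]$ by $r'_W(g(x,y)g^{-1},t)=g\,r'((x,y),t)\,g^{-1}$ for $(x,y)\in X_{(0,\pi]}$. The transition function. The principal $\mathbb{P}^3(\mathbb{R})$-bundle $q$ is trivialized over $U$ by $(x,y,x',y')\mapsto\bigl(\Phi_\pi(r'_W(x',y',0)),\,q(x,y,x',y')\bigr)$ and over $V$ by $(x,y,x',y')\mapsto\bigl(\Phi_\pi(r'_W(x,y,0)),\,q(x,y,x',y')\bigr)$. The transition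 function $\tau:U\cap V\to\mathbb{P}^3(\mathbb{R})$ is given, for $\theta\in(0,\pi)$ and $[[x,y,x',y']]\in A_\theta\cong(X_\theta\times X_{\pi-\theta})/T$, by $$\tau([[x,y,x',y']])=\bigl(\Phi_\pi(r'(x',y',0))\bigr)^{-1}\,\Phi_\pi(r'(x,y,0)).$$
   Formalization: For zw=0, β is 2ω+π or 2ζ+π (printed θ/2 dropped, as it makes Φ_θ discontinuous); counterclockwise means φ decreasing; in (P³×P³)/T, g comes from (x',y') and h from (x,y), since the other order gives the inverse map. *)

theory Defs
  imports "HOL-Analysis.Analysis" "HOL-Algebra.Coset"
begin

section \<open>The groups $SU(2)$, $T$ and $PSU(2)$\<close>

text \<open>The pair \<open>(z, w)\<close> stands for the quaternion $z + wj$; note $jz = \bar z j$ and $j^2 = -1$.\<close>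

type_synonym quat = "complex \<times> complex"

definition qmult :: "quat \<Rightarrow> quat \<Rightarrow> quat" where
  "qmult g h = (fst g * fst h - snd g * cnj (snd h), fst g * snd h + snd g * cnj (fst h))"

definition SU2 :: "quat monoid" where
  "SU2 = \<lparr>carrier = {(z, w). (cmod z)\<^sup>2 + (cmod w)\<^sup>2 = 1}, monoid.mult = qmult, one = (1, 0)\<rparr>"

definition torus :: "quat set" where
  "torus = {(cis \<alpha>, 0) |\<alpha>. True}"

definition commutator :: "quat \<Rightarrow> quat \<Rightarrow> quat" where
  "commutator g h = g \<otimes>\<^bsub>SU2\<^esub> h \<otimes>\<^bsub>SU2\<^esub> inv\<^bsub>SU2\<^esub> g \<otimes>\<^bsub>SU2\<^esub> inv\<^bsub>SU2\<^esub> h"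

definition conj_by :: "quat \<Rightarrow> quat \<Rightarrow> quat" where
  "conj_by g x = g \<otimes>\<^bsub>SU2\<^esub> x \<otimes>\<^bsub>SU2\<^esub> inv\<^bsub>SU2\<^esub> g"

definition PSU2 :: "quat set monoid" where
  "PSU2 = SU2 Mod {(1, 0), (-1, 0)}"

definition psu_class :: "quat \<Rightarrow> quat set" where
  "psu_class g = {(1, 0), (-1, 0)} #>\<^bsub>SU2\<^esub> g"

definition quot_topology :: "'a topology \<Rightarrow> ('a \<Rightarrow> 'b) \<Rightarrow> 'b topology" where
  "quot_topology X f =
     topology (\<lambda>U. U \<subseteq> f ` topspace X \<and> openin X {x \<in> topspace X. f x \<in> U})"

definition PSU2_top :: "quat set topology" where
  "PSU2_top = quot_topology (top_of_set (carrier SU2)) psu_class"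


section \<open>The spaces\<close>

definition X_space :: "real \<Rightarrow> (quat \<times> quat) set" where
  "X_space \<theta> = {(g, h). g \<in> carrier SU2 \<and> h \<in> carrier SU2 \<and> commutator g h = (cis \<theta>, 0)}"

definition W_space :: "real \<Rightarrow> (quat \<times> quat) set" where
  "W_space \<theta> = {(g, h). g \<in> carrier SU2 \<and> h \<in> carrier SU2 \<and>
     (\<exists>k \<in> carrier SU2. commutator g h = conj_by k (cis \<theta>, 0))}"

definition X_union :: "real set \<Rightarrow> (quat \<times> quat) set" where
  "X_union S = (\<Union>\<theta>\<in>S. X_space \<theta>)"

type_synonym quad = "quat \<times> quat \<times> quat \<times> quat"

definition M_space :: "quad set" where
  "M_space = {(x, y, x', y'). x \<in> carrier SU2 \<and> y \<in> carrier SU2 \<and> x' \<in> carrier SU2 \<and>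
     y' \<in> carrier SU2 \<and> commutator x y \<otimes>\<^bsub>SU2\<^esub> commutator x' y' = (-1, 0)}"

definition quad_conj :: "quat \<Rightarrow> quad \<Rightarrow> quad" where
  "quad_conj g = (\<lambda>(x, y, x', y'). (conj_by g x, conj_by g y, conj_by g x', conj_by g y'))"

text \<open>A point of $A$ is an orbit, so the representatives of a class are its elements.\<close>

definition q_proj :: "quad \<Rightarrow> quad set" where
  "q_proj m = (\<lambda>g. quad_conj g m) ` carrier SU2"

definition A_top :: "quad set topology" where
  "A_top = quot_topology (top_of_set M_space) q_proj"

definition A_at :: "real \<Rightarrow> quad set set" where
  "A_at \<theta> = {q_proj (x, y, x', y') |x y x' y'. (x, y, x', y') \<in> M_space \<and> (x, y) \<in> W_space \<theta>}"

definition U_set :: "quad set set" where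
  "U_set = (\<Union>\<theta>\<in>{0..<pi}. A_at \<theta>)"

definition V_set :: "quad set set" where
  "V_set = (\<Union>\<theta>\<in>{0<..pi}. A_at \<theta>)"


section \<open>Normalized arc length\<close>

definition arc_len :: "(real \<Rightarrow> 'a::real_normed_vector) \<Rightarrow> real \<Rightarrow> real" where
  "arc_len c v = integral {0..v} (\<lambda>x. norm (vector_derivative c (at x)))"

text \<open>The parametrization over \<open>[0, 2\<pi>]\<close> of the curve \<open>c\<close> on \<open>[0, l]\<close> by normalized arc
  length. The chosen \<open>v\<close> is unique up to intervals on which \<open>c\<close> is constant, so the
  value does not depend on the choice.\<close>

definition arc_param :: "(real \<Rightarrow> 'a::real_normed_vector) \<Rightarrow> real \<Rightarrow> real \<Rightarrow> 'a" where
  "arc_param c l s = c (SOME v. v \<in> {0..l} \<and> 2 * pi * arc_len c v = s * arc_len c l)"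


section \<open>Waves\<close>

text \<open>A point \<open>(\<phi>, Q)\<close> of the cylinder $C$ is represented by \<open>(cis \<phi>, Q) :: complex \<times> real\<close>;
  the length of a curve in \<open>complex \<times> real\<close> lying on the cylinder is its length in $C$.

  The waves are traversed from \<open>(\<theta>/2, 0)\<close>. The sense called counterclockwise is the
  one in which \<open>\<phi>\<close> decreases (the cylinder seen from below, that is, from the side of negative
  \<open>Q\<close>), so \<open>Q\<close> increases at the initial point for every \<open>P\<close>. This is
  the only choice for which $\Phi_\theta$ below is a homeomorphism: with
  \<open>z = |z| cis \<zeta>\<close>, \<open>w = |w| cis \<omega>\<close>, \<open>s = \<zeta> - \<omega>\<close>, as \<open>P \<rightarrow> 1\<close> (so \<open>w \<rightarrow> 0\<close>) the wave flattens to
  \<open>\<phi> = \<theta>/2 \<mp> s\<close>, so \<open>arg b = arg a - \<phi>\<close> with \<open>arg a = \<theta>/2 + \<pi> + \<zeta> + \<omega>\<close> tends to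
  \<open>2\<zeta> + \<pi>\<close> if \<open>\<phi>\<close> decreases, but would be \<open>2\<omega> + \<pi>\<close>, which has no limit as \<open>w \<rightarrow> 0\<close>, if \<open>\<phi>\<close>
  increased. The map $r'$ does not depend on the choice.\<close>

definition wave_height :: "real \<Rightarrow> real \<Rightarrow> real \<Rightarrow> real" where
  "wave_height \<theta> P \<phi> =
     (let R = sqrt (1 - P\<^sup>2); K = sin (\<theta>/2 - \<phi>) / sin (\<theta>/2)
      in sgn P * (K * R / sqrt (P\<^sup>2 + K\<^sup>2 * R\<^sup>2)))"

definition wave :: "real \<Rightarrow> real \<Rightarrow> real \<Rightarrow> complex \<times> real" where
  "wave \<theta> P v = (let \<phi> = \<theta>/2 - sgn P * v in (cis \<phi>, wave_height \<theta> P \<phi>))"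

text \<open>The square wave $\Gamma_{\theta,0^+}$, for \<open>v\<close> in \<open>[0, 4\<pi>]\<close>: up at \<open>\<phi> = \<theta>/2\<close>,
  along \<open>Q = 1\<close> to \<open>\<phi> = \<theta>/2 - \<pi>\<close>, down, along \<open>Q = -1\<close> to \<open>\<phi> = \<theta>/2 - 2\<pi>\<close>, and up.\<close>

definition square_wave :: "real \<Rightarrow> real \<Rightarrow> complex \<times> real" where
  "square_wave \<theta> v =
     (if v \<le> pi/2 then (cis (\<theta>/2), sin v)
      else if v \<le> 3*pi/2 then (cis (\<theta>/2 - (v - pi/2)), 1)
      else if v \<le> 5*pi/2 then (cis (\<theta>/2 - pi), sin (v - pi))
      else if v \<le> 7*pi/2 then (cis (\<theta>/2 - pi - (v - 5*pi/2)), -1)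
      else (cis (\<theta>/2 - 2*pi), sin (v - 4*pi)))"

definition cyl_to_sphere :: "complex \<times> real \<Rightarrow> complex \<times> real" where
  "cyl_to_sphere = (\<lambda>(u, Q). (of_real (sqrt (1 - Q\<^sup>2)) * u, Q))"

definition gamma_sphere :: "real \<Rightarrow> real \<Rightarrow> real \<Rightarrow> complex \<times> real" where
  "gamma_sphere \<theta> P =
     (if P = 0 then arc_param (cyl_to_sphere \<circ> square_wave \<theta>) (4 * pi)
      else arc_param (cyl_to_sphere \<circ> wave \<theta> P) (2 * pi))"

definition gamma_cyl :: "real \<Rightarrow> real \<Rightarrow> real \<Rightarrow> complex \<times> real" where
  "gamma_cyl \<theta> P = arc_param (wave \<theta> P) (2 * pi)"


section \<open>The homeomorphisms $\Phi_\theta$\<close>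

text \<open>The point \<open>(u, Q)\<close> of the sphere has \<open>u = S cis \<phi>\<close>, so that
  \<open>S b = S a cis (-\<phi>) = a * cnj u\<close>.

  For \<open>zw = 0\<close> the angle \<open>\<beta>\<close> is \<open>2\<omega> + \<pi>\<close> or \<open>2\<zeta> + \<pi>\<close>. The printed source has an additional
  summand \<open>\<theta>/2\<close>, for which the map would not be continuous at these points (by the
  computation above the limit from \<open>zw \<noteq> 0\<close> is \<open>2\<zeta> + \<pi>\<close> for \<open>w \<rightarrow> 0\<close>, and likewise
  \<open>2\<omega> + \<pi>\<close> for \<open>z \<rightarrow> 0\<close>), hence no homeomorphism. With the value used here,
  $\Phi_\pi^{-1}([[u]]) = (u\, i\, u^{-1}, u (-j) u^{-1})$, so $\Phi_\pi$ is
  $SU(2)$-equivariant, as is needed for the trivializations below.\<close>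

definition Phi_inv_rep :: "real \<Rightarrow> quat \<Rightarrow> quat \<times> quat" where
  "Phi_inv_rep \<theta> = (\<lambda>(z, w).
     let P = (cmod z)\<^sup>2 - (cmod w)\<^sup>2;
         R = sqrt (1 - P\<^sup>2);
         Ra = -2 * cis (\<theta>/2) * z * w
     in if z * w \<noteq> 0 then
          (let a = Ra / of_real R;
               s = Arg2pi (z / w);
               (u, Q) = gamma_sphere \<theta> P s
           in ((of_real P * cis (\<theta>/2), Ra), (of_real Q * cis (-\<theta>/2), a * cnj u)))
        else
          (let \<beta> = 2 * Arg2pi (if z = 0 then w else z) + pi
           in ((of_real P * cis (\<theta>/2), Ra), (0, cis \<beta>))))"

definition Phi_inv :: "real \<Rightarrow> quat set \<Rightarrow> quat \<times> quat" where
  "Phi_inv \<theta> c = the_elem (Phi_inv_rep \<theta> ` c)"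

definition Phi :: "real \<Rightarrow> quat \<times> quat \<Rightarrow> quat set" where
  "Phi \<theta> = inv_into (carrier PSU2) (Phi_inv \<theta>)"


section \<open>The deformation $r'$\<close>

text \<open>The point with coordinates \<open>P\<close>, \<open>a\<close> and \<open>(\<phi>, Q)\<close>, where \<open>u = cis \<phi>\<close> and
  \<open>b = a cis (-\<phi>)\<close>.\<close>

definition X_point :: "real \<Rightarrow> real \<Rightarrow> complex \<Rightarrow> complex \<times> real \<Rightarrow> quat \<times> quat" where
  "X_point \<theta> P a = (\<lambda>(u, Q).
     ((of_real P * cis (\<theta>/2), of_real (sqrt (1 - P\<^sup>2)) * a),
      (of_real Q * cis (-\<theta>/2), of_real (sqrt (1 - Q\<^sup>2)) * (a * cnj u))))"

definition theta_at :: "real \<Rightarrow> real \<Rightarrow> real" where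
  "theta_at \<theta> t = t * \<theta> + (1 - t) * pi"

definition r_nonzero :: "quat \<times> quat \<Rightarrow> real \<Rightarrow> quat \<times> quat" where
  "r_nonzero p t = (THE p'. \<exists>\<theta>\<in>{0<..pi}. \<exists>P\<in>{-1..1} - {0}. \<exists>a\<in>sphere 0 1. \<exists>s\<in>{0..2*pi}.
     p = X_point \<theta> P a (gamma_cyl \<theta> P s) \<and>
     p' = X_point (theta_at \<theta> t) P a (gamma_cyl (theta_at \<theta> t) P s))"

text \<open>The points with \<open>P \<noteq> 0\<close>.\<close>

definition X_nonzero :: "(quat \<times> quat) set" where
  "X_nonzero = {(x, y) \<in> X_union {0<..pi}. fst x \<noteq> 0}"

definition r_deform :: "quat \<times> quat \<Rightarrow> real \<Rightarrow> quat \<times> quat" where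
  "r_deform p t =
     (if p \<in> X_nonzero then r_nonzero p t
      else Lim (at (p, t) within X_nonzero \<times> {0..1}) (\<lambda>(p', t'). r_nonzero p' t'))"

definition r_W :: "quat \<times> quat \<Rightarrow> real \<Rightarrow> quat \<times> quat" where
  "r_W p t = (THE p'. \<exists>g \<in> carrier SU2. \<exists>p0 \<in> X_union {0<..pi}.
     p = map_prod (conj_by g) (conj_by g) p0 \<and>
     p' = map_prod (conj_by g) (conj_by g) (r_deform p0 t))"


section \<open>Trivializations and the transition function\<close>

text \<open>The $PSU(2)$-components of the trivializations of \<open>q_proj\<close> over $U$ and $V$.\<close>

definition triv_U :: "quad \<Rightarrow> quat set" where
  "triv_U = (\<lambda>(x, y, x', y'). Phi pi (r_W (x', y') 0))"

definition triv_V :: "quad \<Rightarrow> quat set" where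
  "triv_V = (\<lambda>(x, y, x', y'). Phi pi (r_W (x, y) 0))"

text \<open>The value at \<open>c\<close> is computed from any point of the fibre of \<open>q_proj\<close> over \<open>c\<close>, that is, from
  any element of \<open>c\<close>. On a representative in $X_\theta \times X_{\pi-\theta}$ the map
  \<open>r_W\<close> is \<open>r_deform\<close>.\<close>

definition transition :: "quad set \<Rightarrow> quat set" where
  "transition c = the_elem ((\<lambda>m. inv\<^bsub>PSU2\<^esub> (triv_U m) \<otimes>\<^bsub>PSU2\<^esub> triv_V m) ` c)"

definition slice_map :: "real \<Rightarrow> quad set \<Rightarrow> quat set" where
  "slice_map \<theta> c = the_elem {inv\<^bsub>PSU2\<^esub> (Phi (pi - \<theta>) (x', y')) \<otimes>\<^bsub>PSU2\<^esub> Phi \<theta> (x, y) |x y x' y'.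
     (x, y, x', y') \<in> c \<and> (x, y) \<in> X_space \<theta> \<and> (x', y') \<in> X_space (pi - \<theta>)}"


section \<open>The quotient of $PSU(2) \times PSU(2)$ by $T$\<close>

definition torus_orbit :: "quat set \<times> quat set \<Rightarrow> (quat set \<times> quat set) set" where
  "torus_orbit = (\<lambda>(g, h).
     (\<lambda>t. (psu_class t \<otimes>\<^bsub>PSU2\<^esub> g, psu_class t \<otimes>\<^bsub>PSU2\<^esub> h)) ` torus)"

definition PP_T_top :: "(quat set \<times> quat set) set topology" where
  "PP_T_top = quot_topology (prod_topology PSU2_top PSU2_top) torus_orbit"

text \<open>The identification of $U \cap V$ with $(PSU(2) \times PSU(2))/T$ up to homotopy. The first
  coordinate \<open>g\<close> comes from \<open>(x', y')\<close> and the second coordinate \<open>h\<close> from \<open>(x, y)\<close>, so that the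
  map \<open>(g, h) \<mapsto> inv g \<otimes> h\<close> matches \<open>slice_map\<close>. (In the opposite order the composite would be the
  pointwise inverse of this one, which is not homotopic to it: inversion on $PSU(2)$ has
  degree $-1$.)\<close>

definition comparison :: "quad set \<Rightarrow> (quat set \<times> quat set) set" where
  "comparison c = the_elem {torus_orbit (Phi (pi - \<theta>) (x', y'), Phi \<theta> (x, y)) |\<theta> x y x' y'.
     \<theta> \<in> {0<..<pi} \<and> (x, y, x', y') \<in> c \<and> (x, y) \<in> X_space \<theta> \<and> (x', y') \<in> X_space (pi - \<theta>)}"

definition quotient_division :: "(quat set \<times> quat set) set \<Rightarrow> quat set" where
  "quotient_division d = the_elem ((\<lambda>(g, h). inv\<^bsub>PSU2\<^esub> g \<otimes>\<^bsub>PSU2\<^esub> h) ` d)"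

definition homotopy_equivalence :: "'a topology \<Rightarrow> 'b topology \<Rightarrow> ('a \<Rightarrow> 'b) \<Rightarrow> bool" where
  "homotopy_equivalence X Y f \<longleftrightarrow> continuous_map X Y f \<and>
     (\<exists>g. continuous_map Y X g \<and>
          homotopic_with (\<lambda>_. True) X X (g \<circ> f) id \<and>
          homotopic_with (\<lambda>_. True) Y Y (f \<circ> g) id)"


section \<open>Basic checks\<close>

lemma group_SU2: "group SU2"
proof (rule groupI)
  fix x y assume "x \<in> carrier SU2" "y \<in> carrier SU2"
  then show "x \<otimes>\<^bsub>SU2\<^esub> y \<in> carrier SU2"
  proof (cases x, cases y)
    fix z w z' w' assume [simp]: "x = (z, w)" "y = (z', w')"
    assume "x \<in> carrier SU2" "y \<in> carrier SU2"
    then have 1: "z * cnj z + w * cnj w = 1" "z' * cnj z' + w' * cnj w' = 1"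
      by (simp_all add: SU2_def complex_norm_square flip: of_real_power of_real_add)
        (simp_all only: complex_norm_square[symmetric] of_real_add[symmetric] of_real_1)
    have "(z*z' - w * cnj w') * cnj (z*z' - w * cnj w') + (z*w' + w * cnj z') * cnj (z*w' + w * cnj z')
        = (z * cnj z + w * cnj w) * (z' * cnj z' + w' * cnj w')"
      by (simp add: algebra_simps)
    with 1 have "complex_of_real ((cmod (z*z' - w * cnj w'))\<^sup>2 + (cmod (z*w' + w * cnj z'))\<^sup>2) = 1"
      by (simp only: of_real_add complex_norm_square) simp
    then show ?thesis
      by (simp add: SU2_def qmult_def del: of_real_add of_real_power)
  qed
next
  fix x assume "x \<in> carrier SU2"
  then obtain z w where [simp]: "x = (z, w)" and 0: "(cmod z)\<^sup>2 + (cmod w)\<^sup>2 = 1"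
    by (auto simp: SU2_def)
  from 0 have 1: "z * cnj z + w * cnj w = 1"
    by (simp only: complex_norm_square[symmetric] of_real_add[symmetric] of_real_1)
  have "(cnj z, -w) \<in> carrier SU2" "(cnj z, -w) \<otimes>\<^bsub>SU2\<^esub> x = \<one>\<^bsub>SU2\<^esub>"
    using 0 1 by (simp_all add: SU2_def qmult_def algebra_simps)
  then show "\<exists>y\<in>carrier SU2. y \<otimes>\<^bsub>SU2\<^esub> x = \<one>\<^bsub>SU2\<^esub>" by blast
qed (auto simp: SU2_def qmult_def algebra_simps)

lemma quotient_map_quot_topology: "quotient_map X (quot_topology X f) f"
proof -
  have "istopology (\<lambda>U. U \<subseteq> f ` topspace X \<and> openin X {x \<in> topspace X. f x \<in> U})"
    unfolding istopology_def
  proof (intro conjI allI impI)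
    fix S T assume *: "S \<subseteq> f ` topspace X \<and> openin X {x \<in> topspace X. f x \<in> S}"
      "T \<subseteq> f ` topspace X \<and> openin X {x \<in> topspace X. f x \<in> T}"
    then show "S \<inter> T \<subseteq> f ` topspace X" by blast
    have "{x \<in> topspace X. f x \<in> S \<inter> T} = {x \<in> topspace X. f x \<in> S} \<inter> {x \<in> topspace X. f x \<in> T}"
      by blast
    with * show "openin X {x \<in> topspace X. f x \<in> S \<inter> T}" by auto
  next
    fix \<K> assume *: "\<forall>K\<in>\<K>. K \<subseteq> f ` topspace X \<and> openin X {x \<in> topspace X. f x \<in> K}"
    then show "\<Union> \<K> \<subseteq> f ` topspace X" by blast
    have "{x \<in> topspace X. f x \<in> \<Union> \<K>} = (\<Union>K\<in>\<K>. {x \<in> topspace X. f x \<in> K})" by blast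
    with * show "openin X {x \<in> topspace X. f x \<in> \<Union> \<K>}" by auto
  qed
  then have o: "openin (quot_topology X f) U \<longleftrightarrow>
      U \<subseteq> f ` topspace X \<and> openin X {x \<in> topspace X. f x \<in> U}" for U
    unfolding quot_topology_def by (simp add: topology_inverse')
  have "{x \<in> topspace X. f x \<in> f ` topspace X} = topspace X" by blast
  then have "openin (quot_topology X f) (f ` topspace X)" by (simp add: o)
  then have "topspace (quot_topology X f) = f ` topspace X"
    by (metis o openin_subset openin_topspace subset_antisym)
  then show ?thesis by (auto simp: quotient_map_def o)
qed

end

theory Submission
  imports Defs
begin

text \<open>The projection of the wave \<open>\<Gamma>\<close> for \<open>\<theta>\<close>, \<open>P\<close> to the sphere is a great circle, so
  \<open>\<Phi>\<close> has an explicit formula; it is a bijection from \<open>PSU(2)\<close> to the space \<open>X\<close> at \<open>\<theta>\<close>, jointly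
  continuous in \<open>\<theta>\<close>, and equivariant under \<open>T\<close> (under all of \<open>SU(2)\<close> for \<open>\<theta> = \<pi>\<close>). Parametrizing the
  waves by the sum of the azimuth and the great circle angle makes their arc length on the cylinder
  jointly continuous up to the square wave by dominated convergence, so \<open>r'\<close> extends continuously
  to \<open>P = 0\<close>. Consequently
  \<open>(t, [[x, y, x', y']]) \<mapsto> \<Phi> (r'(x', y', t))\<^sup>-\<^sup>1 \<Phi> (r'(x, y, t))\<close>, with each \<open>\<Phi>\<close> taken at the angle
  reached at time \<open>t\<close>, is a homotopy from the transition function to the quotient map, and
  \<open>U \<inter> V\<close> is homeomorphic to the product of \<open>(0, \<pi>)\<close> with \<open>(PSU(2) \<times> PSU(2))/T\<close>. Continuity of all
  maps is checked on compact sets of parameters, on which the parametrizations are quotient maps.\<close>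


section \<open>Arc length of the waves\<close>

text \<open>As P tends to 0, neither angle alone parametrizes the wave: v stands still on the
  vertical edges of the square wave, and u on the horizontal ones, which the projection to the
  sphere collapses to poles. The sum u + v advances on every edge. The limiting speed still jumps at
  the corners, so continuity is claimed jointly for its integral only. The coordinates (P, a, s) of
  a point are not unique: s = 0 and s = 2\<pi> coincide, and at P = 1 or P = -1 only a combination
  of a and s is determined. Every map written in coordinates therefore needs the check that this
  ambiguity is the same for all \<theta>. The homotopy descends to classes because a common left
  factor cancels in the quotient of two group elements. For t > 0 this factor lies in T; at t = 0
  both factors use the equivariant map at \<pi>, so the whole of SU(2) is allowed, as the transition
  function requires. A homotopy lives on [0, 1] times a quotient, and a product of quotient maps
  need not be a quotient map. Openness of the orbit projections repairs this.\<close>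

text \<open>Along a wave the azimuth \<open>v\<close> on the cylinder and the angle \<open>u\<close> on the great circle are
  related by \<open>tan v = k tan u\<close>. In terms of \<open>x = u + v\<close> this reads \<open>sin (u - v) = r sin x\<close> with
  \<open>r = (1 - k) / (1 + k)\<close>, which makes sense up to \<open>k = 0\<close>, where it yields the square wave.\<close>

definition skew :: "real \<Rightarrow> real \<Rightarrow> real" where
  "skew r x = arcsin (r * sin x)"

definition wave_angle :: "real \<Rightarrow> real \<Rightarrow> real" where
  "wave_angle r x = (x - skew r x) / 2"

definition circle_angle :: "real \<Rightarrow> real \<Rightarrow> real" where
  "circle_angle r x = (x + skew r x) / 2"

text \<open>At r = 1 and cos x = 0 the quotient is 0/0, hence 0 by convention. These x are the
  corners of the square wave.\<close>

definition skew_deriv :: "real \<Rightarrow> real \<Rightarrow> real" where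
  "skew_deriv r x = r * cos x / sqrt (1 - r\<^sup>2 * (sin x)\<^sup>2)"

text \<open>The largest Q on the wave: this is sqrt (1 - k^2) for k = (1 - r) / (1 + r).\<close>

definition height :: "real \<Rightarrow> real" where
  "height r = 2 * sqrt r / (1 + r)"

text \<open>Speed of the curve with azimuth v and height h sin u on the cylinder, where h is
  \<open>height r\<close>, v' = (1 - \<open>skew_deriv\<close>) / 2 and u' = (1 +
  \<open>skew_deriv\<close>) / 2.\<close>

definition speed :: "real \<Rightarrow> real \<Rightarrow> real" where
  "speed r x = sqrt (((1 - skew_deriv r x) / 2)\<^sup>2 +
     (height r * cos (circle_angle r x) * ((1 + skew_deriv r x) / 2))\<^sup>2)"

definition wave_length :: "real \<Rightarrow> real \<Rightarrow> real" where
  "wave_length r x = integral {0..x} (speed r)"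

section \<open>Bounds for the skew angle and the speed\<close>

lemma abs_mult_sin_le:
  fixes r :: real assumes "0 \<le> r" "r \<le> 1" shows "\<bar>r * sin x\<bar> \<le> 1"
proof -
  have "\<bar>r\<bar> * \<bar>sin x\<bar> \<le> 1 * 1" using assms by (intro mult_mono) auto
  then show ?thesis by (simp add: abs_mult)
qed

lemma abs_mult_sin_less:
  fixes r :: real assumes "0 \<le> r" "r < 1" shows "\<bar>r * sin x\<bar> < 1"
proof -
  have "\<bar>r\<bar> * \<bar>sin x\<bar> \<le> r * 1" using assms by (intro mult_mono) auto
  then show ?thesis using assms by (simp add: abs_mult)
qed

lemma sin_skew: "0 \<le> r \<Longrightarrow> r \<le> 1 \<Longrightarrow> sin (skew r x) = r * sin x"
  using abs_mult_sin_le[of r x] by (simp add: skew_def abs_le_iff)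

lemma cos_skew: "0 \<le> r \<Longrightarrow> r \<le> 1 \<Longrightarrow> cos (skew r x) = sqrt (1 - r\<^sup>2 * (sin x)\<^sup>2)"
  using abs_mult_sin_le[of r x] by (simp add: skew_def abs_le_iff cos_arcsin power_mult_distrib)

lemma cos_skew_pos: "0 \<le> r \<Longrightarrow> r < 1 \<Longrightarrow> cos (skew r x) > 0"
  using abs_mult_sin_less[of r x] cos_skew[of r x]
  by (simp add: power_mult_distrib[symmetric] abs_square_less_1)

lemma abs_skew_le: "0 \<le> r \<Longrightarrow> r \<le> 1 \<Longrightarrow> \<bar>skew r x\<bar> \<le> pi/2"
  using abs_mult_sin_le[of r x] arcsin_bounded[of "r * sin x"] unfolding skew_def by (auto simp: abs_le_iff)

lemma circle_plus_wave: "circle_angle r x + wave_angle r x = x"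
  and circle_minus_wave: "circle_angle r x - wave_angle r x = skew r x"
  by (simp_all add: circle_angle_def wave_angle_def field_simps)

text \<open>The radicand is at least (cos x)^2. The bound r, rather than 1, makes both u and v
  strictly increasing when r < 1.\<close>

lemma skew_deriv_le:
  assumes "0 \<le> r" "r \<le> 1" shows "\<bar>skew_deriv r x\<bar> \<le> r"
proof -
  have "r\<^sup>2 * (sin x)\<^sup>2 \<le> 1 * (sin x)\<^sup>2"
    using assms by (intro mult_right_mono) (auto simp: power_le_one)
  then have 0: "(cos x)\<^sup>2 \<le> 1 - r\<^sup>2 * (sin x)\<^sup>2" by (simp add: cos_squared_eq)
  then have "\<bar>cos x\<bar> \<le> sqrt (1 - r\<^sup>2 * (sin x)\<^sup>2)"
    by (metis real_sqrt_abs real_sqrt_le_mono)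
  moreover have "sqrt (1 - r\<^sup>2 * (sin x)\<^sup>2) \<ge> 0" using 0 by (meson order_trans real_sqrt_ge_zero zero_le_power2)
  ultimately have "\<bar>cos x\<bar> / sqrt (1 - r\<^sup>2 * (sin x)\<^sup>2) \<le> 1"
    by (cases "sqrt (1 - r\<^sup>2 * (sin x)\<^sup>2) = 0") (simp_all add: divide_le_eq)
  then have "r * (\<bar>cos x\<bar> / \<bar>sqrt (1 - r\<^sup>2 * (sin x)\<^sup>2)\<bar>) \<le> r * 1"
    using \<open>sqrt (1 - r\<^sup>2 * (sin x)\<^sup>2) \<ge> 0\<close> assms by (intro mult_left_mono) auto
  then show ?thesis using assms by (simp add: skew_deriv_def abs_mult)
qed

lemma skew_has_derivative:
  assumes "0 \<le> r" "r \<le> 1" "r < 1 \<or> cos x \<noteq> 0"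
  shows "(skew r has_real_derivative skew_deriv r x) (at x)"
proof -
  have "\<bar>r * sin x\<bar> < 1"
  proof (cases "r < 1")
    case True then show ?thesis using abs_mult_sin_less assms by blast
  next
    case False
    then have "(sin x)\<^sup>2 < 1" using assms sin_cos_squared_add[of x]
      by (smt (verit) zero_less_power2)
    then show ?thesis using False assms by (simp add: abs_square_less_1)
  qed
  then show ?thesis unfolding skew_def skew_deriv_def
    by (auto intro!: derivative_eq_intros simp: divide_inverse power_mult_distrib)
qed

lemma height_bounds: assumes "0 \<le> r" "r \<le> 1" shows "0 \<le> height r" "height r \<le> 1"
proof -
  have "0 \<le> (1 - sqrt r)\<^sup>2" by simp
  also have "\<dots> = 1 + r - 2 * sqrt r" using assms by (simp add: power2_diff)
  finally show "height r \<le> 1" using assms by (simp add: height_def)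
qed (use assms in \<open>simp add: height_def\<close>)

text \<open>The constant 2 dominates all speeds when r varies. The bound (1 - r) / 2 gives strict
  growth of the length, but degenerates at r = 1.\<close>

lemma speed_bounds:
  assumes "0 \<le> r" "r \<le> 1"
  shows "speed r x \<le> 2" "(1 - skew_deriv r x) / 2 \<le> speed r x" "(1 - r) / 2 \<le> speed r x" "0 \<le> speed r x"
proof -
  let ?d = "skew_deriv r x" and ?q = "height r * cos (circle_angle r x)"
  have d: "\<bar>?d\<bar> \<le> r" by (rule skew_deriv_le[OF assms])
  have "\<bar>height r\<bar> * \<bar>cos (circle_angle r x)\<bar> \<le> 1 * 1"
    using height_bounds[OF assms] by (intro mult_mono) auto
  then have q: "\<bar>?q\<bar> \<le> 1" by (simp add: abs_mult)
  have "\<bar>?q\<bar> * \<bar>(1 + ?d) / 2\<bar> \<le> 1 * 1" using q d assms by (intro mult_mono) auto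
  then have "\<bar>?q * ((1 + ?d) / 2)\<bar> \<le> 1" by (simp only: abs_mult mult_1)
  then have "(?q * ((1 + ?d) / 2))\<^sup>2 \<le> 1" by (simp only: abs_square_le_1)
  moreover have "\<bar>(1 - ?d) / 2\<bar> \<le> 1" using d assms by auto
  then have "((1 - ?d) / 2)\<^sup>2 \<le> 1" by (simp only: abs_square_le_1)
  ultimately have "speed r x \<le> sqrt (2\<^sup>2)" unfolding speed_def by (intro real_sqrt_le_mono) simp
  then show "speed r x \<le> 2" by simp
  show *: "(1 - ?d) / 2 \<le> speed r x" unfolding speed_def by (rule real_le_rsqrt) simp
  show "(1 - r) / 2 \<le> speed r x" by (rule order_trans[OF _ *]) (use abs_le_D1[OF d] in simp)
  show "0 \<le> speed r x" by (simp add: speed_def)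
qed

lemma continuous_on_skew: "continuous_on ({0..1} \<times> UNIV) (\<lambda>(r, x). skew r x)"
  unfolding skew_def case_prod_beta
  by (intro continuous_intros) (use abs_mult_sin_le in \<open>auto simp: abs_le_iff\<close>)

lemma continuous_on_circle_angle: "continuous_on ({0..1} \<times> UNIV) (\<lambda>(r, x). circle_angle r x)"
  using continuous_on_skew unfolding circle_angle_def case_prod_beta by (intro continuous_intros) auto

text \<open>Continuity in r at each fixed x is what dominated convergence asks for. At a corner, cos
  x = 0, \<open>skew_deriv\<close> is 0 for every r, so the jump of the limiting speed in x does no
  harm.\<close>

lemma continuous_on_speed_parameter: "continuous_on {0..1} (\<lambda>r. speed r x)"
proof -
  have 1: "continuous_on {0..1} (\<lambda>r. skew_deriv r x)"
  proof (cases "cos x = 0")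
    case True then show ?thesis by (simp add: skew_deriv_def)
  next
    case False
    have "1 - r\<^sup>2 * (sin x)\<^sup>2 \<noteq> 0" if "r \<in> {0..1}" for r
    proof -
      have "r\<^sup>2 * (sin x)\<^sup>2 \<le> 1 * (sin x)\<^sup>2"
        using that by (intro mult_right_mono) (auto simp: power_le_one)
      moreover have "(sin x)\<^sup>2 < 1" using False by (simp add: sin_squared_eq)
      ultimately show ?thesis by linarith
    qed
    then show ?thesis unfolding skew_deriv_def by (intro continuous_intros) auto
  qed
  have "continuous_on {0..1} (\<lambda>r. (\<lambda>(r, x). circle_angle r x) (r, x))"
    by (rule continuous_on_compose2[OF continuous_on_circle_angle]) (auto intro!: continuous_intros)
  then have 2: "continuous_on {0..1} (\<lambda>r. circle_angle r x)" by simp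
  show ?thesis unfolding speed_def height_def by (intro continuous_intros 1 2) auto
qed

lemma continuous_on_speed: assumes "0 \<le> r" "r < 1" shows "continuous_on S (speed r)"
proof -
  have ne: "1 - r\<^sup>2 * (sin x)\<^sup>2 \<noteq> 0" for x
    using cos_skew_pos[OF assms, of x] cos_skew[of r x] assms by auto
  have 1: "continuous_on S (skew_deriv r)"
    unfolding skew_deriv_def by (intro continuous_intros) (use ne in auto)
  have 2: "continuous_on S (circle_angle r)"
    unfolding circle_angle_def skew_def 
    by (intro continuous_intros) (use abs_mult_sin_less[OF assms] in \<open>auto simp: abs_less_iff intro!: less_imp_le\<close>)
  show ?thesis unfolding speed_def by (intro continuous_intros 1 2) simp_all
qed

section \<open>Length of a wave as a function of r and x, and its inverse\<close>

lemma speed_limit: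
  assumes "\<And>n. \<rho> n \<in> {0..1}" "\<rho> \<longlonglongrightarrow> r" "\<And>n. speed (\<rho> n) integrable_on {a..b}"
  shows "speed r integrable_on {a..b}"
    and "(\<lambda>n. integral {a..b} (speed (\<rho> n))) \<longlonglongrightarrow> integral {a..b} (speed r)"
proof -
  have r: "r \<in> {0..1}"     by (rule Lim_in_closed_set[OF closed_atLeastAtMost _ _ assms(2)]) (use assms(1) in auto)
  have conv: "(\<lambda>n. speed (\<rho> n) x) \<longlonglongrightarrow> speed r x" if "x \<in> {a..b}" for x
    using continuous_on_tendsto_compose[OF continuous_on_speed_parameter assms(2) r] assms(1) by auto
  have le: "\<And>n x. x \<in> {a..b} \<Longrightarrow> norm (speed (\<rho> n) x) \<le> 2"
    using speed_bounds(1,4)[of "\<rho> _"] assms(1) by simp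
  show "speed r integrable_on {a..b}"
    by (rule dominated_convergence(1)[OF assms(3) integrable_const_ivl le conv])
  show "(\<lambda>n. integral {a..b} (speed (\<rho> n))) \<longlonglongrightarrow> integral {a..b} (speed r)"
    by (rule dominated_convergence(2)[OF assms(3) integrable_const_ivl le conv])
qed

text \<open>For r = 1 the integrand jumps at the corners; integrability is inherited from r = 1 -
  1/(n+1) in the limit.\<close>

lemma speed_integrable: assumes "0 \<le> r" "r \<le> 1" shows "speed r integrable_on {a..b}"
proof (cases "r < 1")
  case True then show ?thesis using assms by (intro integrable_continuous_real continuous_on_speed)
next
  case False
  then have "r = 1" using assms by simp
  have "(\<lambda>n. 1 - inverse (real (Suc n))) \<longlonglongrightarrow> 1 - 0"
    by (intro tendsto_intros LIMSEQ_inverse_real_of_nat)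
  moreover have "speed (1 - inverse (real (Suc n))) integrable_on {a..b}" for n
    by (intro integrable_continuous_real continuous_on_speed) (auto simp: field_simps)
  moreover have "1 - inverse (real (Suc n)) \<in> {0..1}" for n by (simp add: inverse_eq_divide)
  ultimately show ?thesis unfolding \<open>r = 1\<close>
    using speed_limit(1)[of "\<lambda>n. 1 - inverse (real (Suc n))" 1 a b] by simp
qed

lemma wave_length_diff:
  assumes "0 \<le> r" "r \<le> 1" "0 \<le> x" "x \<le> x'"
  shows "wave_length r x' - wave_length r x = integral {x..x'} (speed r)"
  using Henstock_Kurzweil_Integration.integral_combine[OF assms(3,4) speed_integrable[OF assms(1,2)]]
  by (simp add: wave_length_def)

text \<open>The constant is the same for all r, so that in a joint limit the variation of x can be
  split off from that of r.\<close>

lemma wave_length_lipschitz: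
  assumes "0 \<le> r" "r \<le> 1" "0 \<le> x" "0 \<le> x'"
  shows "\<bar>wave_length r x' - wave_length r x\<bar> \<le> 2 * \<bar>x' - x\<bar>"
proof -
  have *: "\<bar>wave_length r x' - wave_length r x\<bar> \<le> 2 * \<bar>x' - x\<bar>" if "0 \<le> x" "x \<le> x'" for x x'
  proof -
    have "norm (integral {x..x'} (speed r)) \<le> integral {x..x'} (\<lambda>x. 2)"
      by (rule integral_norm_bound_integral) (use assms speed_bounds speed_integrable in auto)
    then show ?thesis using that wave_length_diff[OF assms(1,2) that] by simp
  qed
  then show ?thesis using *[of x x'] *[of x' x] assms by (cases "x \<le> x'") (auto simp: abs_minus_commute)
qed

lemma continuous_on_wave_length: "continuous_on ({0..1} \<times> {0..}) (\<lambda>(r, x). wave_length r x)"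
proof (rule continuous_on_sequentiallyI, clarsimp)
  fix u :: "nat \<Rightarrow> real \<times> real" and r x
  assume u: "\<forall>n. u n \<in> {0..1} \<times> {0..}" and r: "0 \<le> r" "r \<le> 1" "0 \<le> x" and lim: "u \<longlonglongrightarrow> (r, x)"
  have l1: "(\<lambda>n. fst (u n)) \<longlonglongrightarrow> r" and l2: "(\<lambda>n. snd (u n)) \<longlonglongrightarrow> x"
    using tendsto_fst[OF lim] tendsto_snd[OF lim] by auto
  have b: "0 \<le> fst (u n)" "fst (u n) \<le> 1" "0 \<le> snd (u n)" for n using u by (auto simp: mem_Times_iff)
  have A: "(\<lambda>n. wave_length (fst (u n)) x) \<longlonglongrightarrow> wave_length r x"
    unfolding wave_length_def by (rule speed_limit(2)[OF _ l1]) (use b speed_integrable in auto)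
  have "(\<lambda>n. 2 * \<bar>snd (u n) - x\<bar>) \<longlonglongrightarrow> 2 * \<bar>x - x\<bar>" by (intro tendsto_intros l2)
  then have B: "(\<lambda>n. 2 * \<bar>snd (u n) - x\<bar>) \<longlonglongrightarrow> 0" by simp
  have "(\<lambda>n. wave_length (fst (u n)) (snd (u n)) - wave_length (fst (u n)) x) \<longlonglongrightarrow> 0"
    by (rule Lim_null_comparison[OF _ B]) (use wave_length_lipschitz b r in auto)
  from tendsto_add[OF this A]
  show "(\<lambda>n. case u n of (r, x) \<Rightarrow> wave_length r x) \<longlonglongrightarrow> wave_length r x"
    by (simp add: case_prod_beta)
qed

text \<open>For r = 1 the speed is |cos y| on the vertical edges (cos y > 0) and 1 on the horizontal
  ones (cos y < 0). Hence |cos y| bounds it from below, and its integral over a nontrivial interval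
  is positive.\<close>

lemma wave_length_strict_mono:
  assumes r: "0 \<le> r" "r \<le> 1" and x: "0 \<le> x" "x < x'"
  shows "wave_length r x < wave_length r x'"
proof (cases "r < 1")
  case True
  have "integral {x..x'} (\<lambda>x. (1 - r) / 2) \<le> integral {x..x'} (speed r)"
    by (rule integral_le) (use r speed_integrable speed_bounds in auto)
  moreover have "integral {x..x'} (\<lambda>x. (1 - r) / 2) > 0" using x True by simp
  ultimately show ?thesis using wave_length_diff[of r x x'] r x by simp
next
  case False
  then have r1: "r = 1" using r by simp
  have le: "\<bar>cos y\<bar> \<le> speed 1 y" for y
  proof -
    have s: "skew_deriv 1 y = sgn (cos y)"
      by (simp add: skew_deriv_def cos_squared_eq[symmetric] sgn_real_def)
    have "cos (2 * circle_angle 1 y) = cos y * \<bar>cos y\<bar> - sin y * sin y"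
    proof -
      have "2 * circle_angle 1 y = y + skew 1 y" unfolding circle_angle_def by simp
      moreover have "cos (skew 1 y) = \<bar>cos y\<bar>" "sin (skew 1 y) = sin y"
        using cos_skew[of 1 y] sin_skew[of 1 y] by (simp_all add: cos_squared_eq[symmetric])
      ultimately show ?thesis by (simp only: cos_add)
    qed
    then have c: "2 * (cos (circle_angle 1 y))\<^sup>2 = 1 + cos y * \<bar>cos y\<bar> - sin y * sin y"
      by (simp add: cos_double_cos)
    consider "cos y > 0" | "cos y = 0" | "cos y < 0" by linarith
    then show ?thesis
    proof cases
      case 1
      then have "(cos (circle_angle 1 y))\<^sup>2 = (cos y)\<^sup>2"
        using c by (simp add: power2_eq_square[symmetric] sin_squared_eq)
      then show ?thesis using 1 by (simp add: speed_def s height_def)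
    next
      case 2 then show ?thesis by (simp add: speed_def)
    next
      case 3 then show ?thesis by (simp add: speed_def s)
    qed
  qed
  have "integral {x..x'} (\<lambda>y. \<bar>cos y\<bar>) \<le> integral {x..x'} (speed 1)"
    by (rule integral_le) (use le speed_integrable in \<open>auto intro!: integrable_continuous_real continuous_intros\<close>)
  moreover have "integral {x..x'} (\<lambda>y. \<bar>cos y\<bar>) \<ge> 0"
    by (rule Henstock_Kurzweil_Integration.integral_nonneg) (auto intro!: integrable_continuous_real continuous_intros)
  moreover have "integral {x..x'} (\<lambda>y. \<bar>cos y\<bar>) \<noteq> 0"
  proof
    assume "integral {x..x'} (\<lambda>y. \<bar>cos y\<bar>) = 0"
    moreover have "continuous_on {x..x'} (\<lambda>y. \<bar>cos y\<bar>)" by (intro continuous_intros)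
    ultimately have z: "\<forall>y\<in>{x..x'}. \<bar>cos y\<bar> = 0"
      using integral_eq_0_iff[of x x' "\<lambda>y. \<bar>cos y\<bar>"] x by simp
    \<comment> \<open>Two zeros of cos cannot lie at a positive distance below \<pi>, so the
      distance is capped at 1.\<close>
    define d where "d = min (x' - x) 1"
    have d: "0 < d" "d \<le> 1" "x + d \<le> x'" using x by (auto simp: d_def)
    have "cos x = 0" "cos (x + d) = 0" using bspec[OF z, of x] bspec[OF z, of "x + d"] d x by simp_all
    then have "sin x * sin d = 0" by (simp add: cos_add)
    moreover have "sin d > 0" using d pi_gt3 by (intro sin_gt_zero) auto
    moreover have "sin x \<noteq> 0" using \<open>cos x = 0\<close> sin_cos_squared_add[of x] by auto
    ultimately show False by simp
  qed
  ultimately show ?thesis using wave_length_diff[of r x x'] r x r1 by simp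
qed

text \<open>Inverse of normalized arc length. The solution is unique because the length is strictly
  increasing in x, even for the square wave.\<close>

definition wave_param :: "real \<Rightarrow> real \<Rightarrow> real" where
  "wave_param r s = (THE x. x \<in> {0..4*pi} \<and> 2 * pi * wave_length r x = s * wave_length r (4*pi))"

lemma wave_length_0 [simp]: "wave_length r 0 = 0"
  by (simp add: wave_length_def)

lemma wave_length_total_pos: "0 \<le> r \<Longrightarrow> r \<le> 1 \<Longrightarrow> wave_length r (4*pi) > 0"
  using wave_length_strict_mono[of r 0 "4*pi"] by simp

lemma wave_length_inj:
  "0 \<le> r \<Longrightarrow> r \<le> 1 \<Longrightarrow> 0 \<le> x \<Longrightarrow> 0 \<le> x' \<Longrightarrow> wave_length r x = wave_length r x' \<Longrightarrow> x = x'"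
  using wave_length_strict_mono[of r x x'] wave_length_strict_mono[of r x' x] by force

lemma wave_param_exists:
  assumes "0 \<le> r" "r \<le> 1" "s \<in> {0..2*pi}"
  shows "\<exists>x\<in>{0..4*pi}. 2 * pi * wave_length r x = s * wave_length r (4*pi)"
proof -
  have "continuous_on {0..4*pi} (\<lambda>x. (\<lambda>(r, x). wave_length r x) (r, x))"
    using assms by (intro continuous_on_compose2[OF continuous_on_wave_length] continuous_intros) auto
  then have "continuous_on {0..4*pi} (\<lambda>x. 2 * pi * wave_length r x)" by (intro continuous_intros) simp
  moreover have "s * wave_length r (4*pi) \<le> 2 * pi * wave_length r (4*pi)"
    using assms wave_length_total_pos[OF assms(1,2)] by (intro mult_right_mono) auto
  moreover have "0 \<le> s * wave_length r (4*pi)"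
    using assms wave_length_total_pos[OF assms(1,2)] by simp
  ultimately show ?thesis
    using IVT'[of "\<lambda>x. 2 * pi * wave_length r x" 0 "s * wave_length r (4*pi)" "4*pi"] by force
qed

lemma wave_param_eqI:
  assumes "0 \<le> r" "r \<le> 1" "x \<in> {0..4*pi}" "2 * pi * wave_length r x = s * wave_length r (4*pi)"
  shows "wave_param r s = x"
  unfolding wave_param_def
proof (rule the_equality)
  fix y assume y: "y \<in> {0..4*pi} \<and> 2 * pi * wave_length r y = s * wave_length r (4*pi)"
  then have "2 * pi * wave_length r y = 2 * pi * wave_length r x" using assms(4) by metis
  then have "wave_length r y = wave_length r x" by simp
  moreover have "0 \<le> y" "0 \<le> x" using y assms(3) atLeastAtMost_iff by blast+
  ultimately show "y = x" using wave_length_inj[OF assms(1,2)] by blast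
qed (use assms in blast)

lemma wave_param:
  assumes "0 \<le> r" "r \<le> 1" "s \<in> {0..2*pi}"
  shows "wave_param r s \<in> {0..4*pi}" "2 * pi * wave_length r (wave_param r s) = s * wave_length r (4*pi)"
  using wave_param_exists[OF assms] wave_param_eqI[OF assms(1,2)] by auto

lemma wave_param_0: "0 \<le> r \<Longrightarrow> r \<le> 1 \<Longrightarrow> wave_param r 0 = 0"
  by (rule wave_param_eqI) auto

lemma wave_param_2pi: "0 \<le> r \<Longrightarrow> r \<le> 1 \<Longrightarrow> wave_param r (2*pi) = 4*pi"
  by (rule wave_param_eqI) auto

lemma wave_param_inj:
  assumes "0 \<le> r" "r \<le> 1" "s \<in> {0..2*pi}" "s' \<in> {0..2*pi}" "wave_param r s = wave_param r s'"
  shows "s = s'"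
proof -
  have "s * wave_length r (4*pi) = s' * wave_length r (4*pi)"
    using wave_param(2)[OF assms(1-3)] wave_param(2)[OF assms(1,2,4)] assms(5) by metis
  then show ?thesis using wave_length_total_pos[OF assms(1,2)] by simp
qed

lemma wave_param_surj:
  assumes "0 \<le> r" "r \<le> 1" "x \<in> {0..4*pi}"
  obtains s where "s \<in> {0..2*pi}" "wave_param r s = x"
proof
  let ?s = "2 * pi * wave_length r x / wave_length r (4*pi)"
  note p = wave_length_total_pos[OF assms(1,2)]
  have "0 \<le> wave_length r x" using wave_length_strict_mono[of r 0 x] assms by (cases "x = 0") auto
  moreover have "wave_length r x \<le> wave_length r (4*pi)"
    using wave_length_strict_mono[of r x "4*pi"] assms by (cases "x = 4*pi") auto
  ultimately show "?s \<in> {0..2*pi}" using p by (auto simp: divide_le_eq)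
  show "wave_param r ?s = x" by (rule wave_param_eqI) (use assms p in auto)
qed

text \<open>The continuous bijection \<open>(r, x) \<mapsto> (r, s)\<close> of compact rectangles has a continuous inverse.\<close>

lemma continuous_on_wave_param: "continuous_on ({0..1} \<times> {0..2*pi}) (\<lambda>(r, s). wave_param r s)"
proof -
  define F where "F = (\<lambda>(r, x). (r, 2 * pi * wave_length r x / wave_length r (4*pi)))"
  define G where "G = (\<lambda>(r, s). (r, wave_param r s))"
  have ne: "wave_length r (4*pi) \<noteq> 0" if "0 \<le> r" "r \<le> 1" for r
    using wave_length_total_pos[OF that] by simp
  have c1: "continuous_on ({0..1} \<times> {0..4*pi}) (\<lambda>(r, x). wave_length r x)"
    by (rule continuous_on_subset[OF continuous_on_wave_length]) auto
  have "continuous_on ({0..1} \<times> {0..4*pi}) (\<lambda>z. (\<lambda>(r, x). wave_length r x) (fst z, 4*pi))"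
    by (rule continuous_on_compose2[OF continuous_on_wave_length]) (auto intro!: continuous_intros)
  then have "continuous_on ({0..1} \<times> {0..4*pi}) F"
    unfolding F_def case_prod_beta using c1 ne
    by (intro continuous_intros) (auto simp: case_prod_beta)
  moreover have "compact ({0..1::real} \<times> {0..4*pi})" by (intro compact_Times) auto
  moreover have "\<forall>z\<in>{0..1} \<times> {0..4*pi}. G (F z) = z"
    using ne by (auto simp: F_def G_def intro!: wave_param_eqI)
  ultimately have "continuous_on (F ` ({0..1} \<times> {0..4*pi})) G" by (rule continuous_on_inv)
  moreover have "{0..1} \<times> {0..2*pi} \<subseteq> F ` ({0..1} \<times> {0..4*pi})"
  proof clarify
    fix r s :: real assume "r \<in> {0..1}" "s \<in> {0..2*pi}"
    then show "(r, s) \<in> F ` ({0..1} \<times> {0..4*pi})"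
      using wave_param[of r s] ne[of r] by (intro image_eqI[of _ _ "(r, wave_param r s)"]) (auto simp: F_def)
  qed
  ultimately have "continuous_on ({0..1} \<times> {0..2*pi}) G" by (rule continuous_on_subset)
  then have "continuous_on ({0..1} \<times> {0..2*pi}) (\<lambda>z. snd (G z))" by (intro continuous_intros)
  then show ?thesis by (simp add: G_def case_prod_beta)
qed

section \<open>Monotonicity and range of the two angles\<close>

lemma circle_angle_0: "circle_angle r 0 = 0" and circle_angle_4pi: "circle_angle r (4*pi) = 2*pi"
  by (simp_all add: circle_angle_def skew_def sin_times_pi_eq_0[of 4, simplified])

lemma wave_angle_0: "wave_angle r 0 = 0" and wave_angle_4pi: "wave_angle r (4*pi) = 2*pi"
  by (simp_all add: wave_angle_def skew_def sin_times_pi_eq_0[of 4, simplified])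

lemma circle_angle_has_derivative:
  assumes "0 \<le> r" "r \<le> 1" "r < 1 \<or> cos x \<noteq> 0"
  shows "(circle_angle r has_real_derivative (1 + skew_deriv r x) / 2) (at x)"
  unfolding circle_angle_def using skew_has_derivative[OF assms]
  by (auto intro!: derivative_eq_intros)

lemma wave_angle_has_derivative:
  assumes "0 \<le> r" "r \<le> 1" "r < 1 \<or> cos x \<noteq> 0"
  shows "(wave_angle r has_real_derivative (1 - skew_deriv r x) / 2) (at x)"
  unfolding wave_angle_def using skew_has_derivative[OF assms]
  by (auto intro!: derivative_eq_intros)

lemma continuous_on_angles: 
  assumes "0 \<le> r" "r \<le> 1"
  shows "continuous_on S (circle_angle r)" "continuous_on S (wave_angle r)"
proof -
  have "continuous_on S (skew r)" unfolding skew_def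
    by (intro continuous_intros) (use abs_mult_sin_le[OF assms] in \<open>auto simp: abs_le_iff\<close>)
  then show "continuous_on S (circle_angle r)" "continuous_on S (wave_angle r)"
    unfolding circle_angle_def wave_angle_def by (auto intro!: continuous_intros)
qed

lemma circle_angle_strict_mono:
  assumes "0 \<le> r" "r < 1" "x < x'" shows "circle_angle r x < circle_angle r x'"
proof (rule DERIV_pos_imp_increasing[OF assms(3)])
  fix y
  have "\<bar>skew_deriv r y\<bar> < 1" using skew_deriv_le[of r y] assms by linarith
  then show "\<exists>d. (circle_angle r has_real_derivative d) (at y) \<and> 0 < d"
    using circle_angle_has_derivative[of r y] assms
    by (intro exI[of _ "(1 + skew_deriv r y) / 2"]) auto
qed

text \<open>At r = 1 differentiability fails at the corners, so the inequality is taken as the limit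
  of the strict ones for r < 1.\<close>

lemma circle_angle_mono:
  assumes "0 \<le> r" "r \<le> 1" "x \<le> x'" shows "circle_angle r x \<le> circle_angle r x'"
proof (cases "r < 1")
  case True
  then show ?thesis using circle_angle_strict_mono[of r x x'] assms by (cases "x = x'") auto
next
  case False
  define \<rho> :: "nat \<Rightarrow> real" where "\<rho> n = 1 - inverse (real (Suc n))" for n
  have "(\<lambda>n. 1 - inverse (real (Suc n))) \<longlonglongrightarrow> 1 - 0"
    by (intro tendsto_intros LIMSEQ_inverse_real_of_nat)
  then have l: "\<rho> \<longlonglongrightarrow> 1" unfolding \<rho>_def by simp
  have \<rho>: "0 \<le> \<rho> n" "\<rho> n < 1" for n by (auto simp: \<rho>_def inverse_eq_divide)
  have "continuous_on {0..1} (\<lambda>r. (\<lambda>(r, x). circle_angle r x) (r, y))" for y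
    by (intro continuous_on_compose2[OF continuous_on_circle_angle] continuous_intros) auto
  then have "(\<lambda>n. circle_angle (\<rho> n) y) \<longlonglongrightarrow> circle_angle 1 y" for y
    using continuous_on_tendsto_compose[of "{0..1}" "\<lambda>r. circle_angle r y" \<rho> 1, OF _ l] \<rho>
    by (auto simp: less_imp_le)
  moreover have "circle_angle (\<rho> n) x \<le> circle_angle (\<rho> n) x'" for n
    using circle_angle_strict_mono[of "\<rho> n" x x'] \<rho>[of n] assms by (cases "x = x'") auto
  moreover have "r = 1" using False assms by simp
  ultimately show ?thesis by (blast intro: LIMSEQ_le)
qed

lemma circle_angle_range:
  assumes "0 \<le> r" "r \<le> 1" "x \<in> {0..4*pi}" shows "circle_angle r x \<in> {0..2*pi}"
  using circle_angle_mono[OF assms(1,2), of 0 x] circle_angle_mono[OF assms(1,2), of x "4*pi"] assms(3)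
  by (simp add: circle_angle_0 circle_angle_4pi)

lemma circle_angle_surj:
  assumes "0 \<le> r" "r \<le> 1" "u \<in> {0..2*pi}"
  obtains x where "x \<in> {0..4*pi}" "circle_angle r x = u"
  using IVT'[of "circle_angle r" 0 u "4*pi"] assms continuous_on_angles(1)[OF assms(1,2)]
  by (auto simp: circle_angle_0 circle_angle_4pi)

lemma wave_angle_surj:
  assumes "0 \<le> r" "r \<le> 1" shows "\<exists>x. wave_angle r x = y"
proof -
  \<comment> \<open>\<open>wave_angle r x\<close> differs from x / 2 by at most \<pi>/4, so these
    two points bracket y.\<close>
  let ?a = "2 * y - 2 * pi" and ?b = "2 * y + 2 * pi"
  have "wave_angle r ?a \<le> y" "y \<le> wave_angle r ?b"
    using abs_skew_le[OF assms, of ?a] abs_skew_le[OF assms, of ?b] pi_gt_zero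
    by (auto simp: wave_angle_def field_simps abs_le_iff)
  moreover have "?a \<le> ?b" by simp
  ultimately show ?thesis
    using IVT'[of "wave_angle r" ?a y ?b] continuous_on_angles(2)[OF assms] by blast
qed

text \<open>\<open>arc_len\<close> differentiates c, while only c1, that is c after v, is explicit.
  Since v' > 0, the inverse g of v is differentiable, c has speed |c1'| / v' at corresponding
  points, and L after g is an antiderivative of it. The derivative of L is asked for only at x > 0
  because L is in practice an integral from 0.\<close>

lemma arc_len_reparam:
  fixes c c1 :: "real \<Rightarrow> 'a::real_normed_vector"
  assumes v: "\<And>x. (v has_real_derivative v' x) (at x)" "\<And>x. v' x > 0" "v 0 = 0" "\<And>y. \<exists>x. v x = y"
    and c: "\<And>x. c (v x) = c1 x" "\<And>x. (c1 has_vector_derivative c1' x) (at x)"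
    and L: "\<And>x. x > 0 \<Longrightarrow> (L has_real_derivative norm (c1' x)) (at x)" "continuous_on {0..} L" "L 0 = 0"
    and x: "x \<ge> 0"
  shows "arc_len c (v x) = L x"
proof -
  have mono: "x < y \<Longrightarrow> v x < v y" for x y
    by (rule DERIV_pos_imp_increasing) (use v in auto)
  then have inj: "inj v" by (intro strict_mono_imp_inj_on strict_monoI)
  define g where "g = inv_into UNIV v"
  have gv: "g (v x) = x" and vg: "v (g y) = y" for x y
    using inj v(4) by (auto simp: g_def intro!: f_inv_into_f) (metis rangeI)
  have g_mono: "y < z \<Longrightarrow> g y < g z" for y z
    using mono vg by (metis linorder_neqE_linordered_idom order_less_asym)
  have g0: "g 0 = 0" using gv[of 0] v(3) by simp
  have contv: "isCont v x" for x using v(1) DERIV_isCont by blast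
  have contg: "isCont g y" for y
    using isCont_inverse_function[of 1 "g y" g v] gv contv vg by simp
  have dg: "(g has_real_derivative inverse (v' (g y))) (at y)" for y
    by (rule DERIV_inverse_function[where a="y - 1" and b="y + 1"]) (use v(1) v(2)[of "g y"] vg contg in auto)
  have cg: "c = c1 \<circ> g" using c(1) vg by (auto simp: fun_eq_iff) (metis vg)
  have dc: "(c has_vector_derivative inverse (v' (g y)) *\<^sub>R c1' (g y)) (at y)" for y
    unfolding cg using dg[of y] c(2) by (intro vector_diff_chain_at) (auto simp: has_real_derivative_iff_has_vector_derivative)
  have norm_c: "norm (vector_derivative c (at y)) = norm (c1' (g y)) * inverse (v' (g y))" for y
    using v(2)[of "g y"] by (simp add: vector_derivative_at[OF dc])
  have "((\<lambda>y. norm (vector_derivative c (at y))) has_integral (L \<circ> g) (v x) - (L \<circ> g) 0) {0..v x}"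
  proof (rule fundamental_theorem_of_calculus_interior)
    show "0 \<le> v x" using x mono[of 0 x] v(3) by (cases "x = 0") auto
    show "continuous_on {0..v x} (L \<circ> g)"
    proof (rule continuous_on_compose)
      show "continuous_on {0..v x} g" using contg by (simp add: continuous_at_imp_continuous_on)
      show "continuous_on (g ` {0..v x}) L"
        by (rule continuous_on_subset[OF L(2)]) (use g_mono g0 in \<open>force simp: le_less\<close>)
    qed
    fix y assume "y \<in> {0<..<v x}"
    then have "g y > 0" using g_mono[of 0 y] g0 by simp
    then have "((\<lambda>y. L (g y)) has_real_derivative norm (c1' (g y)) * inverse (v' (g y))) (at y)"
      using DERIV_chain2[OF L(1) dg] by simp
    then show "((L \<circ> g) has_vector_derivative norm (vector_derivative c (at y))) (at y)"
      by (simp add: norm_c has_real_derivative_iff_has_vector_derivative comp_def)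
  qed
  then show ?thesis unfolding arc_len_def by (simp add: integral_unique gv g0 L(3))
qed

text \<open>The choice in \<open>arc_param\<close> may pick any admissible v, so c has to take the
  value p at all of them; v0 shows that there is one.\<close>

lemma arc_param_eqI:
  assumes "v0 \<in> {0..l}" "2 * pi * arc_len c v0 = s * arc_len c l"
    and "\<And>v. v \<in> {0..l} \<Longrightarrow> 2 * pi * arc_len c v = s * arc_len c l \<Longrightarrow> c v = p"
  shows "arc_param c l s = p"
  unfolding arc_param_def
  using someI[of "\<lambda>v. v \<in> {0..l} \<and> 2 * pi * arc_len c v = s * arc_len c l" v0] assms by blast

section \<open>The great circles\<close>

text \<open>The point with coordinates \<open>P\<close>, \<open>a\<close>, \<open>(\<phi>, Q)\<close> lies in \<open>X_\<theta>\<close> iff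
  \<open>P Q sin (\<theta>/2) = R S sin (\<theta>/2 - \<phi>)\<close>, which for fixed \<open>P\<close> is a linear condition on the point
  \<open>(S cis \<phi>, Q)\<close> of the sphere. It cuts out a great circle through \<open>(cis (\<theta>/2), 0)\<close>, whose direction
  there has the components \<open>tilt\<close> and \<open>amplitude\<close>.\<close>

definition tilt :: "real \<Rightarrow> real \<Rightarrow> real" where
  "tilt \<theta> P = P * sin (\<theta>/2) / sqrt (1 - P\<^sup>2 * (cos (\<theta>/2))\<^sup>2)"

definition amplitude :: "real \<Rightarrow> real \<Rightarrow> real" where
  "amplitude \<theta> P = sqrt (1 - P\<^sup>2) / sqrt (1 - P\<^sup>2 * (cos (\<theta>/2))\<^sup>2)"

text \<open>The r that belongs to k = |tilt|. As k \<mapsto> (1 - k) / (1 + k) is an involution of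
  [0, 1], modulus 1 is the square wave at P = 0, and modulus 0 the flat wave at P = 1 or P =
  -1.\<close>

definition modulus :: "real \<Rightarrow> real \<Rightarrow> real" where
  "modulus \<theta> P = (1 - \<bar>tilt \<theta> P\<bar>) / (1 + \<bar>tilt \<theta> P\<bar>)"

text \<open>The minus sign makes \<phi> decrease from \<theta>/2 when P > 0, as in
  \<open>wave\<close>; for P < 0 the sign of \<open>tilt\<close> reverses it.\<close>

definition great_circle :: "real \<Rightarrow> real \<Rightarrow> real \<Rightarrow> complex \<times> real" where
  "great_circle \<theta> P u =
     (cis (\<theta>/2) * Complex (cos u) (- (tilt \<theta> P * sin u)), amplitude \<theta> P * sin u)"

lemma sin_half_pos: "\<theta> \<in> {0<..pi} \<Longrightarrow> sin (\<theta>/2) > 0"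
  by (rule sin_gt_zero) auto

lemma tilt_denominator_pos:
  assumes "\<theta> \<in> {0<..pi}" "P \<in> {-1..1}" shows "1 - P\<^sup>2 * (cos (\<theta>/2))\<^sup>2 > 0"
proof -
  have "(cos (\<theta>/2))\<^sup>2 < 1" using sin_half_pos[OF assms(1)] by (simp add: cos_squared_eq)
  moreover have "P\<^sup>2 \<le> 1" using assms(2) by (simp add: abs_square_le_1 abs_le_iff)
  then have "P\<^sup>2 * (cos (\<theta>/2))\<^sup>2 \<le> 1 * (cos (\<theta>/2))\<^sup>2" by (rule mult_right_mono) simp
  ultimately show ?thesis by linarith
qed

text \<open>The common denominator normalizes the direction: P^2 (sin (\<theta>/2))^2 + 1 - P^2
  equals 1 - P^2 (cos (\<theta>/2))^2. The last two equations translate the pair (k, h) of the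
  circle into the parameter r of the wave.\<close>

lemma tilt_amplitude:
  assumes "\<theta> \<in> {0<..pi}" "P \<in> {-1..1}"
  shows "(tilt \<theta> P)\<^sup>2 + (amplitude \<theta> P)\<^sup>2 = 1" "0 \<le> amplitude \<theta> P" "\<bar>tilt \<theta> P\<bar> \<le> 1"
    "0 \<le> modulus \<theta> P" "modulus \<theta> P \<le> 1"
    "(1 - modulus \<theta> P) / (1 + modulus \<theta> P) = \<bar>tilt \<theta> P\<bar>" "height (modulus \<theta> P) = amplitude \<theta> P"
proof -
  let ?D = "1 - P\<^sup>2 * (cos (\<theta>/2))\<^sup>2"
  have D: "?D > 0" by (rule tilt_denominator_pos[OF assms])
  have P: "P\<^sup>2 \<le> 1" using assms(2) by (simp add: abs_square_le_1 abs_le_iff)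
  have "(tilt \<theta> P)\<^sup>2 + (amplitude \<theta> P)\<^sup>2 = (P\<^sup>2 * (sin (\<theta>/2))\<^sup>2 + (1 - P\<^sup>2)) / ?D"
    using D P by (simp add: tilt_def amplitude_def power_divide power_mult_distrib add_divide_distrib)
  also have "P\<^sup>2 * (sin (\<theta>/2))\<^sup>2 + (1 - P\<^sup>2) = ?D" by (simp add: sin_squared_eq algebra_simps)
  finally show 1: "(tilt \<theta> P)\<^sup>2 + (amplitude \<theta> P)\<^sup>2 = 1" using D by simp
  show 2: "0 \<le> amplitude \<theta> P" using D P by (simp add: amplitude_def)
  have "(tilt \<theta> P)\<^sup>2 \<le> 1" using 1 zero_le_power2[of "amplitude \<theta> P"] by linarith
  then show 3: "\<bar>tilt \<theta> P\<bar> \<le> 1" by (simp add: abs_square_le_1)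
  show 4: "0 \<le> modulus \<theta> P" "modulus \<theta> P \<le> 1" using 3 by (auto simp: modulus_def divide_simps)
  have ne: "1 + \<bar>tilt \<theta> P\<bar> > 0" by linarith
  define m where "m = modulus \<theta> P"
  define k where "k = \<bar>tilt \<theta> P\<bar>"
  have mk: "m * (1 + k) = 1 - k" using ne by (simp add: m_def k_def modulus_def)
  have "1 + m > 0" using 4 by (simp add: m_def)
  then show k: "(1 - modulus \<theta> P) / (1 + modulus \<theta> P) = \<bar>tilt \<theta> P\<bar>"
    unfolding m_def[symmetric] k_def[symmetric] using mk by (simp add: field_simps)
  have "(height (modulus \<theta> P))\<^sup>2 = (amplitude \<theta> P)\<^sup>2"
  proof -
    have "(amplitude \<theta> P)\<^sup>2 = 1 - ((1 - m) / (1 + m))\<^sup>2" using 1 k by (simp add: m_def[symmetric])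
    also have "\<dots> = (2 * sqrt m / (1 + m))\<^sup>2"
      using \<open>1 + m > 0\<close> 4 by (simp add: m_def[symmetric] power_divide power_mult_distrib field_simps)
        (simp add: power2_eq_square algebra_simps)
    finally show ?thesis by (simp add: height_def m_def)
  qed
  then show "height (modulus \<theta> P) = amplitude \<theta> P"
    using 2 height_bounds(1)[OF 4] by (simp add: power2_eq_iff_nonneg)
qed

lemma tilt_eq_0: "\<theta> \<in> {0<..pi} \<Longrightarrow> P \<in> {-1..1} \<Longrightarrow> tilt \<theta> P = 0 \<longleftrightarrow> P = 0"
  using sin_half_pos[of \<theta>] tilt_denominator_pos[of \<theta> P] by (auto simp: tilt_def)

lemma sgn_tilt: "\<theta> \<in> {0<..pi} \<Longrightarrow> P \<in> {-1..1} \<Longrightarrow> sgn P * \<bar>tilt \<theta> P\<bar> = tilt \<theta> P"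
  using sin_half_pos[of \<theta>] tilt_denominator_pos[of \<theta> P] by (auto simp: tilt_def abs_mult sgn_if)

lemma modulus_less_1: "\<theta> \<in> {0<..pi} \<Longrightarrow> P \<in> {-1..1} \<Longrightarrow> P \<noteq> 0 \<Longrightarrow> modulus \<theta> P < 1"
  using tilt_eq_0[of \<theta> P] by (simp add: modulus_def divide_simps)

lemma tilt_P_0 [simp]: "tilt \<theta> 0 = 0" "amplitude \<theta> 0 = 1" "modulus \<theta> 0 = 1"
  by (simp_all add: tilt_def amplitude_def modulus_def)

lemma amplitude_eq_0: 
  assumes "\<theta> \<in> {0<..pi}" "P \<in> {-1..1}" shows "amplitude \<theta> P = 0 \<longleftrightarrow> P\<^sup>2 = 1"
  using tilt_denominator_pos[OF assms] by (auto simp: amplitude_def)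

lemma tilt_extreme:
  assumes "\<theta> \<in> {0<..pi}" "P\<^sup>2 = 1" shows "tilt \<theta> P = P" "amplitude \<theta> P = 0" "modulus \<theta> P = 0"
proof -
  have "sqrt (1 - (cos (\<theta>/2))\<^sup>2) = sin (\<theta>/2)"
    using sin_half_pos[OF assms(1)] by (simp add: sin_squared_eq[symmetric])
  then show 1: "tilt \<theta> P = P" using assms sin_half_pos[OF assms(1)] by (simp add: tilt_def)
  show "amplitude \<theta> P = 0" using assms by (simp add: amplitude_def)
  have "\<bar>P\<bar> = 1" using assms(2) by (auto simp: power2_eq_1_iff)
  then show "modulus \<theta> P = 0" by (simp add: modulus_def 1)
qed

lemma continuous_on_tilt:
  "continuous_on ({0<..pi} \<times> {-1..1}) (\<lambda>(\<theta>, P). tilt \<theta> P)"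
  "continuous_on ({0<..pi} \<times> {-1..1}) (\<lambda>(\<theta>, P). amplitude \<theta> P)"
  "continuous_on ({0<..pi} \<times> {-1..1}) (\<lambda>(\<theta>, P). modulus \<theta> P)"
proof -
  have ne: "sqrt (1 - (snd x)\<^sup>2 * (cos (fst x/2))\<^sup>2) \<noteq> 0" if "x \<in> {0<..pi} \<times> {-1..1}" for x :: "real \<times> real"
    using tilt_denominator_pos[of "fst x" "snd x"] that by (auto simp: mem_Times_iff)
  show 1: "continuous_on ({0<..pi} \<times> {-1..1}) (\<lambda>(\<theta>, P). tilt \<theta> P)"
    unfolding tilt_def case_prod_beta by (intro continuous_intros) (use ne in auto)
  show "continuous_on ({0<..pi} \<times> {-1..1}) (\<lambda>(\<theta>, P). amplitude \<theta> P)"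
    unfolding amplitude_def case_prod_beta by (intro continuous_intros) (use ne in auto)
  have "1 + \<bar>tilt (fst x) (snd x)\<bar> \<noteq> 0" for x :: "real \<times> real" by linarith
  then show "continuous_on ({0<..pi} \<times> {-1..1}) (\<lambda>(\<theta>, P). modulus \<theta> P)"
    using 1 unfolding modulus_def case_prod_beta by (intro continuous_intros) auto
qed

text \<open>The relation tan v = k tan u only says that (cos u, k sin u) and (cos v, sin v) are
  parallel. The factor between them is positive because u - v = \<open>skew r x\<close> stays
  strictly between -\<pi>/2 and \<pi>/2, so cos (u - v) > 0.\<close>

lemma angle_relation:
  fixes r k x :: real
  assumes r: "0 \<le> r" "r < 1" and k: "k = (1 - r) / (1 + r)"
  defines "u \<equiv> circle_angle r x" and "v \<equiv> wave_angle r x"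
  defines "n \<equiv> sqrt ((cos u)\<^sup>2 + k\<^sup>2 * (sin u)\<^sup>2)"
  shows "n > 0" "n * sin v = k * sin u" "n * cos v = cos u"
proof -
  have kpos: "k > 0" using r k by simp
  have "sin (u - v) = r * sin (u + v)"
    using sin_skew[of r x] r by (simp add: u_def v_def circle_plus_wave circle_minus_wave)
  then have "(1 + r) * (sin v * cos u) = (1 - r) * (sin u * cos v)"
    by (simp add: sin_diff sin_add algebra_simps)
  then have 1: "sin v * cos u = k * sin u * cos v" using r by (simp add: k field_simps)
  have c: "cos u * cos v + sin u * sin v > 0"
    using cos_skew_pos[OF r, of x] by (simp add: cos_diff[symmetric] u_def v_def circle_minus_wave)
  define \<mu> where "\<mu> = cos u * cos v + k * sin u * sin v"
  have cu: "cos u = \<mu> * cos v"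
  proof -
    have "\<mu> * cos v = cos u * (cos v)\<^sup>2 + (k * sin u * cos v) * sin v"
      by (simp add: \<mu>_def algebra_simps power2_eq_square)
    also have "\<dots> = cos u * ((cos v)\<^sup>2 + (sin v)\<^sup>2)" unfolding 1[symmetric]
      by (simp only: distrib_left power2_eq_square mult_ac)
    finally show ?thesis by simp
  qed
  have su: "k * sin u = \<mu> * sin v"
  proof -
    have "\<mu> * sin v = (sin v * cos u) * cos v + k * sin u * (sin v)\<^sup>2"
      by (simp add: \<mu>_def algebra_simps power2_eq_square)
    also have "\<dots> = k * sin u * ((cos v)\<^sup>2 + (sin v)\<^sup>2)" unfolding 1
      by (simp only: distrib_left power2_eq_square mult_ac)
    finally show ?thesis by simp
  qed
  \<comment> \<open>This carries the sign of cos (u - v) over to \<mu>: k cos (u - v) is \<mu> times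
    a nonnegative number.\<close>
  have "k * (cos u * cos v + sin u * sin v) = k * cos u * cos v + (k * sin u) * sin v"
    by (simp add: algebra_simps)
  also have "\<dots> = \<mu> * (k * (cos v)\<^sup>2 + (sin v)\<^sup>2)"
    unfolding su by (subst cu) (simp add: algebra_simps power2_eq_square)
  finally have "\<mu> * (k * (cos v)\<^sup>2 + (sin v)\<^sup>2) > 0" using c kpos by (metis mult_pos_pos)
  moreover have "k * (cos v)\<^sup>2 + (sin v)\<^sup>2 \<ge> 0" using kpos by simp
  ultimately have \<mu>: "\<mu> > 0" by (simp add: zero_less_mult_iff)
  have "n = sqrt ((\<mu> * cos v)\<^sup>2 + (\<mu> * sin v)\<^sup>2)"
    unfolding n_def by (simp add: power_mult_distrib[symmetric] cu[symmetric] su[symmetric])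
  also have "\<dots> = sqrt (\<mu>\<^sup>2 * ((cos v)\<^sup>2 + (sin v)\<^sup>2))" by (simp only: power_mult_distrib distrib_left)
  also have "\<dots> = \<mu>" using \<mu> by simp
  finally show "n > 0" "n * sin v = k * sin u" "n * cos v = cos u" using \<mu> su cu by simp_all
qed

section \<open>Wave and great circle for fixed \<theta> and P\<close>

context
  fixes \<theta> P :: real
  assumes \<theta>: "\<theta> \<in> {0<..pi}" and P: "P \<in> {-1..1}"
begin

text \<open>With k = |tilt| and h the amplitude, R = h D and |P| = k D / sin (\<theta>/2). The root
  in \<open>wave_height\<close> is then D / sin (\<theta>/2) times sqrt (k^2 + h^2 (sin v)^2), and
  the latter equals k / n by k^2 + h^2 = 1. The height collapses to h n sin v / k = h sin u.\<close>

lemma wave_reparam: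
  assumes "P \<noteq> 0"
  shows "wave \<theta> P (wave_angle (modulus \<theta> P) x) =
     (cis (\<theta>/2 - sgn P * wave_angle (modulus \<theta> P) x), amplitude \<theta> P * sin (circle_angle (modulus \<theta> P) x))" (is ?A)
    and "cyl_to_sphere (wave \<theta> P (wave_angle (modulus \<theta> P) x)) =
     great_circle \<theta> P (circle_angle (modulus \<theta> P) x)" (is ?B)
proof -
  define r where "r = modulus \<theta> P"
  define k where "k = \<bar>tilt \<theta> P\<bar>"
  define h where "h = amplitude \<theta> P"
  define u where "u = circle_angle r x"
  define v where "v = wave_angle r x"
  define n where "n = sqrt ((cos u)\<^sup>2 + k\<^sup>2 * (sin u)\<^sup>2)"
  define D where "D = sqrt (1 - P\<^sup>2 * (cos (\<theta>/2))\<^sup>2)"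
  define \<sigma> where "\<sigma> = sin (\<theta>/2)"
  note ta = tilt_amplitude[OF \<theta> P]
  have r: "0 \<le> r" "r < 1" using ta modulus_less_1[OF \<theta> P assms] by (auto simp: r_def)
  have k: "k = (1 - r) / (1 + r)" "k > 0" using ta r by (auto simp: k_def r_def)
  note ar = angle_relation[OF r k(1), of x, folded u_def v_def, folded n_def]
  have D: "D > 0" using tilt_denominator_pos[OF \<theta> P] by (simp add: D_def)
  have \<sigma>: "\<sigma> > 0" using sin_half_pos[OF \<theta>] by (simp add: \<sigma>_def)
  have kh: "k\<^sup>2 + h\<^sup>2 = 1" using ta by (simp add: k_def h_def)
  have R: "sqrt (1 - P\<^sup>2) = h * D" using D by (simp add: h_def amplitude_def D_def)
  have "\<bar>P\<bar> = k * D / \<sigma>" using D \<sigma> by (simp add: k_def tilt_def D_def[symmetric] \<sigma>_def[symmetric] abs_mult)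
  then have P2: "P\<^sup>2 = (k * D / \<sigma>)\<^sup>2" by (metis power2_abs)
  have "n\<^sup>2 * (k\<^sup>2 + h\<^sup>2 * (sin v)\<^sup>2) = n\<^sup>2 * (k\<^sup>2 * (cos v)\<^sup>2 + (k\<^sup>2 + h\<^sup>2) * (sin v)\<^sup>2)"
    by (simp add: cos_squared_eq algebra_simps)
  also have "\<dots> = k\<^sup>2 * (n * cos v)\<^sup>2 + (n * sin v)\<^sup>2" unfolding kh by (simp add: power_mult_distrib algebra_simps)
  also have "\<dots> = k\<^sup>2 * ((cos u)\<^sup>2 + (sin u)\<^sup>2)" unfolding ar by (simp only: power_mult_distrib distrib_left)
  finally have "k\<^sup>2 + h\<^sup>2 * (sin v)\<^sup>2 = (k / n)\<^sup>2" using ar(1) by (simp add: field_simps power_divide)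
  then have "P\<^sup>2 + (sin v / \<sigma>)\<^sup>2 * (h * D)\<^sup>2 = (D / \<sigma> * (k / n))\<^sup>2"
    unfolding P2
  proof -
    have "(k * D / \<sigma>)\<^sup>2 + (sin v / \<sigma>)\<^sup>2 * (h * D)\<^sup>2 = (D / \<sigma>)\<^sup>2 * (k\<^sup>2 + h\<^sup>2 * (sin v)\<^sup>2)"
      by (simp add: power_mult_distrib power_divide add_divide_distrib algebra_simps)
    also have "\<dots> = (D / \<sigma>)\<^sup>2 * (k / n)\<^sup>2" using \<open>k\<^sup>2 + h\<^sup>2 * (sin v)\<^sup>2 = (k / n)\<^sup>2\<close> by simp
    finally show "(k * D / \<sigma>)\<^sup>2 + (sin v / \<sigma>)\<^sup>2 * (h * D)\<^sup>2 = (D / \<sigma> * (k / n))\<^sup>2"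
      by (simp only: power_mult_distrib)
  qed
  then have sq: "sqrt (P\<^sup>2 + (sin v / \<sigma>)\<^sup>2 * (h * D)\<^sup>2) = D / \<sigma> * (k / n)"
    using D \<sigma> k(2) ar(1) by simp
  have s2: "sgn P * sgn P = 1" using assms by (simp add: sgn_if)
  have "sin (sgn P * v) = sgn P * sin v" using assms by (simp add: sgn_if)
  then have "wave_height \<theta> P (\<theta>/2 - sgn P * v) =
      (sgn P * sgn P) * (sin v / \<sigma> * (h * D)) / sqrt (P\<^sup>2 + ((sgn P * sgn P) * (sin v / \<sigma>)\<^sup>2) * (h * D)\<^sup>2)"
    unfolding wave_height_def Let_def R \<sigma>_def[symmetric]
    by (simp add: power_mult_distrib power_divide power2_eq_square[of "sgn P"] mult_ac)
  also have "\<dots> = sin v / \<sigma> * (h * D) / (D / \<sigma> * (k / n))" unfolding s2 mult_1 sq ..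
  also have "\<dots> = h * (n * sin v) / k" using D \<sigma> k(2) ar(1) by (simp add: field_simps)
  also have "\<dots> = h * sin u" using k(2) by (simp add: ar)
  finally have wh: "wave_height \<theta> P (\<theta>/2 - sgn P * v) = h * sin u" .
  show A: ?A unfolding wave_def Let_def r_def[symmetric] v_def[symmetric] u_def[symmetric] h_def[symmetric] wh ..
  have "1 - (h * sin u)\<^sup>2 = (cos u)\<^sup>2 + (1 - h\<^sup>2) * (sin u)\<^sup>2"
    by (simp add: cos_squared_eq power_mult_distrib algebra_simps)
  also have "1 - h\<^sup>2 = k\<^sup>2" using kh by simp
  finally have nn: "sqrt (1 - (h * sin u)\<^sup>2) = n" by (simp add: n_def)
  have "of_real n * cis (\<theta>/2 - sgn P * v) = cis (\<theta>/2) * (of_real n * cis (- (sgn P * v)))"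
    using cis_mult[of "\<theta>/2" "- (sgn P * v)"] by (simp add: mult.left_commute)
  also have "of_real n * cis (- (sgn P * v)) = Complex (n * cos v) (- (sgn P * (n * sin v)))"
    using assms by (auto simp: complex_eq_iff sgn_if)
  also have "\<dots> = Complex (cos u) (- (tilt \<theta> P * sin u))"
    using sgn_tilt[OF \<theta> P] unfolding ar k_def by (simp add: mult.assoc[symmetric])
  finally show ?B
    unfolding A unfolding r_def[symmetric] v_def[symmetric] u_def[symmetric] h_def[symmetric]
    by (simp add: cyl_to_sphere_def great_circle_def nn h_def[symmetric])
qed

lemma great_circle_has_derivative:
  "\<exists>d. (great_circle \<theta> P has_vector_derivative d) (at u) \<and> norm d = 1"
proof -
  let ?d = "(cis (\<theta>/2) * Complex (- sin u) (- (tilt \<theta> P * cos u)), amplitude \<theta> P * cos u)"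
  have "((\<lambda>u. cis (\<theta>/2) * (of_real (cos u) - \<i> * of_real (tilt \<theta> P * sin u)))
      has_vector_derivative cis (\<theta>/2) * (of_real (- sin u) - \<i> * of_real (tilt \<theta> P * cos u))) (at u)"
    by (intro derivative_eq_intros has_vector_derivative_mult_right has_vector_derivative_diff
        has_vector_derivative_of_real) (auto simp: has_real_derivative_iff_has_vector_derivative[symmetric] intro!: derivative_eq_intros)
  then have "((\<lambda>u. cis (\<theta>/2) * Complex (cos u) (- (tilt \<theta> P * sin u)))
      has_vector_derivative cis (\<theta>/2) * Complex (- sin u) (- (tilt \<theta> P * cos u))) (at u)"
    by (simp add: complex_eq_iff[of _ "Complex _ _"] Complex_eq)
  moreover have "((\<lambda>u. amplitude \<theta> P * sin u) has_vector_derivative amplitude \<theta> P * cos u) (at u)"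
    by (auto simp: has_real_derivative_iff_has_vector_derivative[symmetric] intro!: derivative_eq_intros)
  ultimately have "(great_circle \<theta> P has_vector_derivative ?d) (at u)"
    unfolding great_circle_def by (intro has_vector_derivative_Pair)
  moreover have "(norm ?d)\<^sup>2 = (sin u)\<^sup>2 + ((tilt \<theta> P)\<^sup>2 + (amplitude \<theta> P)\<^sup>2) * (cos u)\<^sup>2"
    by (simp add: norm_Pair norm_mult cmod_power2 power_mult_distrib algebra_simps)
  then have "(norm ?d)\<^sup>2 = 1" using tilt_amplitude[OF \<theta> P] by simp
  then have "norm ?d = 1" using norm_ge_zero[of ?d] by (simp only: power2_eq_1_iff) linarith
  ultimately show ?thesis by blast
qed

lemma wave_angle_preimage:
  assumes "P \<noteq> 0" "v \<in> {0..2*pi}"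
  obtains x where "x \<in> {0..4*pi}" "v = wave_angle (modulus \<theta> P) x"
proof -
  note r = tilt_amplitude(4,5)[OF \<theta> P]
  show ?thesis
    using IVT'[of "wave_angle (modulus \<theta> P)" 0 v "4*pi"] assms(2) continuous_on_angles(2)[OF r] that
    by (auto simp: wave_angle_0 wave_angle_4pi)
qed

lemma wave_angle_range:
  assumes "P \<noteq> 0" "x \<in> {0..4*pi}" shows "wave_angle (modulus \<theta> P) x \<in> {0..2*pi}"
proof -
  note r = tilt_amplitude(4,5)[OF \<theta> P] modulus_less_1[OF \<theta> P assms(1)]
  have mono: "wave_angle (modulus \<theta> P) x \<le> wave_angle (modulus \<theta> P) y" if "x \<le> y" for x y
  proof (rule DERIV_nonneg_imp_nondecreasing[OF that])
    fix y
    have "\<bar>skew_deriv (modulus \<theta> P) y\<bar> \<le> 1" using skew_deriv_le[OF r(1,2), of y] r by linarith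
    then show "\<exists>d. (wave_angle (modulus \<theta> P) has_real_derivative d) (at y) \<and> 0 \<le> d"
      using wave_angle_has_derivative[OF r(1,2), of y] r(3)
      by (intro exI[of _ "(1 - skew_deriv (modulus \<theta> P) y) / 2"]) auto
  qed
  show ?thesis using mono[of 0 x] mono[of x "4*pi"] assms(2) by (simp add: wave_angle_0 wave_angle_4pi)
qed

lemma wave_arc_len_reparam:
  fixes c c1 :: "real \<Rightarrow> 'a::real_normed_vector"
  assumes "P \<noteq> 0" "\<And>x. c (wave_angle (modulus \<theta> P) x) = c1 x"
    and "\<And>x. (c1 has_vector_derivative c1' x) (at x)"
    and "\<And>x. x > 0 \<Longrightarrow> (L has_real_derivative norm (c1' x)) (at x)" "continuous_on {0..} L" "L 0 = 0"
    and "x \<ge> 0"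
  shows "arc_len c (wave_angle (modulus \<theta> P) x) = L x"
proof (rule arc_len_reparam[where v = "wave_angle (modulus \<theta> P)" and
      v' = "\<lambda>x. (1 - skew_deriv (modulus \<theta> P) x) / 2" and ?c1.0 = c1 and c1' = c1'])
  note r = tilt_amplitude(4,5)[OF \<theta> P] modulus_less_1[OF \<theta> P assms(1)]
  show "(wave_angle (modulus \<theta> P) has_real_derivative (1 - skew_deriv (modulus \<theta> P) x) / 2) (at x)" for x
    using wave_angle_has_derivative r by blast
  have "\<bar>skew_deriv (modulus \<theta> P) x\<bar> < 1" for x using skew_deriv_le[OF r(1,2), of x] r by linarith
  then show "(1 - skew_deriv (modulus \<theta> P) x) / 2 > 0" for x by (auto simp: abs_less_iff)
  show "\<exists>x. wave_angle (modulus \<theta> P) x = y" for y by (rule wave_angle_surj[OF r(1,2)])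
qed (use assms in \<open>auto simp: wave_angle_0\<close>)

text \<open>The great circle has unit speed, so normalized arc length on the sphere is the angle u
  itself, with total 2\<pi>.\<close>

lemma gamma_sphere_nonzero:
  assumes "P \<noteq> 0" "s \<in> {0..2*pi}" shows "gamma_sphere \<theta> P s = great_circle \<theta> P s"
proof -
  define r where "r = modulus \<theta> P"
  have r: "0 \<le> r" "r \<le> 1" "r < 1"
    using tilt_amplitude(4,5)[OF \<theta> P] modulus_less_1[OF \<theta> P assms(1)] by (auto simp: r_def)
  let ?c = "cyl_to_sphere \<circ> wave \<theta> P"
  have cw: "?c (wave_angle r x) = great_circle \<theta> P (circle_angle r x)" for x
    using wave_reparam(2)[OF assms(1)] by (simp add: r_def)
  obtain d where d: "(great_circle \<theta> P has_vector_derivative d u) (at u)" "norm (d u) = 1" for u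
    using great_circle_has_derivative by metis
  have sd: "\<bar>skew_deriv r x\<bar> \<le> 1" for x using skew_deriv_le[OF r(1,2), of x] r by linarith
  have len: "arc_len ?c (wave_angle r x) = circle_angle r x" if "x \<ge> 0" for x
  proof (rule wave_arc_len_reparam[folded r_def, where ?c1.0 = "great_circle \<theta> P \<circ> circle_angle r"
        and c1' = "\<lambda>x. ((1 + skew_deriv r x) / 2) *\<^sub>R d (circle_angle r x)"])
    show "?c (wave_angle r x) = (great_circle \<theta> P \<circ> circle_angle r) x" for x using cw by simp
    show "(great_circle \<theta> P \<circ> circle_angle r has_vector_derivative
        ((1 + skew_deriv r x) / 2) *\<^sub>R d (circle_angle r x)) (at x)" for x
      using circle_angle_has_derivative[of r x] r d(1)
      by (intro vector_diff_chain_at) (auto simp: has_real_derivative_iff_has_vector_derivative)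
    show "(circle_angle r has_real_derivative norm (((1 + skew_deriv r x) / 2) *\<^sub>R d (circle_angle r x))) (at x)" for x
      using circle_angle_has_derivative[of r x] r sd[of x] d(2) by (auto simp: abs_le_iff)
    show "continuous_on {0..} (circle_angle r)" by (rule continuous_on_angles[OF r(1,2)])
  qed (use that assms(1) circle_angle_0 in auto)
  have total: "arc_len ?c (2*pi) = 2*pi"
    using len[of "4*pi"] by (simp add: wave_angle_4pi circle_angle_4pi)
  obtain x0 where x0: "x0 \<in> {0..4*pi}" "circle_angle r x0 = s"
    using circle_angle_surj[OF r(1,2) assms(2)] .
  have "arc_param ?c (2*pi) s = great_circle \<theta> P s"
  proof (rule arc_param_eqI)
    show "wave_angle r x0 \<in> {0..2*pi}" using wave_angle_range[OF assms(1) x0(1)] by (simp add: r_def)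
    show "2 * pi * arc_len ?c (wave_angle r x0) = s * arc_len ?c (2*pi)" using len[of x0] x0 total by simp
    fix v assume v: "v \<in> {0..2*pi}" "2 * pi * arc_len ?c v = s * arc_len ?c (2*pi)"
    obtain x where x: "x \<in> {0..4*pi}" "v = wave_angle r x"
      using wave_angle_preimage[OF assms(1) v(1)] unfolding r_def .
    then have "circle_angle r x = s" using v(2) len[of x] total by simp
    then show "?c v = great_circle \<theta> P s" using cw[of x] x(2) by simp
  qed
  then show ?thesis using assms(1) by (simp add: gamma_sphere_def)
qed

text \<open>On the cylinder the azimuth contributes to the length as well, so the length is the
  integral of \<open>speed\<close> instead of u, and passing to normalized arc length requires
  \<open>wave_param\<close>.\<close>

lemma gamma_cyl_eq:
  assumes "P \<noteq> 0" "s \<in> {0..2*pi}"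
  shows "gamma_cyl \<theta> P s =
    (let x = wave_param (modulus \<theta> P) s
     in (cis (\<theta>/2 - sgn P * wave_angle (modulus \<theta> P) x), amplitude \<theta> P * sin (circle_angle (modulus \<theta> P) x)))"
proof -
  define r where "r = modulus \<theta> P"
  define c1 where "c1 = (\<lambda>x. (cis (\<theta>/2 - sgn P * wave_angle r x), amplitude \<theta> P * sin (circle_angle r x)))"
  define e where "e x = - sgn P * ((1 - skew_deriv r x) / 2)" for x
  define c1' where "c1' = (\<lambda>x. (e x *\<^sub>R (\<i> * cis (\<theta>/2 - sgn P * wave_angle r x)),
      amplitude \<theta> P * (cos (circle_angle r x) * ((1 + skew_deriv r x) / 2))))"
  have r: "0 \<le> r" "r \<le> 1" "r < 1"
    using tilt_amplitude(4,5)[OF \<theta> P] modulus_less_1[OF \<theta> P assms(1)] by (auto simp: r_def)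
  have cw: "wave \<theta> P (wave_angle r x) = c1 x" for x
    using wave_reparam(1)[OF assms(1)] by (simp add: r_def c1_def)
  have dc: "(c1 has_vector_derivative c1' x) (at x)" for x
    unfolding c1_def c1'_def
  proof (intro has_vector_derivative_Pair)
    have "((\<lambda>x. \<theta>/2 - sgn P * wave_angle r x) has_real_derivative e x) (at x)"
      using wave_angle_has_derivative[of r x] r unfolding e_def
      by (auto intro!: derivative_eq_intros)
    moreover have "(cis has_vector_derivative \<i> * cis y) (at y)" for y
    proof -
      have "((\<lambda>y. exp (\<i> * of_real y)) has_vector_derivative (\<i> * 1) * exp (\<i> * of_real y)) (at y)"
        by (intro derivative_eq_intros field_vector_diff_chain_at[of _ _ _ exp, unfolded comp_def])
          (auto intro!: derivative_eq_intros has_vector_derivative_of_real simp: has_real_derivative_iff_has_vector_derivative[symmetric])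
      moreover have "cis = (\<lambda>y. exp (\<i> * of_real y))" by (simp add: fun_eq_iff cis_conv_exp)
      ultimately show ?thesis by (simp add: cis_conv_exp[symmetric])
    qed
    ultimately show "((\<lambda>x. cis (\<theta>/2 - sgn P * wave_angle r x)) has_vector_derivative
        e x *\<^sub>R (\<i> * cis (\<theta>/2 - sgn P * wave_angle r x))) (at x)"
      using vector_diff_chain_at[of "\<lambda>x. \<theta>/2 - sgn P * wave_angle r x" "e x" x cis]
      by (simp add: has_real_derivative_iff_has_vector_derivative comp_def)
    show "((\<lambda>x. amplitude \<theta> P * sin (circle_angle r x)) has_vector_derivative
        amplitude \<theta> P * (cos (circle_angle r x) * ((1 + skew_deriv r x) / 2))) (at x)"
      unfolding has_real_derivative_iff_has_vector_derivative[symmetric]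
      by (intro DERIV_cmult DERIV_chain2[OF DERIV_sin] circle_angle_has_derivative) (use r in auto)
  qed
  \<comment> \<open>The sign of P only reverses the azimuth and drops out of the speed.\<close>
  have "(e x)\<^sup>2 = ((1 - skew_deriv r x) / 2)\<^sup>2" for x
    unfolding e_def power_mult_distrib using assms(1) by (simp add: sgn_if)
  then have norm: "norm (c1' x) = speed r x" for x
    using tilt_amplitude(7)[OF \<theta> P]
    unfolding c1'_def norm_Pair speed_def r_def[symmetric] norm_scaleR norm_mult
    by (simp only: real_norm_def power2_abs norm_ii norm_cis mult_1_right mult.assoc abs_mult[symmetric])
  have len: "arc_len (wave \<theta> P) (wave_angle r x) = wave_length r x" if "x \<ge> 0" for x
  proof (rule wave_arc_len_reparam[folded r_def, where ?c1.0 = c1 and c1' = c1'])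
    show "wave \<theta> P (wave_angle r x) = c1 x" for x by (rule cw)
    show "(c1 has_vector_derivative c1' x) (at x)" for x by (rule dc)
    show "(wave_length r has_real_derivative norm (c1' x)) (at x)" if "x > 0" for x
    proof -
      have "((\<lambda>x. integral {0..x} (speed r)) has_real_derivative speed r x) (at x within {0..x+1})"
        by (rule integral_has_real_derivative) (use that continuous_on_speed[OF r(1,3)] in auto)
      moreover have "at x within {0..x+1} = at x" using that by (intro at_within_interior) simp
      ultimately show ?thesis unfolding wave_length_def[abs_def] norm by simp
    qed
    have "continuous_on {0..} (\<lambda>x. (\<lambda>(r, x). wave_length r x) (r, x))"
      by (intro continuous_on_compose2[OF continuous_on_wave_length] continuous_intros) (use r in auto)
    then show "continuous_on {0..} (wave_length r)" by simp
  qed (use that assms(1) in auto)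
  have total: "arc_len (wave \<theta> P) (2*pi) = wave_length r (4*pi)"
    using len[of "4*pi"] by (simp add: wave_angle_4pi)
  note wp = wave_param[OF r(1,2) assms(2)]
  have "arc_param (wave \<theta> P) (2*pi) s = c1 (wave_param r s)"
  proof (rule arc_param_eqI)
    show "wave_angle r (wave_param r s) \<in> {0..2*pi}" using wave_angle_range[OF assms(1) wp(1)] by (simp add: r_def)
    show "2 * pi * arc_len (wave \<theta> P) (wave_angle r (wave_param r s)) = s * arc_len (wave \<theta> P) (2*pi)"
      unfolding total using wp len[of "wave_param r s"] by simp
    fix v assume v: "v \<in> {0..2*pi}" "2 * pi * arc_len (wave \<theta> P) v = s * arc_len (wave \<theta> P) (2*pi)"
    obtain x where x: "x \<in> {0..4*pi}" "v = wave_angle r x"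
      using wave_angle_preimage[OF assms(1) v(1)] unfolding r_def .
    then have "arc_len (wave \<theta> P) v = wave_length r x" using len[of x] by simp
    then have "wave_param r s = x" using v(2) x(1) r unfolding total by (intro wave_param_eqI) simp_all
    then show "wave \<theta> P v = c1 (wave_param r s)" using cw[of x] x(2) by simp
  qed
  then show ?thesis by (simp add: gamma_cyl_def c1_def r_def Let_def)
qed

end

text \<open>At r = 1, \<open>skew\<close> is arcsin (sin x). Its value is the y in
  [-\<pi>/2, \<pi>/2] with sin y = sin x, which on the five intervals is x, \<pi> - x, x - 2\<pi>,
  3\<pi> - x and x - 4\<pi>.\<close>

lemma circle_angle_1:
  "x \<in> {0..pi/2} \<Longrightarrow> circle_angle 1 x = x"
  "x \<in> {pi/2..3*pi/2} \<Longrightarrow> circle_angle 1 x = pi/2"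
  "x \<in> {3*pi/2..5*pi/2} \<Longrightarrow> circle_angle 1 x = x - pi"
  "x \<in> {5*pi/2..7*pi/2} \<Longrightarrow> circle_angle 1 x = 3*pi/2"
  "x \<in> {7*pi/2..4*pi} \<Longrightarrow> circle_angle 1 x = x - 2*pi"
proof -
  have *: "circle_angle 1 x = (x + y) / 2" if "sin x = sin y" "- (pi/2) \<le> y" "y \<le> pi/2" for y
    using that arcsin_sin[of y] by (simp add: circle_angle_def skew_def)
  have p: "sin (x - 2*pi) = sin x" "sin (3*pi - x) = sin x" "sin (x - 4*pi) = sin x" "sin (pi - x) = sin x"
  proof -
    show "sin (x - 2*pi) = sin x" by (simp add: sin_diff)
    have "sin (3*pi - x) = sin (2*pi + (pi - x))" by (simp add: algebra_simps)
    then show "sin (3*pi - x) = sin x" by (simp only: sin_add sin_two_pi cos_two_pi) simp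
    have "sin (x - 4*pi) = sin (x - 2*pi - 2*pi)" by (simp add: algebra_simps)
    then show "sin (x - 4*pi) = sin x" by (simp add: sin_diff)
  qed simp
  show "x \<in> {0..pi/2} \<Longrightarrow> circle_angle 1 x = x" using *[of x] by simp
  show "x \<in> {pi/2..3*pi/2} \<Longrightarrow> circle_angle 1 x = pi/2" using *[of "pi - x"] p by simp
  show "x \<in> {3*pi/2..5*pi/2} \<Longrightarrow> circle_angle 1 x = x - pi" using *[of "x - 2*pi"] p by simp
  show "x \<in> {5*pi/2..7*pi/2} \<Longrightarrow> circle_angle 1 x = 3*pi/2" using *[of "3*pi - x"] p by simp
  show "x \<in> {7*pi/2..4*pi} \<Longrightarrow> circle_angle 1 x = x - 2*pi" using *[of "x - 4*pi"] p by simp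
qed

text \<open>The edges Q = 1 and Q = -1 project to the poles, where u rests at \<pi>/2 and 3\<pi>/2.
  On the descending edge the azimuth has moved by \<pi>; the resulting sign cancels against |cos (x
  - \<pi>)| = - cos (x - \<pi>).\<close>

lemma square_wave_eq:
  assumes "x \<in> {0..4*pi}"
  shows "cyl_to_sphere (square_wave \<theta> x) = great_circle \<theta> 0 (circle_angle 1 x)"
proof -
  have sq: "sqrt (1 - (sin y)\<^sup>2) = \<bar>cos y\<bar>" for y by (simp add: cos_squared_eq[symmetric])
  have gc: "great_circle \<theta> 0 u = (cis (\<theta>/2) * of_real (cos u), sin u)" for u
    by (simp add: great_circle_def complex_eq_iff)
  have c1: "cis (\<theta>/2 - pi) = - cis (\<theta>/2)" and c2: "cis (\<theta>/2 - 2*pi) = cis (\<theta>/2)"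
    by (auto simp: complex_eq_iff cos_diff sin_diff)
  have s4: "sin (x - 4*pi) = sin (x - 2*pi)" and s4': "cos (x - 4*pi) = cos (x - 2*pi)"
  proof -
    have "x - 4*pi = (x - 2*pi) - 2*pi" by simp
    then show "sin (x - 4*pi) = sin (x - 2*pi)" "cos (x - 4*pi) = cos (x - 2*pi)"
      by (simp_all only: sin_diff cos_diff sin_two_pi cos_two_pi) simp_all
  qed
  consider "x \<in> {0..pi/2}" | "x \<in> {pi/2<..3*pi/2}" | "x \<in> {3*pi/2<..5*pi/2}" 
    | "x \<in> {5*pi/2<..7*pi/2}" | "x \<in> {7*pi/2<..4*pi}"
    using assms by force
  then show ?thesis
  proof cases
    case 1
    then have "cos x \<ge> 0" by (intro cos_ge_zero) auto
    then show ?thesis using 1 circle_angle_1(1)[of x] by (simp add: square_wave_def cyl_to_sphere_def sq gc)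
  next
    case 2
    then have "circle_angle 1 x = pi/2" by (intro circle_angle_1(2)) auto
    then have "cos (circle_angle 1 x) = 0" "sin (circle_angle 1 x) = 1" by (simp_all only: cos_pi_half sin_pi_half)
    then show ?thesis using 2 by (simp add: square_wave_def cyl_to_sphere_def gc)
  next
    case 3
    have "cos (x - pi) = - cos (x - 2*pi)" by (simp add: cos_diff)
    moreover have "cos (x - 2*pi) \<ge> 0" using 3 by (intro cos_ge_zero) auto
    ultimately have "\<bar>cos (x - pi)\<bar> = - cos (x - pi)" by simp
    then show ?thesis using 3 circle_angle_1(3)[of x]
      by (simp add: square_wave_def cyl_to_sphere_def sq gc c1)
  next
    case 4
    have "sin (3*pi/2) = -1" "cos (3*pi/2) = 0" 
      using sin_3over2_pi cos_3over2_pi by (simp_all add: mult.commute)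
    moreover have "circle_angle 1 x = 3*pi/2" using 4 by (intro circle_angle_1(4)) auto
    ultimately have "cos (circle_angle 1 x) = 0" "sin (circle_angle 1 x) = -1" by metis+
    then show ?thesis using 4 by (simp add: square_wave_def cyl_to_sphere_def gc)
  next
    case 5
    have "cos (x - 4*pi) \<ge> 0" using 5 by (intro cos_ge_zero) auto
    then have "\<bar>cos (x - 4*pi)\<bar> = cos (x - 2*pi)" using s4' by simp
    then show ?thesis using 5 circle_angle_1(5)[of x] s4
      by (simp add: square_wave_def cyl_to_sphere_def sq gc c2 s4)
  qed
qed

lemma gamma_sphere_zero:
  assumes \<theta>: "\<theta> \<in> {0<..pi}" and s: "s \<in> {0..2*pi}" shows "gamma_sphere \<theta> 0 s = great_circle \<theta> 0 s"
proof -
  let ?c = "cyl_to_sphere \<circ> square_wave \<theta>"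
  obtain d where d: "(great_circle \<theta> 0 has_vector_derivative d u) (at u)" "norm (d u) = 1" for u
    using great_circle_has_derivative[OF \<theta>, of 0] by (metis atLeastAtMost_iff neg_le_0_iff_le zero_le_one)
  have sd: "\<bar>skew_deriv 1 x\<bar> \<le> 1" for x using skew_deriv_le[of 1 x] by simp
  have len: "arc_len ?c x = circle_angle 1 x" if x: "x \<in> {0..4*pi}" for x
  proof -
    have "((\<lambda>y. norm (vector_derivative ?c (at y))) has_integral circle_angle 1 x - circle_angle 1 0) {0..x}"
    proof (rule fundamental_theorem_of_calculus_interior_strong)
      show "finite {pi/2, 3*pi/2, 5*pi/2, 7*pi/2}" by simp
      show "continuous_on {0..x} (circle_angle 1)" by (rule continuous_on_angles) auto
      fix y assume y: "y \<in> {0<..<x} - {pi/2, 3*pi/2, 5*pi/2, 7*pi/2}"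
      \<comment> \<open>The four excluded points are all zeros of cos in the open interval from 0 to
        4\<pi>; only there may the derivative be missing.\<close>
      have "cos y \<noteq> 0"
      proof
        assume "cos y = 0"
        then obtain i :: int where i: "y = of_int i * pi + pi/2" using cos_zero_iff_int2 by metis
        moreover have "0 < y" "y < 4 * pi" using y x by auto
        ultimately have "- pi < of_int i * pi" "of_int i * pi < 4 * pi" using pi_gt_zero by linarith+
        then have "(-1) * pi < of_int i * pi" by simp
        then have "-1 < real_of_int i" "real_of_int i < 4" 
          using \<open>of_int i * pi < 4 * pi\<close> pi_gt_zero mult_less_cancel_right_pos by blast+
        then have "i = 0 \<or> i = 1 \<or> i = 2 \<or> i = 3" by linarith
        then show False using y i by (auto simp: field_simps)
      qed
      then have ca: "(circle_angle 1 has_real_derivative (1 + skew_deriv 1 y) / 2) (at y)"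
        by (intro circle_angle_has_derivative) auto
      then have "(great_circle \<theta> 0 \<circ> circle_angle 1 has_vector_derivative
          ((1 + skew_deriv 1 y) / 2) *\<^sub>R d (circle_angle 1 y)) (at y)"
        using d(1) by (intro vector_diff_chain_at) (auto simp: has_real_derivative_iff_has_vector_derivative)
      then have "(?c has_vector_derivative ((1 + skew_deriv 1 y) / 2) *\<^sub>R d (circle_angle 1 y)) (at y)"
        by (rule has_vector_derivative_transform_within_open[where S = "{0<..<4*pi}"])
          (use y x square_wave_eq in auto)
      then have "norm (vector_derivative ?c (at y)) = (1 + skew_deriv 1 y) / 2"
        using sd[of y] d(2) by (simp add: vector_derivative_at abs_le_iff)
      then show "(circle_angle 1 has_vector_derivative norm (vector_derivative ?c (at y))) (at y)"
        using ca unfolding has_real_derivative_iff_has_vector_derivative by metis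
    qed (use x in auto)
    then show ?thesis unfolding arc_len_def by (simp add: integral_unique circle_angle_0)
  qed
  have total: "arc_len ?c (4*pi) = 2*pi" using len[of "4*pi"] by (simp add: circle_angle_4pi)
  obtain x0 where x0: "x0 \<in> {0..4*pi}" "circle_angle 1 x0 = s" 
    using circle_angle_surj[of 1 s] s by auto
  have "arc_param ?c (4*pi) s = great_circle \<theta> 0 s"
  proof (rule arc_param_eqI[OF x0(1)])
    show "2 * pi * arc_len ?c x0 = s * arc_len ?c (4*pi)" using len[of x0] x0 total by simp
    \<comment> \<open>At a pole v is not unique, since u is constant along a horizontal edge, but
      the projected point depends on v only through u.\<close>
    fix v assume v: "v \<in> {0..4*pi}" "2 * pi * arc_len ?c v = s * arc_len ?c (4*pi)"
    then have "circle_angle 1 v = s" using len[of v] total by simp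
    then show "?c v = great_circle \<theta> 0 s" using square_wave_eq[OF v(1)] by simp
  qed
  then show ?thesis by (simp add: gamma_sphere_def)
qed

lemma gamma_sphere_eq:
  assumes "\<theta> \<in> {0<..pi}" "P \<in> {-1..1}" "s \<in> {0..2*pi}"
  shows "gamma_sphere \<theta> P s = great_circle \<theta> P s"
  using gamma_sphere_zero gamma_sphere_nonzero assms by (cases "P = 0") auto

text \<open>\<open>X_point\<close> expressed by the great circle angle. The coordinate S b is a
  times the conjugate of S cis \<phi>, which is linear in cos u and sin u, so the formula makes
  sense at P = 0 too and involves no square root of 1 - Q^2.\<close>

definition X_curve :: "real \<Rightarrow> real \<Rightarrow> complex \<Rightarrow> real \<Rightarrow> quat \<times> quat" where
  "X_curve \<theta> P a u =
     ((of_real P * cis (\<theta>/2), of_real (sqrt (1 - P\<^sup>2)) * a),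
      (of_real (amplitude \<theta> P * sin u) * cis (-\<theta>/2),
       a * (cis (-\<theta>/2) * Complex (cos u) (tilt \<theta> P * sin u))))"

text \<open>Turns normalized arc length on the cylinder, which r' preserves, into the angle on the
  sphere, by which \<Phi> is defined.\<close>

definition wave_circle :: "real \<Rightarrow> real \<Rightarrow> real" where
  "wave_circle r s = circle_angle r (wave_param r s)"

lemma X_point_gamma_cyl:
  assumes "\<theta> \<in> {0<..pi}" "P \<in> {-1..1}" "P \<noteq> 0" "s \<in> {0..2*pi}"
  shows "X_point \<theta> P a (gamma_cyl \<theta> P s) = X_curve \<theta> P a (wave_circle (modulus \<theta> P) s)"
proof -
  define x where "x = wave_param (modulus \<theta> P) s"
  define w where "w = cis (\<theta>/2 - sgn P * wave_angle (modulus \<theta> P) x)"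
  define Q where "Q = amplitude \<theta> P * sin (circle_angle (modulus \<theta> P) x)"
  have g: "gamma_cyl \<theta> P s = (w, Q)"
    using gamma_cyl_eq[OF assms] by (simp add: x_def w_def Q_def Let_def)
  have "cyl_to_sphere (w, Q) = great_circle \<theta> P (circle_angle (modulus \<theta> P) x)"
    using wave_reparam[OF assms(1-3), of x] by (simp add: w_def Q_def)
  then have "of_real (sqrt (1 - Q\<^sup>2)) * w = fst (great_circle \<theta> P (circle_angle (modulus \<theta> P) x))"
    by (drule_tac arg_cong[where f = fst]) (simp add: cyl_to_sphere_def)
  then have "of_real (sqrt (1 - Q\<^sup>2)) * cnj w = cnj (fst (great_circle \<theta> P (circle_angle (modulus \<theta> P) x)))"
    by (drule_tac arg_cong[where f = cnj]) simp
  then have "of_real (sqrt (1 - Q\<^sup>2)) * (a * cnj w) =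
      a * (cis (-\<theta>/2) * Complex (cos (circle_angle (modulus \<theta> P) x)) (tilt \<theta> P * sin (circle_angle (modulus \<theta> P) x)))"
    by (simp add: great_circle_def cis_cnj mult.left_commute complex_cnj)
  then show ?thesis unfolding g
    by (simp add: X_point_def X_curve_def wave_circle_def x_def[symmetric] Q_def)
qed

lemma wave_circle_range:
  assumes "0 \<le> r" "r \<le> 1" "s \<in> {0..2*pi}" shows "wave_circle r s \<in> {0..2*pi}"
  unfolding wave_circle_def by (intro circle_angle_range assms wave_param)

lemma wave_circle_ends:
  assumes "0 \<le> r" "r \<le> 1" shows "wave_circle r 0 = 0" "wave_circle r (2*pi) = 2*pi"
  using assms by (simp_all add: wave_circle_def wave_param_0 wave_param_2pi circle_angle_0 circle_angle_4pi)

lemma wave_circle_surj: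
  assumes "0 \<le> r" "r \<le> 1" "u \<in> {0..2*pi}"
  obtains s where "s \<in> {0..2*pi}" "wave_circle r s = u"
  using circle_angle_surj[OF assms] wave_param_surj[OF assms(1,2)] unfolding wave_circle_def by metis

text \<open>Strictness of r < 1 matters: at r = 1 the angle rests along the horizontal edges while s
  advances.\<close>

lemma wave_circle_inj:
  assumes "0 \<le> r" "r < 1" "s \<in> {0..2*pi}" "s' \<in> {0..2*pi}" "wave_circle r s = wave_circle r s'"
  shows "s = s'"
proof -
  have "wave_param r s = wave_param r s'"
    using assms(5) circle_angle_strict_mono[OF assms(1,2)] unfolding wave_circle_def
    by (metis less_irrefl linorder_neqE_linordered_idom)
  then show ?thesis using wave_param_inj[of r s s'] assms by simp
qed

lemma continuous_on_wave_circle: "continuous_on ({0..1} \<times> {0..2*pi}) (\<lambda>(r, s). wave_circle r s)"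
proof -
  have "continuous_on ({0..1} \<times> {0..2*pi}) (\<lambda>z. (\<lambda>(r, x). circle_angle r x) (fst z, (\<lambda>(r, s). wave_param r s) z))"
    by (intro continuous_on_compose2[OF continuous_on_circle_angle] continuous_intros continuous_on_wave_param) auto
  then show ?thesis by (simp add: wave_circle_def case_prod_beta)
qed

lemma cis_eq_interval:
  assumes "cis u = cis u'" "u \<in> {0..2*pi}" "u' \<in> {0..2*pi}"
  shows "u = u' \<or> u = 0 \<and> u' = 2*pi \<or> u = 2*pi \<and> u' = 0"
proof -
  have "cis (u - u') = 1" using assms(1) by (simp add: cis_divide[symmetric])
  then have "cos (u - u') = 1" by (simp add: complex_eq_iff)
  then obtain n :: int where n: "u - u' = of_int n * (2 * pi)" using cos_one_2pi_int by (metis mult.assoc)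
  moreover have "\<bar>u - u'\<bar> \<le> 2 * pi" using assms by (auto simp: abs_le_iff)
  ultimately have "\<bar>real_of_int n\<bar> * (2 * pi) \<le> 1 * (2 * pi)" by (simp add: abs_mult)
  then have "\<bar>real_of_int n\<bar> \<le> 1" using pi_gt_zero by (subst (asm) mult_le_cancel_right_pos) auto
  then have "n = 0 \<or> n = 1 \<or> n = -1" by linarith
  then show ?thesis using n assms by auto
qed

text \<open>R is nonzero, so a can be read off; the amplitude is nonzero, which gives sin u; after
  cancelling a the last coordinate gives cos u.\<close>

lemma X_curve_eq_iff:
  assumes "\<theta> \<in> {0<..pi}" "P \<in> {-1..1}" "P\<^sup>2 \<noteq> 1"
  shows "X_curve \<theta> P a u = X_curve \<theta> P a' u' \<and> a \<noteq> 0 \<longleftrightarrow> a = a' \<and> a \<noteq> 0 \<and> cis u = cis u'"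
proof -
  have "P\<^sup>2 \<le> 1" using assms(2) by (simp add: abs_square_le_1 abs_le_iff)
  then have 1: "sqrt (1 - P\<^sup>2) \<noteq> 0" using assms(3) by simp
  have 2: "amplitude \<theta> P \<noteq> 0" using amplitude_eq_0[OF assms(1,2)] assms(3) by simp
  show ?thesis using 1 2 by (auto simp: X_curve_def complex_eq_iff[of "cis u"] complex_eq_iff[of "Complex _ _"])
qed

text \<open>At \<open>P = \<plusminus>1\<close> the wave is flat and only \<open>a cis (P u)\<close> is determined by the point.\<close>

lemma X_curve_extreme:
  assumes "\<theta> \<in> {0<..pi}" "P\<^sup>2 = 1"
  shows "X_curve \<theta> P a u = ((of_real P * cis (\<theta>/2), 0), (0, cis (-\<theta>/2) * (a * cis (P * u))))"
proof -
  have "P = 1 \<or> P = -1" using assms(2) by (simp add: power2_eq_1_iff)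
  then show ?thesis using tilt_extreme[OF assms] by (auto simp: X_curve_def complex_eq_iff algebra_simps)
qed

text \<open>This makes r' well defined. At P = 1 or P = -1 the modulus is 0 for both angles, so the
  combination a cis (P u) that the point determines stays the same. At P = 0 the modulus is 1 for
  both. Otherwise a is determined, and s up to exchanging 0 and 2\<pi>, which are the two ends of
  the period for every modulus.\<close>

lemma X_curve_deform_unique:
  assumes \<theta>: "\<theta> \<in> {0<..pi}" "\<theta>' \<in> {0<..pi}" and P: "P \<in> {-1..1}" and a: "a \<noteq> 0"
    and s: "s \<in> {0..2*pi}" "s' \<in> {0..2*pi}"
    and eq: "X_curve \<theta> P a (wave_circle (modulus \<theta> P) s) = X_curve \<theta> P a' (wave_circle (modulus \<theta> P) s')"
  shows "X_curve \<theta>' P a (wave_circle (modulus \<theta>' P) s) = X_curve \<theta>' P a' (wave_circle (modulus \<theta>' P) s')"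
proof (cases "P\<^sup>2 = 1")
  case True
  then show ?thesis using eq tilt_extreme(3)[OF \<theta>(1) True] tilt_extreme(3)[OF \<theta>(2) True]
    by (simp add: X_curve_extreme[OF \<theta>(1) True] X_curve_extreme[OF \<theta>(2) True])
next
  case False
  then have 1: "a = a'" "cis (wave_circle (modulus \<theta> P) s) = cis (wave_circle (modulus \<theta> P) s')"
    using X_curve_eq_iff[OF \<theta>(1) P False] eq a by blast+
  note r = tilt_amplitude(4,5)[OF \<theta>(1) P] and r' = tilt_amplitude(4,5)[OF \<theta>(2) P]
  have "cis (wave_circle (modulus \<theta>' P) s) = cis (wave_circle (modulus \<theta>' P) s')"
  proof (cases "P = 0")
    case True then show ?thesis using 1 by simp
  next
    case False
    let ?w = "wave_circle (modulus \<theta> P)"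
    have inj: "s1 = s2" if "?w s1 = ?w s2" "s1 \<in> {0..2*pi}" "s2 \<in> {0..2*pi}" for s1 s2
      using wave_circle_inj[OF r(1) modulus_less_1[OF \<theta>(1) P False]] that by blast
    have "?w s = ?w s' \<or> ?w s = ?w 0 \<and> ?w s' = ?w (2*pi) \<or> ?w s = ?w (2*pi) \<and> ?w s' = ?w 0"
      using cis_eq_interval[OF 1(2) wave_circle_range[OF r s(1)] wave_circle_range[OF r s(2)]]
      by (simp add: wave_circle_ends[OF r])
    moreover have "0 \<in> {0..2*pi}" "2*pi \<in> {0..2*pi}" by auto
    ultimately have "s = s' \<or> s = 0 \<and> s' = 2*pi \<or> s = 2*pi \<and> s' = 0" using inj s by metis
    then show ?thesis by (auto simp: wave_circle_ends[OF r'])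
  qed
  then show ?thesis using X_curve_eq_iff[OF \<theta>(2) P False] 1(1) a by blast
qed

section \<open>The spaces of pairs with given commutator\<close>

interpretation SU2: group SU2 by (rule group_SU2)

lemma SU2_mult [simp]: "x \<otimes>\<^bsub>SU2\<^esub> y = qmult x y"
  and SU2_one [simp]: "\<one>\<^bsub>SU2\<^esub> = (1, 0)"
  by (simp_all add: SU2_def)

lemma SU2_iff: "(z, w) \<in> carrier SU2 \<longleftrightarrow> (cmod z)\<^sup>2 + (cmod w)\<^sup>2 = 1"
  by (simp add: SU2_def)

lemma SU2_inv:
  assumes "x \<in> carrier SU2" shows "inv\<^bsub>SU2\<^esub> x = (cnj (fst x), - snd x)"
proof (rule SU2.inv_equality)
  obtain z w where [simp]: "x = (z, w)" by (cases x)
  have "(cmod z)\<^sup>2 + (cmod w)\<^sup>2 = 1" using assms by (simp add: SU2_iff)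
  then have "complex_of_real ((cmod z)\<^sup>2 + (cmod w)\<^sup>2) = 1" by simp
  then have "cnj z * z + cnj w * w = 1" by (simp only: of_real_add complex_norm_square mult.commute)
  then show "(cnj (fst x), - snd x) \<otimes>\<^bsub>SU2\<^esub> x = \<one>\<^bsub>SU2\<^esub>"
    by (simp add: qmult_def mult.commute)
  show "(cnj (fst x), - snd x) \<in> carrier SU2" using assms by (simp add: SU2_iff)
qed (rule assms)

lemma torus_SU2: "t \<in> torus \<Longrightarrow> t \<in> carrier SU2"
  by (auto simp: torus_def SU2_iff)

lemma cis_SU2 [simp]: "(cis \<theta>, 0) \<in> carrier SU2"
  by (simp add: SU2_iff)

lemma qmult_SU2: "x \<in> carrier SU2 \<Longrightarrow> y \<in> carrier SU2 \<Longrightarrow> qmult x y \<in> carrier SU2"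
  using SU2.m_closed by simp

lemma qmult_assoc: "qmult (qmult x y) z = qmult x (qmult y z)"
  by (simp add: qmult_def algebra_simps)

lemma conj_by_SU2: "g \<in> carrier SU2 \<Longrightarrow> x \<in> carrier SU2 \<Longrightarrow> conj_by g x \<in> carrier SU2"
  by (simp add: conj_by_def qmult_SU2 del: SU2_mult)

lemma conj_by_eq:
  "g \<in> carrier SU2 \<Longrightarrow> conj_by g x = qmult (qmult g x) (cnj (fst g), - snd g)"
  by (simp add: conj_by_def SU2_inv)

lemma conj_by_conj_by:
  assumes "g \<in> carrier SU2" "h \<in> carrier SU2" "x \<in> carrier SU2"
  shows "conj_by g (conj_by h x) = conj_by (g \<otimes>\<^bsub>SU2\<^esub> h) x"
  using assms by (simp add: conj_by_def SU2.inv_mult_group SU2.m_assoc del: SU2_mult)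

lemma conj_by_one: "x \<in> carrier SU2 \<Longrightarrow> conj_by (1, 0) x = x"
  using SU2.l_one SU2.r_one SU2.inv_one by (simp add: conj_by_def qmult_def)

lemma conj_by_inv:
  assumes "g \<in> carrier SU2" "x \<in> carrier SU2"
  shows "conj_by (inv\<^bsub>SU2\<^esub> g) (conj_by g x) = x" "conj_by g (conj_by (inv\<^bsub>SU2\<^esub> g) x) = x"
  using assms by (simp_all add: conj_by_conj_by conj_by_one[folded SU2_one] del: SU2_mult SU2_one)

lemma conj_by_mult:
  assumes "g \<in> carrier SU2" "x \<in> carrier SU2" "y \<in> carrier SU2"
  shows "conj_by g (x \<otimes>\<^bsub>SU2\<^esub> y) = conj_by g x \<otimes>\<^bsub>SU2\<^esub> conj_by g y"
proof -
  have "inv\<^bsub>SU2\<^esub> g \<otimes>\<^bsub>SU2\<^esub> (g \<otimes>\<^bsub>SU2\<^esub> z) = z" if "z \<in> carrier SU2" for z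
    using assms that by (simp add: SU2.m_assoc[symmetric] del: SU2_mult SU2_one)
  then show ?thesis using assms by (simp add: conj_by_def SU2.m_assoc del: SU2_mult)
qed

lemma conj_by_inverse:
  assumes "g \<in> carrier SU2" "x \<in> carrier SU2"
  shows "conj_by g (inv\<^bsub>SU2\<^esub> x) = inv\<^bsub>SU2\<^esub> (conj_by g x)"
  using assms by (simp add: conj_by_def SU2.inv_mult_group SU2.m_assoc del: SU2_mult)

lemma commutator_SU2: "x \<in> carrier SU2 \<Longrightarrow> y \<in> carrier SU2 \<Longrightarrow> commutator x y \<in> carrier SU2"
  by (simp add: commutator_def del: SU2_mult)

lemma commutator_conj_by:
  assumes "g \<in> carrier SU2" "x \<in> carrier SU2" "y \<in> carrier SU2"
  shows "commutator (conj_by g x) (conj_by g y) = conj_by g (commutator x y)"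
  using assms by (simp add: commutator_def conj_by_mult conj_by_inverse conj_by_SU2 del: SU2_mult)

text \<open>An equation without inverses, which can be compared coordinatewise.\<close>

lemma commutator_eq_iff:
  assumes "x \<in> carrier SU2" "y \<in> carrier SU2" "c \<in> carrier SU2"
  shows "commutator x y = c \<longleftrightarrow> qmult x y = qmult c (qmult y x)"
proof -
  have "commutator x y = (x \<otimes>\<^bsub>SU2\<^esub> y) \<otimes>\<^bsub>SU2\<^esub> inv\<^bsub>SU2\<^esub> (y \<otimes>\<^bsub>SU2\<^esub> x)"
    using assms by (simp add: commutator_def SU2.inv_mult_group SU2.m_assoc del: SU2_mult)
  moreover have "\<dots> = c \<longleftrightarrow> x \<otimes>\<^bsub>SU2\<^esub> y = c \<otimes>\<^bsub>SU2\<^esub> (y \<otimes>\<^bsub>SU2\<^esub> x)"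
    using assms SU2.inv_solve_right by (metis SU2.m_closed)
  ultimately show ?thesis by simp
qed

text \<open>The real part of the first coordinate is half the trace.\<close>

lemma Re_fst_conj_by:
  assumes "g \<in> carrier SU2" shows "Re (fst (conj_by g x)) = Re (fst x)"
proof -
  obtain z w where g: "g = (z, w)" by (cases g)
  obtain p q where x: "x = (p, q)" by (cases x)
  have "(cmod z)\<^sup>2 + (cmod w)\<^sup>2 = 1" using assms g by (simp add: SU2_iff)
  then have 1: "(Re z)\<^sup>2 + (Im z)\<^sup>2 + (Re w)\<^sup>2 + (Im w)\<^sup>2 = 1" by (simp add: cmod_power2)
  have "Re (fst (conj_by g x)) = Re p * ((Re z)\<^sup>2 + (Im z)\<^sup>2 + (Re w)\<^sup>2 + (Im w)\<^sup>2)"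
    unfolding conj_by_eq[OF assms] by (simp add: g x qmult_def algebra_simps power2_eq_square)
  then show ?thesis using 1 x by simp
qed

text \<open>In xy = cis \<theta> yx the second coordinates agree identically. The first ones reduce
  to P Q sin (\<theta>/2) = R t, which holds because Q and t are the multiples of sin u by
  \<open>amplitude\<close> and \<open>tilt\<close>, two quotients with the same denominator.\<close>

lemma X_curve_in_X_space:
  assumes \<theta>: "\<theta> \<in> {0<..pi}" and P: "P \<in> {-1..1}" and a: "cmod a = 1"
  shows "X_curve \<theta> P a u \<in> X_space \<theta>"
proof -
  define R where "R = sqrt (1 - P\<^sup>2)"
  define Q where "Q = amplitude \<theta> P * sin u"
  define t where "t = tilt \<theta> P * sin u"
  define e where "e = cis (\<theta>/2)"
  define \<beta> where "\<beta> = Complex (cos u) t"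
  note ta = tilt_amplitude[OF \<theta> P]
  have ec: "cis (-\<theta>/2) = cnj e" by (simp add: e_def cis_cnj)
  have ee: "e * cnj e = 1" by (simp add: e_def cis_cnj cis_mult)
  have e2: "cis \<theta> = e * e" by (simp add: e_def cis_mult)
  have aa: "a * cnj a = 1" using a by (simp add: complex_norm_square[symmetric])
  have "P\<^sup>2 \<le> 1" using P by (simp add: abs_square_le_1 abs_le_iff)
  then have R2: "P\<^sup>2 + R\<^sup>2 = 1" by (simp add: R_def)
  let ?x = "(of_real P * e, of_real R * a)" and ?y = "(of_real Q * cnj e, a * (cnj e * \<beta>))"
  have eq: "X_curve \<theta> P a u = (?x, ?y)"
    unfolding X_curve_def R_def Q_def e_def[symmetric] ec \<beta>_def t_def ..
  have x: "?x \<in> carrier SU2" using R2 a by (simp add: SU2_iff norm_mult e_def)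
  have "Q\<^sup>2 + (cmod \<beta>)\<^sup>2 = (cos u)\<^sup>2 + ((tilt \<theta> P)\<^sup>2 + (amplitude \<theta> P)\<^sup>2) * (sin u)\<^sup>2"
    by (simp add: \<beta>_def cmod_power2 Q_def t_def power_mult_distrib algebra_simps)
  then have y: "?y \<in> carrier SU2" using a ta by (simp add: SU2_iff norm_mult e_def)
  have "sin (\<theta>/2) * P * Q = R * t"
    by (simp add: Q_def t_def R_def amplitude_def tilt_def)
  moreover have "Im e = sin (\<theta>/2)" "Im \<beta> = t" by (simp_all add: e_def \<beta>_def)
  ultimately have "complex_of_real (P * Q) * (e - cnj e) = of_real R * (\<beta> - cnj \<beta>)"
    by (simp add: complex_eq_iff algebra_simps)
  then have "e * (complex_of_real (P * Q) * (e - cnj e)) = e * (of_real R * (\<beta> - cnj \<beta>))" by simp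
  then have key: "of_real P * of_real Q * (e * e) - of_real P * of_real Q = of_real R * e * \<beta> - of_real R * e * cnj \<beta>"
    using ee by (simp add: algebra_simps)
  have "qmult ?x ?y = qmult (cis \<theta>, 0) (qmult ?y ?x)"
  proof -
    have "qmult ?x ?y = (of_real P * of_real Q * (e * cnj e) - of_real R * e * cnj \<beta> * (a * cnj a),
        a * (of_real P * \<beta> * (e * cnj e) + of_real R * of_real Q * e))"
      by (simp add: qmult_def algebra_simps)
    moreover have "qmult ?y ?x = (of_real P * of_real Q * (e * cnj e) - of_real R * cnj e * \<beta> * (a * cnj a),
        a * (of_real P * \<beta> * (cnj e * cnj e) + of_real R * of_real Q * cnj e))"
      by (simp add: qmult_def algebra_simps)
    moreover have "qmult (cis \<theta>, 0) (p, q) = (e * e * p, e * e * q)" for p q by (simp add: qmult_def e2)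
    moreover have "e * e * (a * (of_real P * \<beta> * (cnj e * cnj e) + of_real R * of_real Q * cnj e)) =
        a * (of_real P * \<beta> * ((e * cnj e) * (e * cnj e)) + of_real R * of_real Q * e * (e * cnj e))"
      by (simp add: algebra_simps)
    moreover have "e * e * (of_real P * of_real Q * 1 - of_real R * cnj e * \<beta> * 1) =
        of_real P * of_real Q * (e * e) - of_real R * e * \<beta> * (e * cnj e)" by (simp add: algebra_simps)
    ultimately show ?thesis unfolding ee aa using key by (simp add: algebra_simps)
  qed
  then show ?thesis using x y by (simp add: eq X_space_def commutator_eq_iff)
qed

text \<open>For q = z cis (\<theta>/2) the hypothesis says that rotating q by \<theta>/2 or by
  -\<theta>/2 gives the same real part. The two differ by 2 Im q sin (\<theta>/2), so q is
  real.\<close>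

lemma real_of_Re_cis:
  assumes "sin (\<theta>/2) \<noteq> 0" "Re (cis \<theta> * z) = Re z"
  shows "z = of_real (Re (z * cis (\<theta>/2))) * cis (-\<theta>/2)"
proof -
  define q where "q = z * cis (\<theta>/2)"
  have z: "z = q * cis (-\<theta>/2)" by (simp add: q_def cis_mult mult.assoc)
  have "cis \<theta> * z = q * cis (\<theta>/2)" by (simp add: q_def cis_mult mult_ac)
  then have "Re (q * cis (\<theta>/2)) = Re (q * cis (-\<theta>/2))" using assms(2) z by metis
  then have "Im q * sin (\<theta>/2) = 0" by (simp add: algebra_simps)
  then have "Im q = 0" using assms(1) by simp
  then have "q = of_real (Re q)" by (simp add: complex_eq_iff)
  then show ?thesis using z unfolding q_def[symmetric] by metis
qed

text \<open>Invariance of the trace under conjugation puts the first coordinates of x and y on the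
  lines through cis (\<theta>/2) and cis (-\<theta>/2). The remaining content of the commutator
  equation is one linear relation between Q and Im b, the equation of the great circle.\<close>

lemma X_space_imp_X_curve:
  assumes \<theta>: "\<theta> \<in> {0<..pi}" and p: "p \<in> X_space \<theta>"
  obtains P a u where "P \<in> {-1..1}" "cmod a = 1" "u \<in> {0..2*pi}" "p = X_curve \<theta> P a u"
proof -
  obtain z w z' w' where pd: "p = ((z, w), (z', w'))" by (metis surj_pair)
  let ?x = "(z, w)" and ?y = "(z', w')" and ?c = "(cis \<theta>, 0)"
  have x: "?x \<in> carrier SU2" and y: "?y \<in> carrier SU2" and c: "commutator ?x ?y = ?c"
    using p by (auto simp: pd X_space_def)
  have \<sigma>: "sin (\<theta>/2) > 0" by (rule sin_half_pos[OF \<theta>])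
  have xy: "qmult ?x ?y = qmult ?c (qmult ?y ?x)" using c x y commutator_eq_iff[OF x y] by simp
  define ix where "ix = inv\<^bsub>SU2\<^esub> ?x"
  have ix: "ix = (cnj z, - w)" "ix \<in> carrier SU2"
    using SU2_inv[OF x] SU2.inv_closed[OF x] by (simp_all add: ix_def)
  have xi: "qmult ?x ix = (1, 0)" "qmult ix ?x = (1, 0)"
    using x SU2.r_inv[of ?x] SU2.l_inv[of ?x] by (simp_all add: ix_def)
  \<comment> \<open>The equation xy = cyx says that the conjugate of y by x is cy, so y and cy have
    the same trace.\<close>
  have "conj_by ?x ?y = qmult (qmult ?x ?y) ix" by (simp add: conj_by_def ix_def)
  also have "\<dots> = qmult ?c ?y" unfolding xy by (simp add: qmult_assoc xi) (simp add: qmult_def)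
  finally have "Re (fst (qmult ?c ?y)) = Re z'" using Re_fst_conj_by[OF x, of ?y] by simp
  then have "Re (cis \<theta> * z') = Re z'" by (simp add: qmult_def)
  then have z': "z' = of_real (Re (z' * cis (\<theta>/2))) * cis (-\<theta>/2)"
    by (rule real_of_Re_cis[rotated]) (use \<sigma> in simp)
  \<comment> \<open>Similarly the conjugate of the inverse of x by y is that inverse times c; this
    constrains the first coordinate of x.\<close>
  have "qmult ?y ix = qmult ix (qmult (qmult ?x ?y) ix)"
    by (simp add: qmult_assoc[symmetric] xi) (simp add: qmult_def)
  also have "\<dots> = qmult (qmult ix ?c) ?y" unfolding xy by (simp add: qmult_assoc xi) (simp add: qmult_def)
  finally have "conj_by ?y ix = qmult (qmult (qmult ix ?c) ?y) (inv\<^bsub>SU2\<^esub> ?y)" by (simp add: conj_by_def)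
  also have "\<dots> = qmult ix ?c"
    using y SU2.r_inv[OF y] by (simp add: qmult_assoc) (simp add: qmult_def)
  finally have "Re (fst (qmult ix ?c)) = Re (cnj z)" using Re_fst_conj_by[OF y, of ix] ix by simp
  then have "Re (cis \<theta> * cnj z) = Re (cnj z)" by (simp add: ix qmult_def mult.commute)
  then have cz: "cnj z = of_real (Re (cnj z * cis (\<theta>/2))) * cis (-\<theta>/2)"
    by (rule real_of_Re_cis[rotated]) (use \<sigma> in simp)
  define P where "P = Re (cnj z * cis (\<theta>/2))"
  define Q where "Q = Re (z' * cis (\<theta>/2))"
  have z: "z = of_real P * cis (\<theta>/2)"
  proof -
    have "cnj (cnj z) = of_real P * cnj (cis (-\<theta>/2))" using cz unfolding P_def[symmetric]
      by (metis complex_cnj_complex_of_real complex_cnj_mult)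
    then show ?thesis by (simp add: cis_cnj)
  qed
  have z'Q: "z' = of_real Q * cis (-\<theta>/2)" using z' by (simp add: Q_def)
  have Pw: "P\<^sup>2 + (cmod w)\<^sup>2 = 1" using x by (simp add: SU2_iff z norm_mult)
  have Qw: "Q\<^sup>2 + (cmod w')\<^sup>2 = 1" using y by (simp add: SU2_iff z'Q norm_mult)
  have P2: "P\<^sup>2 \<le> 1" using Pw zero_le_power2[of "cmod w"] by linarith
  then have P: "P \<in> {-1..1}" by (simp add: abs_square_le_1 abs_le_iff)
  define R where "R = sqrt (1 - P\<^sup>2)"
  have R: "R = cmod w" using Pw by (simp add: R_def real_sqrt_unique eq_diff_eq add.commute)
  \<comment> \<open>For w = 0 every unit a is admissible; b is measured relative to a below, so 1
    will do.\<close>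
  define a where "a = (if w = 0 then 1 else w / of_real R)"
  have a: "cmod a = 1" by (simp add: a_def R norm_divide)
  have w: "w = of_real R * a" using R by (simp add: a_def)
  have aa: "cnj a * a = 1" using a by (simp add: complex_norm_square[symmetric] mult.commute)
  define b where "b = cnj a * (cis (\<theta>/2) * w')"
  have w': "w' = a * (cis (-\<theta>/2) * b)"
  proof -
    have "a * (cis (-\<theta>/2) * b) = (cnj a * a) * (cis (-\<theta>/2) * cis (\<theta>/2)) * w'" by (simp add: b_def mult_ac)
    then show ?thesis by (simp add: aa cis_mult)
  qed
  have "cmod b = cmod w'" using a by (simp add: b_def norm_mult)
  then have "Q\<^sup>2 + (cmod b)\<^sup>2 = 1" using Qw by simp
  then have Qb: "Q\<^sup>2 + (Re b)\<^sup>2 + (Im b)\<^sup>2 = 1" by (simp add: cmod_power2)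
  have main: "sin (\<theta>/2) * P * Q = R * Im b"
  proof -
    have "z * z' - w * cnj w' = cis \<theta> * (z' * z - w' * cnj w)" using xy by (simp add: qmult_def)
    moreover have "z * z' = of_real (P * Q)" by (simp add: z z'Q cis_mult mult_ac)
    moreover have "z' * z = of_real (P * Q)" by (simp add: z z'Q cis_mult mult_ac)
    moreover have "w * cnj w' = of_real R * (cnj a * a) * (cis (\<theta>/2) * cnj b)"
      by (simp add: w w' cis_cnj mult_ac)
    moreover have "w' * cnj w = of_real R * (cnj a * a) * (cis (-\<theta>/2) * b)"
      by (simp add: w w' mult_ac)
    ultimately have "of_real (P * Q) - of_real R * (cis (\<theta>/2) * cnj b) =
        cis \<theta> * (of_real (P * Q) - of_real R * (cis (-\<theta>/2) * b))" by (simp add: aa)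
    then have "cis (-\<theta>/2) * (of_real (P * Q) - of_real R * (cis (\<theta>/2) * cnj b)) =
        cis (-\<theta>/2) * (cis \<theta> * (of_real (P * Q) - of_real R * (cis (-\<theta>/2) * b)))" by simp
    then have "of_real (P * Q) * cis (-\<theta>/2) - of_real R * (cis (-\<theta>/2) * cis (\<theta>/2)) * cnj b =
        of_real (P * Q) * (cis (-\<theta>/2) * cis \<theta>) - of_real R * (cis (-\<theta>/2) * cis \<theta> * cis (-\<theta>/2)) * b"
      by (simp only: right_diff_distrib mult_ac)
    then have "of_real (P * Q) * cis (-\<theta>/2) - of_real R * cnj b = of_real (P * Q) * cis (\<theta>/2) - of_real R * b"
      by (simp add: cis_mult)
    then have "Im (of_real (P * Q) * cis (-\<theta>/2) - of_real R * cnj b) = Im (of_real (P * Q) * cis (\<theta>/2) - of_real R * b)"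
      by simp
    then show ?thesis by (simp add: algebra_simps)
  qed
  note ta = tilt_amplitude[OF \<theta> P]
  define A where "A = amplitude \<theta> P"
  define K where "K = tilt \<theta> P"
  have AK: "K\<^sup>2 + A\<^sup>2 = 1" using ta(1) by (simp add: A_def K_def)
  have tq: "K * Q = A * Im b"
  proof -
    define D where "D = sqrt (1 - P\<^sup>2 * (cos (\<theta>/2))\<^sup>2)"
    have "D > 0" using tilt_denominator_pos[OF \<theta> P] by (simp add: D_def)
    moreover have "K = P * sin (\<theta>/2) / D" "A = R / D" by (simp_all add: K_def A_def D_def tilt_def amplitude_def R_def)
    ultimately have "K * Q = (sin (\<theta>/2) * P * Q) / D" "A * Im b = (R * Im b) / D" by simp_all
    then show ?thesis using main by simp
  qed
  \<comment> \<open>By \<open>tq\<close> the vector (Q, Im b) is parallel to the unit vector (A, K);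
    q is its coefficient and becomes sin u.\<close>
  define q where "q = A * Q + K * Im b"
  have q1: "A * q = Q"
  proof -
    have "A * q = A\<^sup>2 * Q + K * (A * Im b)" by (simp add: q_def algebra_simps power2_eq_square)
    also have "\<dots> = (K\<^sup>2 + A\<^sup>2) * Q" unfolding tq[symmetric] by (simp add: algebra_simps power2_eq_square)
    finally show ?thesis by (simp add: AK)
  qed
  have q2: "K * q = Im b"
  proof -
    have "K * q = A * (K * Q) + K\<^sup>2 * Im b" by (simp add: q_def algebra_simps power2_eq_square)
    also have "\<dots> = (K\<^sup>2 + A\<^sup>2) * Im b" unfolding tq by (simp add: algebra_simps power2_eq_square)
    finally show ?thesis by (simp add: AK)
  qed
  have "q\<^sup>2 = (K * q)\<^sup>2 + (A * q)\<^sup>2" using AK by (simp add: power_mult_distrib distrib_right[symmetric])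
  then have "(Re b)\<^sup>2 + q\<^sup>2 = 1" using Qb unfolding q1 q2 by simp
  then obtain u where u: "0 \<le> u" "u < 2*pi" "Re b = cos u" "q = sin u"
    using sincos_total_2pi by blast
  have "b = Complex (cos u) (tilt \<theta> P * sin u)" "Q = amplitude \<theta> P * sin u"
    using u q1 q2 by (simp_all add: complex_eq_iff A_def K_def)
  then have "p = X_curve \<theta> P a u"
    unfolding pd X_curve_def using z w z'Q w' by (simp add: R_def)
  then show ?thesis using that[of P a u] P a u by auto
qed

section \<open>The homeomorphisms onto \<open>PSU(2)\<close>\<close>

text \<open>If the preimage of U is D \<inter> V and y lies in U, then f maps the compact set K - V
  onto a closed set that misses y. Within N its complement is covered by f on K \<inter> V, hence
  lies in U. Compactness is asked for only locally because \<theta> ranges over an interval that is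
  not compact.\<close>

lemma quotient_map_compact_cover:
  fixes f :: "'a::t2_space \<Rightarrow> 'b::t2_space"
  assumes cont: "continuous_on D f" and im: "f ` D = S"
    and cover: "\<And>y. y \<in> S \<Longrightarrow> \<exists>K N. compact K \<and> K \<subseteq> D \<and> open N \<and> y \<in> N \<and> S \<inter> N \<subseteq> f ` K"
  shows "quotient_map (top_of_set D) (top_of_set S) f"
  unfolding quotient_map_def
proof (intro conjI allI impI)
  show "f ` topspace (top_of_set D) = topspace (top_of_set S)" using im by simp
  fix U assume "U \<subseteq> topspace (top_of_set S)"
  then have US: "U \<subseteq> S" by simp
  show "openin (top_of_set D) {x \<in> topspace (top_of_set D). f x \<in> U} = openin (top_of_set S) U"
  proof
    assume "openin (top_of_set S) U"
    moreover have "f \<in> D \<rightarrow> S" using im by auto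
    ultimately have "openin (top_of_set D) (D \<inter> f -` U)"
      using cont continuous_on_open_gen by blast
    moreover have "D \<inter> f -` U = {x \<in> topspace (top_of_set D). f x \<in> U}" by auto
    ultimately show "openin (top_of_set D) {x \<in> topspace (top_of_set D). f x \<in> U}" by simp
  next
    assume "openin (top_of_set D) {x \<in> topspace (top_of_set D). f x \<in> U}"
    then obtain V where V: "open V" "{x \<in> D. f x \<in> U} = D \<inter> V" by (auto simp: openin_open)
    show "openin (top_of_set S) U"
    proof (subst openin_subopen, intro ballI)
      fix y assume y: "y \<in> U"
      then obtain K N where K: "compact K" "K \<subseteq> D" "open N" "y \<in> N" "S \<inter> N \<subseteq> f ` K"
        using cover[OF subsetD[OF US y]] by (elim exE conjE)
      have "compact (f ` (K - V))"
        using K V(1) cont by (intro compact_continuous_image compact_diff) (auto intro: continuous_on_subset)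
      then have o: "open (N - f ` (K - V))" using K(3) by (intro open_Diff compact_imp_closed)
      have "y \<notin> f ` (K - V)" using V(2) K(2) y by blast
      moreover have "S \<inter> (N - f ` (K - V)) \<subseteq> U"
      proof
        fix z assume z: "z \<in> S \<inter> (N - f ` (K - V))"
        then obtain x where x: "x \<in> K" "z = f x" using K(5) by blast
        then have "x \<in> D \<inter> V" using z K(2) by blast
        then show "z \<in> U" using x V(2) by blast
      qed
      ultimately show "\<exists>T. openin (top_of_set S) T \<and> y \<in> T \<and> T \<subseteq> U"
        using o y US K(4) by (intro exI[of _ "S \<inter> (N - f ` (K - V))"]) (auto intro: openin_open_Int)
    qed
  qed
qed

definition polar :: "real \<Rightarrow> real \<Rightarrow> real \<Rightarrow> quat" where
  "polar P \<zeta> \<omega> = (of_real (sqrt ((1 + P) / 2)) * cis \<zeta>, of_real (sqrt ((1 - P) / 2)) * cis \<omega>)"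

lemma polar_SU2: "P \<in> {-1..1} \<Longrightarrow> polar P \<zeta> \<omega> \<in> carrier SU2"
  by (simp add: polar_def SU2_iff norm_mult field_simps)

lemma SU2_polar:
  assumes "x \<in> carrier SU2"
  obtains P \<zeta> \<omega> where "P \<in> {-1..1}" "\<zeta> \<in> {0..2*pi}" "\<omega> \<in> {0..2*pi}" "x = polar P \<zeta> \<omega>"
proof -
  obtain z w where x: "x = (z, w)" by (cases x)
  define P where "P = (cmod z)\<^sup>2 - (cmod w)\<^sup>2"
  have n: "(cmod z)\<^sup>2 + (cmod w)\<^sup>2 = 1" using assms x by (simp add: SU2_iff)
  have 1: "(1 + P) / 2 = (cmod z)\<^sup>2" "(1 - P) / 2 = (cmod w)\<^sup>2" using n by (auto simp: P_def field_simps)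
  have "z = of_real (cmod z) * cis (Arg2pi z)" "w = of_real (cmod w) * cis (Arg2pi w)"
    by (metis Arg2pi_eq cis_conv_exp)+
  then have "x = polar P (Arg2pi z) (Arg2pi w)" by (simp add: x polar_def 1)
  moreover have "Arg2pi z \<in> {0..2*pi}" "Arg2pi w \<in> {0..2*pi}"
    using Arg2pi_ge_0 Arg2pi_lt_2pi less_imp_le by auto
  moreover have "0 \<le> (1 + P) / 2" "0 \<le> (1 - P) / 2" unfolding 1 by simp_all
  then have "P \<in> {-1..1}" by simp
  ultimately show ?thesis using that by blast
qed

text \<open>One formula for both branches of \<open>Phi_inv_rep\<close>, with free phases in place
  of arguments. The great circle is periodic, so \<zeta> - \<omega> may replace the argument of z /
  w. If z or w vanishes, its arbitrary phase cancels between a and cis (P u), leaving -cis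
  (2\<omega>) or -cis (2\<zeta>).\<close>

lemma Phi_inv_rep_polar:
  assumes \<theta>: "\<theta> \<in> {0<..pi}" and P: "P \<in> {-1..1}"
  shows "Phi_inv_rep \<theta> (polar P \<zeta> \<omega>) = X_curve \<theta> P (- cis (\<theta>/2 + \<zeta> + \<omega>)) (\<zeta> - \<omega>)"
proof -
  define s1 where "s1 = sqrt ((1 + P) / 2)"
  define s2 where "s2 = sqrt ((1 - P) / 2)"
  define z where "z = of_real s1 * cis \<zeta>"
  define w where "w = of_real s2 * cis \<omega>"
  define R where "R = sqrt (1 - P\<^sup>2)"
  have s: "s1\<^sup>2 = (1 + P) / 2" "s2\<^sup>2 = (1 - P) / 2" "s1 \<ge> 0" "s2 \<ge> 0" using P by (auto simp: s1_def s2_def)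
  have PP: "(cmod z)\<^sup>2 - (cmod w)\<^sup>2 = P" using s by (simp add: z_def w_def norm_mult field_simps)
  have "s1 * s2 = sqrt ((1 - P\<^sup>2) / 2\<^sup>2)"
    unfolding s1_def s2_def real_sqrt_mult[symmetric] by (simp add: power2_eq_square algebra_simps)
  then have R: "R = 2 * (s1 * s2)" by (simp add: R_def real_sqrt_divide)
  have pol: "polar P \<zeta> \<omega> = (z, w)" by (simp add: polar_def z_def w_def s1_def s2_def)
  have cc: "cis (\<theta>/2) * (cis \<zeta> * cis \<omega>) = cis (\<theta>/2 + \<zeta> + \<omega>)" by (simp add: cis_mult add.assoc)
  have Ra: "-2 * cis (\<theta>/2) * z * w = of_real R * - cis (\<theta>/2 + \<zeta> + \<omega>)"
    unfolding cc[symmetric] by (simp add: R z_def w_def)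
  show ?thesis
  proof (cases "z * w = 0")
    case False
    then have s0: "s1 > 0" "s2 > 0" using s by (auto simp: z_def w_def less_le)
    then have R0: "of_real R \<noteq> (0::complex)" by (simp add: R)
    have "z / w = of_real (s1 / s2) * cis (\<zeta> - \<omega>)" by (simp add: z_def w_def cis_divide[symmetric])
    moreover have "s1 / s2 > 0" using s0 by simp
    ultimately have "Arg2pi (z / w) = Arg2pi (cis (\<zeta> - \<omega>))" using Arg2pi_times_of_real by metis
    then have cs: "cis (Arg2pi (z / w)) = cis (\<zeta> - \<omega>)"
      using Arg2pi_eq[of "cis (\<zeta> - \<omega>)"] by (simp add: cis_conv_exp)
    have "Arg2pi (z / w) \<in> {0..2*pi}" using Arg2pi_ge_0 Arg2pi_lt_2pi less_imp_le by auto
    then have g: "gamma_sphere \<theta> P (Arg2pi (z / w)) = great_circle \<theta> P (Arg2pi (z / w))"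
      by (rule gamma_sphere_eq[OF \<theta> P])
    have gg: "great_circle \<theta> P (Arg2pi (z / w)) = great_circle \<theta> P (\<zeta> - \<omega>)"
      using cs by (simp add: great_circle_def complex_eq_iff)
    show ?thesis unfolding pol Phi_inv_rep_def prod.case Let_def PP Ra R_def[symmetric] g gg
      using False R0 by (simp add: X_curve_def great_circle_def R_def[symmetric] cis_cnj complex_cnj)
  next
    case True
    then have "s1 = 0 \<or> s2 = 0" by (simp add: z_def w_def)
    then have "P = -1 \<or> P = 1" using s by auto
    then show ?thesis
    proof
      assume Pm: "P = -1"
      then have zw: "z = 0" "w = cis \<omega>" by (simp_all add: z_def w_def s1_def s2_def)
      have "cis (Arg2pi (cis \<omega>)) = cis \<omega>" using Arg2pi_eq[of "cis \<omega>"] by (simp add: cis_conv_exp)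
      then have "cis (2 * Arg2pi (cis \<omega>)) = cis \<omega> * cis \<omega>"
        by (metis cis_mult mult_2)
      then have b: "cis (2 * Arg2pi (cis \<omega>) + pi) = - (cis \<omega> * cis \<omega>)"
        by (metis cis_mult cis_pi mult_minus1_right)
      have c: "cis (- (\<theta>/2)) * (cis (\<theta>/2 + \<zeta> + \<omega>) * cis (\<omega> - \<zeta>)) = cis \<omega> * cis \<omega>"
        by (simp add: cis_mult)
      show ?thesis unfolding pol using X_curve_extreme[OF \<theta>, of P] Pm
        by (simp add: Phi_inv_rep_def Let_def zw b c)
    next
      assume Pm: "P = 1"
      then have zw: "z = cis \<zeta>" "w = 0" by (simp_all add: z_def w_def s1_def s2_def)
      have "cis (Arg2pi (cis \<zeta>)) = cis \<zeta>" using Arg2pi_eq[of "cis \<zeta>"] by (simp add: cis_conv_exp)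
      then have "cis (2 * Arg2pi (cis \<zeta>)) = cis \<zeta> * cis \<zeta>"
        by (metis cis_mult mult_2)
      then have b: "cis (2 * Arg2pi (cis \<zeta>) + pi) = - (cis \<zeta> * cis \<zeta>)"
        by (metis cis_mult cis_pi mult_minus1_right)
      have c: "cis (- (\<theta>/2)) * (cis (\<theta>/2 + \<zeta> + \<omega>) * cis (\<zeta> - \<omega>)) = cis \<zeta> * cis \<zeta>"
        by (simp add: cis_mult)
      show ?thesis unfolding pol using X_curve_extreme[OF \<theta>, of P] Pm
        by (simp add: Phi_inv_rep_def Let_def zw b c)
    qed
  qed
qed

lemma Phi_inv_rep_in_X_space:
  assumes "\<theta> \<in> {0<..pi}" "x \<in> carrier SU2" shows "Phi_inv_rep \<theta> x \<in> X_space \<theta>"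
  using SU2_polar[OF assms(2)] Phi_inv_rep_polar[OF assms(1)] X_curve_in_X_space[OF assms(1)]
  by (metis norm_cis norm_minus_cancel)

lemma X_space_Phi_inv_rep:
  assumes \<theta>: "\<theta> \<in> {0<..pi}" and p: "p \<in> X_space \<theta>"
  obtains x where "x \<in> carrier SU2" "p = Phi_inv_rep \<theta> x"
proof -
  obtain P a u where P: "P \<in> {-1..1}" and a: "cmod a = 1" and p: "p = X_curve \<theta> P a u"
    using X_space_imp_X_curve[OF assms] by metis
  \<comment> \<open>The phases below solve \<zeta> + \<omega> = \<alpha> and \<zeta> - \<omega> =
    u.\<close>
  define \<alpha> where "\<alpha> = Arg2pi (- a) - \<theta>/2"
  have "cis (\<theta>/2 + \<alpha>) = - a" using Arg2pi_eq[of "- a"] a by (simp add: \<alpha>_def cis_conv_exp)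
  moreover have "\<theta>/2 + (\<alpha> + u)/2 + (\<alpha> - u)/2 = \<theta>/2 + \<alpha>" "(\<alpha> + u)/2 - (\<alpha> - u)/2 = u"
    by (simp_all add: field_simps)
  ultimately have "p = Phi_inv_rep \<theta> (polar P ((\<alpha> + u)/2) ((\<alpha> - u)/2))"
    unfolding Phi_inv_rep_polar[OF \<theta> P] p by (simp only: minus_minus)
  then show ?thesis using that polar_SU2[OF P] by blast
qed

lemma cis_double_eq: "cis (2 * x) = cis (2 * y) \<Longrightarrow> cis x = cis y \<or> cis x = - cis y"
  by (metis cis_mult mult_2 power2_eq_iff power2_eq_square)

text \<open>The sum and the difference of the phases are determined modulo 2\<pi>, hence so is
  2\<zeta>, and cis \<zeta> up to sign. The product cis \<zeta> cis \<omega> being fixed, both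
  coordinates change sign together. If one coordinate is 0, the doubled phase of the other
  suffices.\<close>

lemma Phi_inv_rep_eq_iff:
  assumes \<theta>: "\<theta> \<in> {0<..pi}" and x: "x \<in> carrier SU2" "y \<in> carrier SU2"
  shows "Phi_inv_rep \<theta> x = Phi_inv_rep \<theta> y \<longleftrightarrow> x = y \<or> x = - y"
proof -
  obtain P \<zeta> \<omega> where P: "P \<in> {-1..1}" and xp: "x = polar P \<zeta> \<omega>" using SU2_polar[OF x(1)] by metis
  obtain P' \<zeta>' \<omega>' where P': "P' \<in> {-1..1}" and yp: "y = polar P' \<zeta>' \<omega>'" using SU2_polar[OF x(2)] by metis
  have my: "- y = polar P' (\<zeta>' + pi) (\<omega>' + pi)"
    by (simp add: yp polar_def cis_mult[symmetric])
  have "cis (\<theta>/2 + (\<zeta>' + pi) + (\<omega>' + pi)) = cis (\<theta>/2 + \<zeta>' + \<omega>') * (cis pi * cis pi)"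
    unfolding cis_mult by (simp add: algebra_simps)
  then have 1: "Phi_inv_rep \<theta> (- y) = Phi_inv_rep \<theta> y"
    unfolding my unfolding yp Phi_inv_rep_polar[OF \<theta> P'] by simp
  have "x = y \<or> x = - y" if eq: "Phi_inv_rep \<theta> x = Phi_inv_rep \<theta> y"
  proof -
    have E: "X_curve \<theta> P (- cis (\<theta>/2 + \<zeta> + \<omega>)) (\<zeta> - \<omega>) = X_curve \<theta> P' (- cis (\<theta>/2 + \<zeta>' + \<omega>')) (\<zeta>' - \<omega>')"
      using eq unfolding xp yp Phi_inv_rep_polar[OF \<theta> P] Phi_inv_rep_polar[OF \<theta> P'] .
    then have PP: "P' = P" by (simp add: X_curve_def)
    have split: "cis (\<theta>/2 + \<zeta> + \<omega>) = cis (\<theta>/2) * (cis \<zeta> * cis \<omega>)" for \<zeta> \<omega>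
      by (simp add: cis_mult add.assoc)
    show ?thesis
    proof (cases "P\<^sup>2 = 1")
      case False
      have "cis (\<theta>/2 + \<zeta> + \<omega>) = cis (\<theta>/2 + \<zeta>' + \<omega>')" and d: "cis (\<zeta> - \<omega>) = cis (\<zeta>' - \<omega>')"
        using X_curve_eq_iff[OF \<theta> P False, of "- cis (\<theta>/2 + \<zeta> + \<omega>)" "\<zeta> - \<omega>" "- cis (\<theta>/2 + \<zeta>' + \<omega>')" "\<zeta>' - \<omega>'"] E
        unfolding PP by auto
      then have s: "cis \<zeta> * cis \<omega> = cis \<zeta>' * cis \<omega>'" by (simp add: split)
      have "cis (2 * \<zeta>) = cis \<zeta> * cis \<omega> * cis (\<zeta> - \<omega>)" for \<zeta> \<omega> by (simp add: cis_mult)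
      then have "cis (2 * \<zeta>) = cis (2 * \<zeta>')" using s d by metis
      then have "cis \<zeta> = cis \<zeta>' \<or> cis \<zeta> = - cis \<zeta>'" by (rule cis_double_eq)
      then have "cis \<zeta> = cis \<zeta>' \<and> cis \<omega> = cis \<omega>' \<or> cis \<zeta> = - cis \<zeta>' \<and> cis \<omega> = - cis \<omega>'"
      proof
        assume "cis \<zeta> = - cis \<zeta>'"
        then have "cis \<zeta>' * (- cis \<omega>) = cis \<zeta>' * cis \<omega>'" using s by simp
        then have "cis \<omega>' = - cis \<omega>" using mult_cancel_left[of "cis \<zeta>'"] cis_neq_zero by metis
        then show ?thesis using \<open>cis \<zeta> = - cis \<zeta>'\<close> by simp
      qed (use s in simp)
      then show ?thesis by (auto simp: xp yp polar_def PP)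
    next
      case True
      then have "P = 1 \<or> P = -1" by (simp add: power2_eq_1_iff)
      then show ?thesis
      proof
        assume "P = 1"
        then have "cis (\<theta>/2 + \<zeta> + \<omega>) * cis (\<zeta> - \<omega>) = cis (\<theta>/2 + \<zeta>' + \<omega>') * cis (\<zeta>' - \<omega>')"
          using E unfolding PP X_curve_extreme[OF \<theta> True] by simp
        then have "cis (\<theta>/2) * cis (2 * \<zeta>) = cis (\<theta>/2) * cis (2 * \<zeta>')" by (simp add: cis_mult add.commute)
        then have "cis \<zeta> = cis \<zeta>' \<or> cis \<zeta> = - cis \<zeta>'" by (intro cis_double_eq) simp
        then show ?thesis using \<open>P = 1\<close> by (auto simp: xp yp polar_def PP)
      next
        assume "P = -1"
        then have "cis (\<theta>/2 + \<zeta> + \<omega>) * cis (\<omega> - \<zeta>) = cis (\<theta>/2 + \<zeta>' + \<omega>') * cis (\<omega>' - \<zeta>')"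
          using E unfolding PP X_curve_extreme[OF \<theta> True] by simp
        then have "cis (\<theta>/2) * cis (2 * \<omega>) = cis (\<theta>/2) * cis (2 * \<omega>')" by (simp add: cis_mult add.commute)
        then have "cis \<omega> = cis \<omega>' \<or> cis \<omega> = - cis \<omega>'" by (intro cis_double_eq) simp
        then show ?thesis using \<open>P = -1\<close> by (auto simp: xp yp polar_def PP)
      qed
    qed
  qed
  then show ?thesis using 1 by auto
qed

lemma continuous_on_X_curve:
  "continuous_on ({0<..pi} \<times> {-1..1} \<times> UNIV \<times> UNIV) (\<lambda>(\<theta>, P, a, u). X_curve \<theta> P a u)"
proof -
  let ?S = "{0<..pi} \<times> {-1..1} \<times> (UNIV :: complex set) \<times> (UNIV :: real set)"
  have 1: "continuous_on ?S (\<lambda>z. (\<lambda>(\<theta>, P). tilt \<theta> P) (fst z, fst (snd z)))"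
    by (intro continuous_on_compose2[OF continuous_on_tilt(1)] continuous_intros) auto
  have 2: "continuous_on ?S (\<lambda>z. (\<lambda>(\<theta>, P). amplitude \<theta> P) (fst z, fst (snd z)))"
    by (intro continuous_on_compose2[OF continuous_on_tilt(2)] continuous_intros) auto
  have e: "X_curve \<theta> P a u = ((of_real P * exp (\<i> * of_real (\<theta>/2)), of_real (sqrt (1 - P\<^sup>2)) * a),
      (of_real (amplitude \<theta> P * sin u) * exp (\<i> * of_real (-\<theta>/2)),
       a * (exp (\<i> * of_real (-\<theta>/2)) * (of_real (cos u) + \<i> * of_real (tilt \<theta> P * sin u)))))" for \<theta> P a u
    by (simp add: X_curve_def cis_conv_exp Complex_eq)
  show ?thesis unfolding e case_prod_beta
    using 1 2 by (intro continuous_intros) auto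
qed

text \<open>The phases are not continuous functions of x, but the polar parametrization is a
  quotient map, and in polar parameters the formula is continuous.\<close>

lemma continuous_on_Phi_inv_rep:
  "continuous_on ({0<..pi} \<times> carrier SU2) (\<lambda>(\<theta>, x). Phi_inv_rep \<theta> x)"
proof -
  let ?D = "{0<..pi} \<times> {-1..1} \<times> {0..2*pi} \<times> {0..2*pi}"
  let ?f = "\<lambda>(\<theta>, P, \<zeta>, \<omega>). (\<theta>::real, polar P \<zeta> \<omega>)"
  have pe: "polar P \<zeta> \<omega> = (of_real (sqrt ((1 + P) / 2)) * exp (\<i> * of_real \<zeta>),
      of_real (sqrt ((1 - P) / 2)) * exp (\<i> * of_real \<omega>))" for P \<zeta> \<omega>
    by (simp add: polar_def cis_conv_exp)
  have "quotient_map (top_of_set ?D) (top_of_set ({0<..pi} \<times> carrier SU2)) ?f"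
  proof (rule quotient_map_compact_cover)
    show "continuous_on ?D ?f" unfolding pe case_prod_beta by (intro continuous_intros) auto
    show "?f ` ?D = {0<..pi} \<times> carrier SU2"
    proof (intro equalityI subsetI)
      fix y assume "y \<in> {0<..pi} \<times> carrier SU2"
      then obtain \<theta> x where y: "y = (\<theta>, x)" "\<theta> \<in> {0<..pi}" "x \<in> carrier SU2" by auto
      obtain P \<zeta> \<omega> where "P \<in> {-1..1}" "\<zeta> \<in> {0..2*pi}" "\<omega> \<in> {0..2*pi}" "x = polar P \<zeta> \<omega>"
        using SU2_polar[OF y(3)] .
      then show "y \<in> ?f ` ?D" using y by (intro image_eqI[of _ _ "(\<theta>, P, \<zeta>, \<omega>)"]) auto
    qed (auto simp: polar_SU2)
    fix y assume "y \<in> {0<..pi} \<times> carrier SU2"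
    then obtain \<theta> x where y: "y = (\<theta>, x)" "\<theta> \<in> {0<..pi}" "x \<in> carrier SU2" by auto
    \<comment> \<open>Keeping the angle above \<theta>/2 avoids the missing endpoint 0.\<close>
    let ?K = "{\<theta>/2..pi} \<times> {-1..1::real} \<times> {0..2*pi} \<times> {0..2*pi}" and ?N = "{\<theta>/2<..} \<times> UNIV"
    have "compact ?K" by (intro compact_Times compact_Icc)
    moreover have "open ?N" by (intro open_Times open_greaterThan open_UNIV)
    moreover have "({0<..pi} \<times> carrier SU2) \<inter> ?N \<subseteq> ?f ` ?K"
    proof
      fix v assume "v \<in> ({0<..pi} \<times> carrier SU2) \<inter> ?N"
      then obtain \<theta>' x where v: "v = (\<theta>', x)" "\<theta>' \<in> {\<theta>/2..pi}" "x \<in> carrier SU2" by auto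
      obtain P \<zeta> \<omega> where "P \<in> {-1..1}" "\<zeta> \<in> {0..2*pi}" "\<omega> \<in> {0..2*pi}" "x = polar P \<zeta> \<omega>"
        using SU2_polar[OF v(3)] .
      then show "v \<in> ?f ` ?K" using v by (intro image_eqI[of _ _ "(\<theta>', P, \<zeta>, \<omega>)"]) auto
    qed
    moreover have "?K \<subseteq> ?D" using y by auto
    moreover have "y \<in> ?N" using y by auto
    ultimately show "\<exists>K N. compact K \<and> K \<subseteq> ?D \<and> open N \<and> y \<in> N \<and> ({0<..pi} \<times> carrier SU2) \<inter> N \<subseteq> ?f ` K"
      by blast
  qed
  moreover have "continuous_on ?D ((\<lambda>(\<theta>, x). Phi_inv_rep \<theta> x) \<circ> ?f)"
  proof -
    have "continuous_on ?D (\<lambda>z. (\<lambda>(\<theta>, P, a, u). X_curve \<theta> P a u)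
        (fst z, fst (snd z), - exp (\<i> * of_real (fst z/2 + fst (snd (snd z)) + snd (snd (snd z)))),
         fst (snd (snd z)) - snd (snd (snd z))))"
      by (intro continuous_on_compose2[OF continuous_on_X_curve] continuous_intros) auto
    then show ?thesis
      by (rule continuous_on_eq) (auto simp: Phi_inv_rep_polar cis_conv_exp)
  qed
  ultimately show ?thesis
    using continuous_compose_quotient_map[of "top_of_set ?D" "top_of_set ({0<..pi} \<times> carrier SU2)" ?f euclidean]
    unfolding continuous_map_iff_continuous by blast
qed

section \<open>Equivariance of the parametrization\<close>

lemma qmult_torus: "qmult (cis \<tau>, 0) (z, w) = (cis \<tau> * z, cis \<tau> * w)"
  by (simp add: qmult_def)

lemma conj_by_torus: "conj_by (cis \<tau>, 0) (z, w) = (z, cis (2 * \<tau>) * w)"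
proof -
  have "z * cis \<tau> * cis (- \<tau>) = z" "w * cis \<tau> * cis \<tau> = w * cis (2 * \<tau>)"
    unfolding mult.assoc cis_mult by simp_all
  then show ?thesis by (simp add: conj_by_eq qmult_def cis_cnj mult_ac)
qed

lemma X_curve_torus:
  "map_prod (conj_by (cis \<tau>, 0)) (conj_by (cis \<tau>, 0)) (X_curve \<theta> P a u) = X_curve \<theta> P (cis (2 * \<tau>) * a) u"
  by (simp add: X_curve_def conj_by_torus mult_ac)

text \<open>Left multiplication by cis \<tau> adds \<tau> to both phases: the difference is
  unchanged and the sum grows by 2\<tau>, which is the rotation of a under conjugation.\<close>

lemma Phi_inv_rep_torus:
  assumes "\<theta> \<in> {0<..pi}" "x \<in> carrier SU2" "t \<in> torus"
  shows "Phi_inv_rep \<theta> (qmult t x) = map_prod (conj_by t) (conj_by t) (Phi_inv_rep \<theta> x)"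
proof -
  obtain P \<zeta> \<omega> where P: "P \<in> {-1..1}" and x: "x = polar P \<zeta> \<omega>" using SU2_polar[OF assms(2)] by metis
  obtain \<tau> where t: "t = (cis \<tau>, 0)" using assms(3) by (auto simp: torus_def)
  have 1: "qmult t x = polar P (\<zeta> + \<tau>) (\<omega> + \<tau>)"
    by (simp add: t x polar_def qmult_torus cis_mult[symmetric] mult_ac)
  have 2: "- cis (\<theta>/2 + (\<zeta> + \<tau>) + (\<omega> + \<tau>)) = cis (2 * \<tau>) * - cis (\<theta>/2 + \<zeta> + \<omega>)"
    by (simp add: cis_mult algebra_simps)
  show ?thesis unfolding 1 unfolding x Phi_inv_rep_polar[OF assms(1) P] t X_curve_torus 2 by simp
qed

text \<open>At \<pi> the tilt is P and the amplitude is R, and the pair becomes the conjugate by x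
  of the fixed pair (i, -j). Equivariance under all of SU(2), beyond T, rests on this form.\<close>

lemma Phi_inv_rep_pi:
  assumes "x \<in> carrier SU2"
  shows "Phi_inv_rep pi x = (conj_by x (\<i>, 0), conj_by x (0, -1))"
proof -
  obtain P \<zeta> \<omega> where P: "P \<in> {-1..1}" and x: "x = polar P \<zeta> \<omega>" using SU2_polar[OF assms] by metis
  have p: "pi \<in> {0<..pi}" by simp
  define s1 where "s1 = sqrt ((1 + P) / 2)"
  define s2 where "s2 = sqrt ((1 - P) / 2)"
  have s: "s1\<^sup>2 = (1 + P) / 2" "s2\<^sup>2 = (1 - P) / 2" using P by (auto simp: s1_def s2_def)
  have "s1 * s2 = sqrt ((1 - P\<^sup>2) / 2\<^sup>2)"
    unfolding s1_def s2_def real_sqrt_mult[symmetric] by (simp add: power2_eq_square algebra_simps)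
  then have R: "sqrt (1 - P\<^sup>2) = 2 * (s1 * s2)" by (simp add: real_sqrt_divide)
  have PP: "P = s1\<^sup>2 - s2\<^sup>2" "s1\<^sup>2 + s2\<^sup>2 = 1" using s by (auto simp: field_simps)
  have ta: "tilt pi P = P" "amplitude pi P = sqrt (1 - P\<^sup>2)" by (simp_all add: tilt_def amplitude_def)
  have c1: "- cis (pi/2 + \<zeta> + \<omega>) = - \<i> * (cis \<zeta> * cis \<omega>)"
    by (simp add: cis_mult[symmetric] cis_pi_half)
  have c2: "cis (-pi/2) = - \<i>" by (simp add: complex_eq_iff)
  define d where "d = \<zeta> - \<omega>"
  have d1: "cis \<zeta> * cis \<omega> * cis d = cis \<zeta> * cis \<zeta>" "cis \<zeta> * cis \<omega> * cis (- d) = cis \<omega> * cis \<omega>"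
    by (simp_all add: d_def cis_mult)
  have Cd: "Complex (cos d) (P * sin d) = of_real (s1\<^sup>2) * cis d + of_real (s2\<^sup>2) * cis (- d)"
    using PP by (simp add: complex_eq_iff algebra_simps)
      (metis distrib_left mult.commute mult.right_neutral)
  have sd: "of_real (sin d) * (2 * \<i>) = cis \<zeta> * cis (- \<omega>) - cis \<omega> * cis (- \<zeta>)"
    by (simp add: d_def cis_mult complex_eq_iff cos_diff sin_diff)
  have "Phi_inv_rep pi x = ((of_real P * \<i>, of_real (2 * (s1 * s2)) * (- \<i> * (cis \<zeta> * cis \<omega>))),
      (of_real (2 * (s1 * s2) * sin d) * - \<i>,
       - (of_real (s1\<^sup>2) * (cis \<zeta> * cis \<zeta>) + of_real (s2\<^sup>2) * (cis \<omega> * cis \<omega>))))"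
  proof -
    have "(- \<i> * (cis \<zeta> * cis \<omega>)) * (- \<i> * (of_real (s1\<^sup>2) * cis d + of_real (s2\<^sup>2) * cis (- d))) =
        - (of_real (s1\<^sup>2) * (cis \<zeta> * cis \<omega> * cis d) + of_real (s2\<^sup>2) * (cis \<zeta> * cis \<omega> * cis (- d)))"
      by (simp add: algebra_simps)
    then show ?thesis
      unfolding x Phi_inv_rep_polar[OF p P] X_curve_def c1 c2 ta R d_def[symmetric] Cd d1
      by (simp only: cis_pi_half)
  qed
  moreover have "conj_by x (\<i>, 0) = (of_real P * \<i>, of_real (2 * (s1 * s2)) * (- \<i> * (cis \<zeta> * cis \<omega>)))"
  proof -
    have 1: "cis \<zeta> * cis (- \<zeta>) = 1" "cis \<omega> * cis (- \<omega>) = 1" by (simp_all add: cis_mult)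
    have "fst (conj_by x (\<i>, 0)) = \<i> * (of_real (s1\<^sup>2) * (cis \<zeta> * cis (- \<zeta>)) - of_real (s2\<^sup>2) * (cis \<omega> * cis (- \<omega>)))"
      unfolding conj_by_eq[OF assms] unfolding x polar_def s1_def[symmetric] s2_def[symmetric]
      by (simp add: qmult_def cis_cnj algebra_simps power2_eq_square)
    then have "fst (conj_by x (\<i>, 0)) = of_real P * \<i>" unfolding 1 PP(1) by simp
    moreover have "snd (conj_by x (\<i>, 0)) = of_real (2 * (s1 * s2)) * (- \<i> * (cis \<zeta> * cis \<omega>))"
      unfolding conj_by_eq[OF assms] unfolding x polar_def s1_def[symmetric] s2_def[symmetric]
      by (simp add: qmult_def)
    ultimately show ?thesis by (simp add: prod_eq_iff)
  qed
  moreover have "conj_by x (0, -1) = (of_real (2 * (s1 * s2) * sin d) * - \<i>,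
       - (of_real (s1\<^sup>2) * (cis \<zeta> * cis \<zeta>) + of_real (s2\<^sup>2) * (cis \<omega> * cis \<omega>)))"
  proof -
    have "of_real (2 * (s1 * s2) * sin d) * - \<i> = - (of_real s1 * of_real s2 * (of_real (sin d) * (2 * \<i>)))"
      by simp
    then show ?thesis unfolding sd
      unfolding conj_by_eq[OF assms] unfolding x polar_def s1_def[symmetric] s2_def[symmetric]
      by (simp add: qmult_def cis_cnj algebra_simps power2_eq_square)
  qed
  ultimately show ?thesis by simp
qed

lemma Phi_inv_rep_pi_equivariant:
  assumes "g \<in> carrier SU2" "x \<in> carrier SU2"
  shows "Phi_inv_rep pi (qmult g x) = map_prod (conj_by g) (conj_by g) (Phi_inv_rep pi x)"
  using assms conj_by_conj_by[OF assms] by (simp add: Phi_inv_rep_pi qmult_SU2 SU2_iff)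

section \<open>The quotient group PSU(2)\<close>

lemma psu_class_eq: "psu_class x = {x, - x}"
proof -
  have "qmult (1, 0) x = x" "qmult (-1, 0) x = - x" by (simp_all add: qmult_def prod_eq_iff)
  then show ?thesis unfolding psu_class_def r_coset_def by auto
qed

lemma minus_SU2 [simp]: "- x \<in> carrier SU2 \<longleftrightarrow> x \<in> carrier SU2"
  by (cases x) (simp add: SU2_iff)

lemma psu_class_eq_iff: "psu_class x = psu_class y \<longleftrightarrow> x = y \<or> x = - y"
  by (auto simp: psu_class_eq doubleton_eq_iff minus_equation_iff)

lemma normal_PM: "{(1, 0), (-1, 0)} \<lhd> SU2"
proof (rule SU2.normal_invI)
  have c: "(1, 0) \<in> carrier SU2" "(-1, 0) \<in> carrier SU2" by (simp_all add: SU2_iff)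
  show "subgroup {(1, 0), (-1, 0)} SU2"
  proof (rule SU2.subgroupI)
    show "{(1, 0), (-1, 0)} \<subseteq> carrier SU2" using c by simp
    fix a b :: quat assume "a \<in> {(1, 0), (-1, 0)}" "b \<in> {(1, 0), (-1, 0)}"
    then show "inv\<^bsub>SU2\<^esub> a \<in> {(1, 0), (-1, 0)}" "a \<otimes>\<^bsub>SU2\<^esub> b \<in> {(1, 0), (-1, 0)}"
      using c by (auto simp: SU2_inv qmult_def)
  qed simp
  fix x h :: quat assume "x \<in> carrier SU2" "h \<in> {(1, 0), (-1, 0)}"
  then have "h = (1, 0) \<or> h = (-1, 0)" "qmult x (inv\<^bsub>SU2\<^esub> x) = (1, 0)" using SU2.r_inv[of x] by auto
  moreover have "qmult x (qmult (-1, 0) y) = - qmult x y" for y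
    by (cases x; cases y) (simp add: qmult_def algebra_simps)
  moreover have "qmult (1, 0) y = y" for y by (cases y) (simp add: qmult_def)
  ultimately show "x \<otimes>\<^bsub>SU2\<^esub> h \<otimes>\<^bsub>SU2\<^esub> inv\<^bsub>SU2\<^esub> x \<in> {(1, 0), (-1, 0)}"
    by (elim disjE) (simp_all add: qmult_assoc)
qed

interpretation PM: normal "{(1, 0), (-1, 0)}" SU2 by (rule normal_PM)

interpretation PSU2: group PSU2 unfolding PSU2_def by (rule PM.factorgroup_is_group)

lemma carrier_PSU2: "carrier PSU2 = psu_class ` carrier SU2"
  by (auto simp: PSU2_def FactGroup_def RCOSETS_def psu_class_def)

lemma psu_class_PSU2 [simp]: "x \<in> carrier SU2 \<Longrightarrow> psu_class x \<in> carrier PSU2"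
  by (simp add: carrier_PSU2)

lemma psu_class_mult:
  "x \<in> carrier SU2 \<Longrightarrow> y \<in> carrier SU2 \<Longrightarrow> psu_class x \<otimes>\<^bsub>PSU2\<^esub> psu_class y = psu_class (qmult x y)"
  using PM.rcos_sum[of x y] by (simp add: PSU2_def psu_class_def)

lemma psu_class_inv:
  assumes "x \<in> carrier SU2" shows "inv\<^bsub>PSU2\<^esub> (psu_class x) = psu_class (inv\<^bsub>SU2\<^esub> x)"
  using PM.rcos_inv[OF assms] PM.inv_FactGroup[of "psu_class x"] psu_class_PSU2[OF assms]
  by (simp add: PSU2_def psu_class_def)

lemma Phi_inv_psu_class:
  assumes "\<theta> \<in> {0<..pi}" "x \<in> carrier SU2" shows "Phi_inv \<theta> (psu_class x) = Phi_inv_rep \<theta> x"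
  using Phi_inv_rep_eq_iff[OF assms(1), of "- x" x] assms(2) by (simp add: Phi_inv_def psu_class_eq)

lemma Phi_Phi_inv_rep:
  assumes "\<theta> \<in> {0<..pi}" "x \<in> carrier SU2" shows "Phi \<theta> (Phi_inv_rep \<theta> x) = psu_class x"
proof -
  have "inj_on (Phi_inv \<theta>) (carrier PSU2)"
    using Phi_inv_rep_eq_iff[OF assms(1)] Phi_inv_psu_class[OF assms(1)]
    by (auto simp: inj_on_def carrier_PSU2 psu_class_eq_iff)
  then have "Phi \<theta> (Phi_inv \<theta> (psu_class x)) = psu_class x"
    unfolding Phi_def by (rule inv_into_f_f) (use assms(2) in simp)
  then show ?thesis using Phi_inv_psu_class[OF assms] by simp
qed

section \<open>The deformation\<close>

text \<open>On \<open>X_space \<theta>\<close> this is cos \<theta>, so it recovers the angle.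
  Inverses are spelled out by conjugates to make it continuous on all pairs.\<close>

definition comm_trace :: "quat \<times> quat \<Rightarrow> real" where
  "comm_trace p = Re (fst (qmult (qmult (fst p) (snd p))
     (qmult (cnj (fst (fst p)), - snd (fst p)) (cnj (fst (snd p)), - snd (snd p)))))"

lemma comm_trace_commutator:
  "x \<in> carrier SU2 \<Longrightarrow> y \<in> carrier SU2 \<Longrightarrow> comm_trace (x, y) = Re (fst (commutator x y))"
  by (simp add: comm_trace_def commutator_def SU2_inv qmult_assoc)

lemma comm_trace_X_space: "p \<in> X_space \<theta> \<Longrightarrow> comm_trace p = cos \<theta>"
  by (cases p) (simp add: X_space_def comm_trace_commutator)

lemma continuous_on_comm_trace: "continuous_on S comm_trace"
  unfolding comm_trace_def qmult_def by (intro continuous_intros)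

lemma X_space_unique:
  "p \<in> X_space \<theta> \<Longrightarrow> p \<in> X_space \<theta>' \<Longrightarrow> \<theta> \<in> {0..pi} \<Longrightarrow> \<theta>' \<in> {0..pi} \<Longrightarrow> \<theta> = \<theta>'"
  using comm_trace_X_space[of p \<theta>] comm_trace_X_space[of p \<theta>'] cos_inj_pi[of \<theta> \<theta>'] by auto

text \<open>The point in the coordinates kept by r'. Unlike \<open>gamma_cyl\<close> it also makes
  sense at P = 0, where it follows the square wave.\<close>

definition wave_point :: "real \<Rightarrow> real \<Rightarrow> complex \<Rightarrow> real \<Rightarrow> quat \<times> quat" where
  "wave_point \<theta> P a s = X_curve \<theta> P a (wave_circle (modulus \<theta> P) s)"

definition wave_dom :: "(real \<times> real \<times> complex \<times> real) set" where
  "wave_dom = {0<..pi} \<times> {-1..1} \<times> sphere 0 1 \<times> {0..2*pi}"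

lemma continuous_on_wave_point: "continuous_on wave_dom (\<lambda>(\<theta>, P, a, s). wave_point \<theta> P a s)"
proof -
  have m: "continuous_on wave_dom (\<lambda>z. (\<lambda>(\<theta>, P). modulus \<theta> P) (fst z, fst (snd z)))"
    by (intro continuous_on_compose2[OF continuous_on_tilt(3)] continuous_intros) (auto simp: wave_dom_def)
  have w: "continuous_on wave_dom (\<lambda>z. (\<lambda>(r, s). wave_circle r s) (modulus (fst z) (fst (snd z)), snd (snd (snd z))))"
    using m by (intro continuous_on_compose2[OF continuous_on_wave_circle] continuous_intros)
      (auto simp: wave_dom_def tilt_amplitude)
  have "continuous_on wave_dom (\<lambda>z. (\<lambda>(\<theta>, P, a, u). X_curve \<theta> P a u)
      (fst z, fst (snd z), fst (snd (snd z)), wave_circle (modulus (fst z) (fst (snd z))) (snd (snd (snd z)))))"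
    using w by (intro continuous_on_compose2[OF continuous_on_X_curve] continuous_intros) (auto simp: wave_dom_def)
  then show ?thesis by (simp add: wave_point_def case_prod_beta)
qed

lemma wave_point_in_X_space:
  "(\<theta>, P, a, s) \<in> wave_dom \<Longrightarrow> wave_point \<theta> P a s \<in> X_space \<theta>"
  by (simp add: wave_dom_def wave_point_def X_curve_in_X_space)

lemma X_space_wave_point:
  assumes "\<theta> \<in> {0<..pi}" "p \<in> X_space \<theta>"
  obtains P a s where "(\<theta>, P, a, s) \<in> wave_dom" "p = wave_point \<theta> P a s"
proof -
  obtain P a u where P: "P \<in> {-1..1}" "cmod a = 1" "u \<in> {0..2*pi}" "p = X_curve \<theta> P a u"
    using X_space_imp_X_curve[OF assms] .
  obtain s where "s \<in> {0..2*pi}" "wave_circle (modulus \<theta> P) s = u"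
    using wave_circle_surj[OF tilt_amplitude(4,5)[OF assms(1) P(1)] P(3)] .
  then show ?thesis using that[of P a s] P assms(1) by (simp add: wave_point_def wave_dom_def)
qed

lemma wave_point_fst: "fst (wave_point \<theta> P a s) = (of_real P * cis (\<theta>/2), of_real (sqrt (1 - P\<^sup>2)) * a)"
  by (simp add: wave_point_def X_curve_def)

text \<open>The commutator determines \<theta> and the first coordinate determines P; the rest is
  \<open>X_curve_deform_unique\<close>.\<close>

lemma wave_point_deform_unique:
  assumes d: "(\<theta>, P, a, s) \<in> wave_dom" "(\<theta>', P', a', s') \<in> wave_dom"
    and eq: "wave_point \<theta> P a s = wave_point \<theta>' P' a' s'" and \<theta>1: "\<theta>1 \<in> {0<..pi}"
  shows "\<theta> = \<theta>'" "P = P'" "wave_point \<theta>1 P a s = wave_point \<theta>1 P' a' s'"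
proof -
  show t: "\<theta> = \<theta>'"
    using X_space_unique[of "wave_point \<theta> P a s" \<theta> \<theta>'] wave_point_in_X_space[OF d(1)]
      wave_point_in_X_space[OF d(2)] d unfolding eq by (auto simp: wave_dom_def)
  show p: "P = P'" using arg_cong[OF eq, of "\<lambda>p. fst (fst p)"] t by (simp add: wave_point_fst)
  have "a \<noteq> 0" using d(1) by (auto simp: wave_dom_def)
  then show "wave_point \<theta>1 P a s = wave_point \<theta>1 P' a' s'"
    using X_curve_deform_unique[of \<theta> \<theta>1 P a s s' a'] d \<theta>1 eq p t
    by (simp add: wave_point_def wave_dom_def)
qed

lemma theta_at_range: "\<theta> \<in> {0<..pi} \<Longrightarrow> t \<in> {0..1} \<Longrightarrow> theta_at \<theta> t \<in> {0<..pi}"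
  and theta_at_0: "theta_at \<theta> 0 = pi" and theta_at_1: "theta_at \<theta> 1 = \<theta>"
proof -
  assume a: "\<theta> \<in> {0<..pi}" "t \<in> {0..1}"
  have "t * \<theta> + (1 - t) * pi \<le> t * pi + (1 - t) * pi" using a by (intro add_mono mult_left_mono) auto
  moreover have "t * \<theta> + (1 - t) * pi > 0"
  proof (cases "t = 0")
    case False then have "t * \<theta> > 0" using a by simp
    then show ?thesis using a by (simp add: add_pos_nonneg)
  qed simp
  ultimately show "theta_at \<theta> t \<in> {0<..pi}" by (simp add: theta_at_def algebra_simps)
qed (simp_all add: theta_at_def)

lemma X_union_wave: "X_union {0<..pi} = (\<lambda>(\<theta>, P, a, s). wave_point \<theta> P a s) ` wave_dom"
proof (intro equalityI subsetI)
  fix p assume "p \<in> X_union {0<..pi}"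
  then obtain \<theta> where "\<theta> \<in> {0<..pi}" "p \<in> X_space \<theta>" by (auto simp: X_union_def)
  then obtain P a s where "(\<theta>, P, a, s) \<in> wave_dom" "p = wave_point \<theta> P a s" by (rule X_space_wave_point)
  then show "p \<in> (\<lambda>(\<theta>, P, a, s). wave_point \<theta> P a s) ` wave_dom"
    by (intro image_eqI[of _ _ "(\<theta>, P, a, s)"]) auto
next
  fix p assume "p \<in> (\<lambda>(\<theta>, P, a, s). wave_point \<theta> P a s) ` wave_dom"
  then obtain \<theta> P a s where "(\<theta>, P, a, s) \<in> wave_dom" "p = wave_point \<theta> P a s" by auto
  then show "p \<in> X_union {0<..pi}" using wave_point_in_X_space[of \<theta> P a s]
    by (auto simp: X_union_def wave_dom_def)
qed

text \<open>The deformation in coordinates, including P = 0. It serves as the explicit candidate for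
  the limit by which \<open>r_deform\<close> is defined.\<close>

definition wave_deform :: "quat \<times> quat \<Rightarrow> real \<Rightarrow> quat \<times> quat" where
  "wave_deform p t = (SOME p'. \<exists>\<theta> P a s. (\<theta>, P, a, s) \<in> wave_dom \<and> p = wave_point \<theta> P a s \<and>
     p' = wave_point (theta_at \<theta> t) P a s)"

lemma wave_deform_wave_point:
  assumes "(\<theta>, P, a, s) \<in> wave_dom" "t \<in> {0..1}"
  shows "wave_deform (wave_point \<theta> P a s) t = wave_point (theta_at \<theta> t) P a s"
proof -
  let ?R = "\<lambda>p'. \<exists>\<theta>' P' a' s'. (\<theta>', P', a', s') \<in> wave_dom \<and> wave_point \<theta> P a s = wave_point \<theta>' P' a' s' \<and>
     p' = wave_point (theta_at \<theta>' t) P' a' s'"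
  have "?R (wave_point (theta_at \<theta> t) P a s)" using assms by blast
  then have "?R (wave_deform (wave_point \<theta> P a s) t)" unfolding wave_deform_def by (rule someI)
  then obtain \<theta>' P' a' s' where *: "(\<theta>', P', a', s') \<in> wave_dom" "wave_point \<theta> P a s = wave_point \<theta>' P' a' s'"
     "wave_deform (wave_point \<theta> P a s) t = wave_point (theta_at \<theta>' t) P' a' s'" by blast
  have "theta_at \<theta> t \<in> {0<..pi}" using assms by (intro theta_at_range) (auto simp: wave_dom_def)
  note u = wave_point_deform_unique[OF assms(1) *(1,2) this]
  show ?thesis unfolding *(3) u(1)[symmetric] u(3)[symmetric] ..
qed

text \<open>In coordinates the deformation only replaces \<theta>, which is continuous. It descends
  because the coordinate map is a quotient map, although the coordinates themselves cannot be chosen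
  continuously.\<close>

lemma continuous_on_wave_deform:
  "continuous_on (X_union {0<..pi} \<times> {0..1}) (\<lambda>(p, t). wave_deform p t)"
proof -
  let ?D = "wave_dom \<times> {0..1::real}" and ?S = "X_union {0<..pi} \<times> {0..1::real}"
  let ?w = "\<lambda>(\<theta>, P, a, s). wave_point \<theta> P a s"
  let ?f = "\<lambda>(z, t). (?w z, t::real)"
  have "quotient_map (top_of_set ?D) (top_of_set ?S) ?f"
  proof (rule quotient_map_compact_cover)
    have "continuous_on ?D (\<lambda>z. ?w (fst z))"
      by (intro continuous_on_compose2[OF continuous_on_wave_point] continuous_intros) auto
    then have "continuous_on ?D (\<lambda>z. (?w (fst z), snd z))" by (intro continuous_intros)
    then show "continuous_on ?D ?f" by (simp add: case_prod_beta)
    show "?f ` ?D = ?S" unfolding X_union_wave by force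
    fix y assume "y \<in> ?S"
    then obtain p t \<theta> where y: "y = (p, t)" "p \<in> X_space \<theta>" "\<theta> \<in> {0<..pi}" "t \<in> {0..1}"
      by (auto simp: X_union_def)
    let ?K = "({\<theta>/2..pi} \<times> {-1..1::real} \<times> sphere (0::complex) 1 \<times> {0..2*pi}) \<times> {0..1::real}"
    \<comment> \<open>Since cos decreases on [0, \<pi>], this neighbourhood contains only points
      whose angle exceeds \<theta>/2.\<close>
    let ?N = "{p. comm_trace p < cos (\<theta>/2)} \<times> (UNIV :: real set)"
    have "compact ?K" by (intro compact_Times compact_Icc compact_sphere)
    moreover have "?K \<subseteq> ?D" using y by (auto simp: wave_dom_def)
    moreover have "open ?N"
      by (intro open_Times open_UNIV open_Collect_less continuous_on_const continuous_on_comm_trace)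
    moreover have "cos \<theta> < cos (\<theta>/2)" using y(3) by (intro cos_monotone_0_pi) auto
    then have "y \<in> ?N" using y comm_trace_X_space[OF y(2)] by simp
    moreover have "?S \<inter> ?N \<subseteq> ?f ` ?K"
    proof
      fix v assume v: "v \<in> ?S \<inter> ?N"
      then obtain p t \<theta>' where v': "v = (p, t)" "p \<in> X_space \<theta>'" "\<theta>' \<in> {0<..pi}" "t \<in> {0..1}"
        by (auto simp: X_union_def)
      then have "cos \<theta>' < cos (\<theta>/2)" using v comm_trace_X_space[OF v'(2)] by simp
      then have "\<theta>/2 < \<theta>'" using v'(3) y(3) cos_mono_less_eq[of \<theta>' "\<theta>/2"] by auto
      moreover obtain P a s where "(\<theta>', P, a, s) \<in> wave_dom" "p = wave_point \<theta>' P a s"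
        using X_space_wave_point[OF v'(3,2)] .
      ultimately show "v \<in> ?f ` ?K" using v'
        by (intro image_eqI[of _ _ "((\<theta>', P, a, s), t)"]) (auto simp: wave_dom_def)
    qed
    ultimately show "\<exists>K N. compact K \<and> K \<subseteq> ?D \<and> open N \<and> y \<in> N \<and> ?S \<inter> N \<subseteq> ?f ` K" by blast
  qed
  moreover have "continuous_on ?D ((\<lambda>(p, t). wave_deform p t) \<circ> ?f)"
  proof -
    have "continuous_on ?D (\<lambda>z. ?w (theta_at (fst (fst z)) (snd z), snd (fst z)))"
      unfolding theta_at_def
      by (intro continuous_on_compose2[OF continuous_on_wave_point] continuous_intros)
        (auto simp: wave_dom_def theta_at_range[unfolded theta_at_def, simplified])
    then show ?thesis by (rule continuous_on_eq) (auto simp: wave_deform_wave_point)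
  qed
  ultimately show ?thesis
    using continuous_compose_quotient_map[of "top_of_set ?D" "top_of_set ?S" ?f euclidean]
    unfolding continuous_map_iff_continuous by blast
qed

lemma r_nonzero_eq:
  assumes "p \<in> X_nonzero" "t \<in> {0..1}" shows "r_nonzero p t = wave_deform p t"
proof -
  obtain \<theta>0 where "\<theta>0 \<in> {0<..pi}" "p \<in> X_space \<theta>0" "fst (fst p) \<noteq> 0"
    using assms(1) by (auto simp: X_nonzero_def X_union_def)
  then obtain P0 a0 s0 where w0: "(\<theta>0, P0, a0, s0) \<in> wave_dom" "p = wave_point \<theta>0 P0 a0 s0"
    by (metis X_space_wave_point)
  have P0: "P0 \<noteq> 0" using \<open>fst (fst p) \<noteq> 0\<close> by (simp add: w0 wave_point_fst)
  have r: "\<theta>0 \<in> {0<..pi}" "P0 \<in> {-1..1}" "a0 \<in> sphere 0 1" "s0 \<in> {0..2*pi}"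
    using w0 by (auto simp: wave_dom_def)
  have xp: "X_point \<theta> P a (gamma_cyl \<theta> P s) = wave_point \<theta> P a s"
    if "(\<theta>, P, a, s) \<in> wave_dom" "P \<noteq> 0" for \<theta> P a s
    using that X_point_gamma_cyl[of \<theta> P s a] by (simp add: wave_dom_def wave_point_def)
  have td: "(theta_at \<theta> t, P, a, s) \<in> wave_dom" if "(\<theta>, P, a, s) \<in> wave_dom" for \<theta> P a s
    using that assms(2) by (auto simp: wave_dom_def theta_at_range[simplified])
  show ?thesis unfolding r_nonzero_def
  proof (rule the_equality)
    have "P0 \<in> {-1..1} - {0}" using r P0 by simp
    moreover have "p = X_point \<theta>0 P0 a0 (gamma_cyl \<theta>0 P0 s0)"
      "wave_deform p t = X_point (theta_at \<theta>0 t) P0 a0 (gamma_cyl (theta_at \<theta>0 t) P0 s0)"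
      unfolding xp[OF w0(1) P0] xp[OF td[OF w0(1)] P0] using w0 wave_deform_wave_point assms(2) by auto
    ultimately show "\<exists>\<theta>\<in>{0<..pi}. \<exists>P\<in>{-1..1} - {0}. \<exists>a\<in>sphere 0 1. \<exists>s\<in>{0..2*pi}.
        p = X_point \<theta> P a (gamma_cyl \<theta> P s) \<and>
        wave_deform p t = X_point (theta_at \<theta> t) P a (gamma_cyl (theta_at \<theta> t) P s)"
      using r by blast
  next
    fix p' assume "\<exists>\<theta>\<in>{0<..pi}. \<exists>P\<in>{-1..1} - {0}. \<exists>a\<in>sphere 0 1. \<exists>s\<in>{0..2*pi}.
        p = X_point \<theta> P a (gamma_cyl \<theta> P s) \<and> p' = X_point (theta_at \<theta> t) P a (gamma_cyl (theta_at \<theta> t) P s)"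
    then obtain \<theta> P a s where d: "(\<theta>, P, a, s) \<in> wave_dom" "P \<noteq> 0"
      and p: "p = X_point \<theta> P a (gamma_cyl \<theta> P s)" "p' = X_point (theta_at \<theta> t) P a (gamma_cyl (theta_at \<theta> t) P s)"
      unfolding wave_dom_def by (elim bexE conjE) blast
    show "p' = wave_deform p t"
      unfolding p xp[OF d] xp[OF td[OF d(1)] d(2)] using wave_deform_wave_point[OF d(1) assms(2)] by simp
  qed
qed

text \<open>Points with \<open>P = 0\<close> are limits of points with \<open>P \<noteq> 0\<close>, so the limit in \<open>r_deform\<close> is
  determined.\<close>

lemma r_deform_eq:
  assumes "p \<in> X_union {0<..pi}" "t \<in> {0..1}" shows "r_deform p t = wave_deform p t"
proof (cases "p \<in> X_nonzero")
  case True then show ?thesis using r_nonzero_eq assms(2) by (simp add: r_deform_def)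
next
  case False
  then have p0: "fst (fst p) = 0" using assms(1) by (cases p) (auto simp: X_nonzero_def)
  obtain \<theta> P a s where w: "(\<theta>, P, a, s) \<in> wave_dom" "p = wave_point \<theta> P a s"
    using assms(1) unfolding X_union_wave by auto
  have "P = 0" using p0 by (simp add: w wave_point_fst)
  \<comment> \<open>Only P moves away from 0; \<theta>, a and s stay fixed, so joint continuity at P
    = 0 gives the convergence.\<close>
  define f where "f n = (wave_point \<theta> (inverse (real (Suc n))) a s, t)" for n
  have wd: "(\<theta>, inverse (real (Suc n)), a, s) \<in> wave_dom" for n
    using w(1) by (auto simp: wave_dom_def inverse_eq_divide field_simps)
  have "f n \<in> X_nonzero \<times> {0..1} - {(p, t)}" for n
  proof -
    have "wave_point \<theta> (inverse (real (Suc n))) a s \<in> X_union {0<..pi}" unfolding X_union_wave using wd by force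
    moreover have "fst (fst (wave_point \<theta> (inverse (real (Suc n))) a s)) \<noteq> 0"
      by (simp add: wave_point_fst del: of_nat_Suc)
    ultimately show ?thesis using assms(2) p0 unfolding f_def X_nonzero_def by (auto simp: case_prod_beta)
  qed
  moreover have "f \<longlonglongrightarrow> (p, t)"
  proof -
    have "(\<lambda>n. (\<theta>, inverse (real (Suc n)), a, s)) \<longlonglongrightarrow> (\<theta>, 0, a, s)"
      by (intro tendsto_intros LIMSEQ_inverse_real_of_nat)
    then have "(\<lambda>n. (\<lambda>(\<theta>, P, a, s). wave_point \<theta> P a s) (\<theta>, inverse (real (Suc n)), a, s)) \<longlonglongrightarrow>
        (\<lambda>(\<theta>, P, a, s). wave_point \<theta> P a s) (\<theta>, 0, a, s)"
      by (rule continuous_on_tendsto_compose[OF continuous_on_wave_point]) (use w wd \<open>P = 0\<close> in auto)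
    then show ?thesis unfolding f_def w \<open>P = 0\<close> by (intro tendsto_Pair tendsto_const) simp
  qed
  ultimately have lp: "(p, t) islimpt X_nonzero \<times> {0..1}" unfolding islimpt_sequential by blast
  have "((\<lambda>(p, t). wave_deform p t) \<longlongrightarrow> (\<lambda>(p, t). wave_deform p t) (p, t)) (at (p, t) within X_union {0<..pi} \<times> {0..1})"
    using continuous_on_wave_deform assms unfolding continuous_on_def by blast
  then have "((\<lambda>(p, t). wave_deform p t) \<longlongrightarrow> wave_deform p t) (at (p, t) within X_nonzero \<times> {0..1})"
    unfolding prod.case by (rule tendsto_within_subset) (auto simp: X_nonzero_def)
  then have "((\<lambda>(p, t). r_nonzero p t) \<longlongrightarrow> wave_deform p t) (at (p, t) within X_nonzero \<times> {0..1})"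
    by (rule Lim_transform_eventually)
      (auto simp: eventually_at_filter r_nonzero_eq intro!: always_eventually)
  then have "Lim (at (p, t) within X_nonzero \<times> {0..1}) (\<lambda>(p', t'). r_nonzero p' t') = wave_deform p t"
    using lp by (intro tendsto_Lim) (simp add: trivial_limit_within)
  then show ?thesis using False by (simp add: r_deform_def)
qed

lemma r_deform_wave_point:
  assumes "(\<theta>, P, a, s) \<in> wave_dom" "t \<in> {0..1}"
  shows "r_deform (wave_point \<theta> P a s) t = wave_point (theta_at \<theta> t) P a s"
proof -
  have "wave_point \<theta> P a s \<in> X_union {0<..pi}" unfolding X_union_wave using assms(1) by force
  then show ?thesis using assms by (simp add: r_deform_eq wave_deform_wave_point)
qed

lemma continuous_on_r_deform: "continuous_on (X_union {0<..pi} \<times> {0..1}) (\<lambda>(p, t). r_deform p t)"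
  by (rule continuous_on_eq[OF continuous_on_wave_deform]) (auto simp: r_deform_eq)

lemma r_deform_in_X_space:
  assumes "\<theta> \<in> {0<..pi}" "p \<in> X_space \<theta>" "t \<in> {0..1}" shows "r_deform p t \<in> X_space (theta_at \<theta> t)"
proof -
  obtain P a s where w: "(\<theta>, P, a, s) \<in> wave_dom" "p = wave_point \<theta> P a s"
    using X_space_wave_point[OF assms(1,2)] .
  then have "(theta_at \<theta> t, P, a, s) \<in> wave_dom" using assms theta_at_range by (auto simp: wave_dom_def)
  then show ?thesis using w assms(3) by (simp add: r_deform_wave_point wave_point_in_X_space)
qed

lemma r_deform_1: "\<theta> \<in> {0<..pi} \<Longrightarrow> p \<in> X_space \<theta> \<Longrightarrow> r_deform p 1 = p"
  by (metis X_space_wave_point atLeastAtMost_iff order_refl r_deform_wave_point theta_at_1 zero_le_one)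

lemma r_deform_torus:
  assumes "\<theta> \<in> {0<..pi}" "p \<in> X_space \<theta>" "t \<in> {0..1}" "g \<in> torus"
  shows "r_deform (map_prod (conj_by g) (conj_by g) p) t = map_prod (conj_by g) (conj_by g) (r_deform p t)"
proof -
  obtain P a s where w: "(\<theta>, P, a, s) \<in> wave_dom" "p = wave_point \<theta> P a s"
    using X_space_wave_point[OF assms(1,2)] .
  obtain \<tau> where g: "g = (cis \<tau>, 0)" using assms(4) by (auto simp: torus_def)
  have e: "map_prod (conj_by g) (conj_by g) (wave_point \<theta> P a s) = wave_point \<theta> P (cis (2 * \<tau>) * a) s" for \<theta>
    by (simp add: g wave_point_def X_curve_torus)
  have "(\<theta>, P, cis (2 * \<tau>) * a, s) \<in> wave_dom" using w(1) by (simp add: wave_dom_def norm_mult)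
  then show ?thesis using w assms(3) by (simp add: e r_deform_wave_point)
qed

section \<open>Classes of quadruples\<close>

definition pair_conj :: "quat \<Rightarrow> quat \<times> quat \<Rightarrow> quat \<times> quat" where
  "pair_conj g = map_prod (conj_by g) (conj_by g)"

definition quad_of :: "quat \<times> quat \<Rightarrow> quat \<times> quat \<Rightarrow> quad" where
  "quad_of p p' = (fst p, snd p, fst p', snd p')"

text \<open>The parameter b describes the first pair and a the second, in keeping with the order of
  \<open>comparison\<close>: the map to study is the inverse of a times b.\<close>

definition pair_point :: "real \<Rightarrow> quat \<Rightarrow> quat \<Rightarrow> quad" where
  "pair_point \<theta> a b = quad_of (Phi_inv_rep \<theta> b) (Phi_inv_rep (pi - \<theta>) a)"

lemma quad_conj_quad_of: "quad_conj g (quad_of p p') = quad_of (pair_conj g p) (pair_conj g p')"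
  by (simp add: quad_conj_def quad_of_def pair_conj_def case_prod_beta)

lemma quad_of_eq [simp]: "quad_of p p' = quad_of r r' \<longleftrightarrow> p = r \<and> p' = r'"
  by (auto simp: quad_of_def prod_eq_iff)

lemma quad_of_cases: obtains p p' where "m = quad_of p p'"
  by (metis fst_conv prod_cases4 quad_of_def snd_conv)

lemma pair_conj_pair_conj:
  "g \<in> carrier SU2 \<Longrightarrow> h \<in> carrier SU2 \<Longrightarrow> p \<in> carrier SU2 \<times> carrier SU2 \<Longrightarrow>
    pair_conj g (pair_conj h p) = pair_conj (qmult g h) p"
  by (cases p) (simp add: pair_conj_def conj_by_conj_by)

lemma pair_conj_one: "p \<in> carrier SU2 \<times> carrier SU2 \<Longrightarrow> pair_conj (1, 0) p = p"
  by (cases p) (simp add: pair_conj_def conj_by_one)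

lemma SU2_one_closed [simp]: "(1, 0) \<in> carrier SU2"
  by (simp add: SU2_iff)

lemma pair_conj_inv:
  assumes "g \<in> carrier SU2" "p \<in> carrier SU2 \<times> carrier SU2"
  shows "pair_conj (inv\<^bsub>SU2\<^esub> g) (pair_conj g p) = p" "pair_conj g (pair_conj (inv\<^bsub>SU2\<^esub> g) p) = p"
  using assms by (cases p; simp add: pair_conj_def conj_by_inv)+

lemma X_space_subset: "X_space \<theta> \<subseteq> carrier SU2 \<times> carrier SU2"
  by (auto simp: X_space_def)

lemma comm_trace_pair_conj:
  assumes "g \<in> carrier SU2" "p \<in> carrier SU2 \<times> carrier SU2"
  shows "comm_trace (pair_conj g p) = comm_trace p"
  using assms by (cases p)
    (simp add: pair_conj_def comm_trace_commutator commutator_conj_by conj_by_SU2 Re_fst_conj_by)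

text \<open>Such a g commutes with cis \<theta>, whose imaginary part is nonzero, so its j-component
  vanishes. At \<theta> = \<pi> this would fail, as -1 is central.\<close>

lemma torus_centralizer:
  assumes g: "g \<in> carrier SU2" and \<theta>: "\<theta> \<in> {0<..<pi}" and p: "p \<in> X_space \<theta>" "pair_conj g p \<in> X_space \<theta>"
  shows "g \<in> torus"
proof -
  obtain x y where pe: "p = (x, y)" by (cases p)
  obtain z w where ge: "g = (z, w)" by (cases g)
  have "conj_by g (commutator x y) = (cis \<theta>, 0)"
    using p g by (simp add: pe pair_conj_def X_space_def commutator_conj_by)
  then have "conj_by g (cis \<theta>, 0) = (cis \<theta>, 0)" using p by (simp add: pe X_space_def)
  then have "z * cis \<theta> * cnj z + w * cnj (cis \<theta>) * cnj w = cis \<theta>"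
    unfolding conj_by_eq[OF g] by (simp add: ge qmult_def)
  moreover have n: "(cmod z)\<^sup>2 + (cmod w)\<^sup>2 = 1" using g by (simp add: ge SU2_iff)
  then have "z * cnj z + w * cnj w = 1"
    unfolding complex_norm_square[symmetric] of_real_add[symmetric] by simp
  ultimately have "z * cis \<theta> * cnj z + w * cnj (cis \<theta>) * cnj w = cis \<theta> * (z * cnj z + w * cnj w)" by simp
  then have "w * cnj w * (cis \<theta> - cnj (cis \<theta>)) = 0" by (auto simp: algebra_simps)
  moreover have "sin \<theta> > 0" using \<theta> by (intro sin_gt_zero) auto
  then have "cis \<theta> - cnj (cis \<theta>) \<noteq> 0" by (simp add: complex_eq_iff)
  ultimately have w: "w = 0" by simp
  then have "cmod z = 1" using n by (simp add: power2_eq_1_iff) (metis abs_norm_cancel abs_1 abs_minus_cancel)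
  then have "z = cis (Arg2pi z)" using Arg2pi_eq[of z] by (simp add: cis_conv_exp)
  then show ?thesis unfolding torus_def ge w by blast
qed

lemma cis_mult_complement: "qmult (cis \<theta>, 0) (cis (pi - \<theta>), 0) = (-1, 0)"
  by (simp add: qmult_def cis_mult)

lemma quad_of_in_M:
  assumes "p \<in> X_space \<theta>" "p' \<in> X_space (pi - \<theta>)" shows "quad_of p p' \<in> M_space"
  using assms by (cases p; cases p') (simp add: quad_of_def M_space_def X_space_def cis_mult_complement)

lemma quad_of_M:
  "quad_of p p' \<in> M_space \<Longrightarrow> p \<in> carrier SU2 \<times> carrier SU2 \<and> p' \<in> carrier SU2 \<times> carrier SU2"
  by (cases p; cases p') (simp add: quad_of_def M_space_def)

lemma quad_conj_M:
  assumes g: "g \<in> carrier SU2" and m: "m \<in> M_space" shows "quad_conj g m \<in> M_space"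
proof -
  obtain x y x' y' where me: "m = (x, y, x', y')" by (metis prod_cases4)
  have s: "x \<in> carrier SU2" "y \<in> carrier SU2" "x' \<in> carrier SU2" "y' \<in> carrier SU2"
    and c: "commutator x y \<otimes>\<^bsub>SU2\<^esub> commutator x' y' = (-1, 0)" using m by (auto simp: me M_space_def)
  have "conj_by g (commutator x y \<otimes>\<^bsub>SU2\<^esub> commutator x' y') = (-1, 0)"
  proof -
    have "qmult g (-1, 0) = qmult (-1, 0) g" by (simp add: qmult_def)
    then have "conj_by g (-1, 0) = qmult (-1, 0) (qmult g (inv\<^bsub>SU2\<^esub> g))"
      by (simp add: conj_by_def qmult_assoc)
    also have "\<dots> = (-1, 0)" using SU2.r_inv[OF g] by (simp add: qmult_def)
    finally show ?thesis using c by simp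
  qed
  then have "commutator (conj_by g x) (conj_by g y) \<otimes>\<^bsub>SU2\<^esub> commutator (conj_by g x') (conj_by g y') = (-1, 0)"
    using s g by (simp add: commutator_conj_by conj_by_mult commutator_SU2 del: SU2_mult)
  then show ?thesis using s g by (simp add: me quad_conj_def M_space_def conj_by_SU2)
qed

lemma quad_conj_quad_conj:
  assumes "g \<in> carrier SU2" "h \<in> carrier SU2" "m \<in> M_space"
  shows "quad_conj g (quad_conj h m) = quad_conj (qmult g h) m"
proof -
  obtain p p' where "m = quad_of p p'" by (rule quad_of_cases)
  then show ?thesis using assms quad_of_M by (simp add: quad_conj_quad_of pair_conj_pair_conj)
qed

lemma quad_conj_one: "m \<in> M_space \<Longrightarrow> quad_conj (1, 0) m = m"
  by (metis quad_of_cases quad_of_M quad_conj_quad_of pair_conj_one)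

lemma q_proj_self: "m \<in> M_space \<Longrightarrow> m \<in> q_proj m"
  unfolding q_proj_def using quad_conj_one[of m] by (metis SU2_one_closed imageI)

lemma q_proj_quad_conj:
  assumes "g \<in> carrier SU2" "m \<in> M_space" shows "q_proj (quad_conj g m) = q_proj m"
proof (intro equalityI subsetI)
  fix n assume "n \<in> q_proj (quad_conj g m)"
  then show "n \<in> q_proj m" using assms by (auto simp: q_proj_def quad_conj_quad_conj qmult_SU2)
next
  fix n assume "n \<in> q_proj m"
  then obtain h where h: "h \<in> carrier SU2" "n = quad_conj h m" by (auto simp: q_proj_def)
  have "qmult (qmult h (inv\<^bsub>SU2\<^esub> g)) g = h"
    using SU2.inv_solve_right[of h "qmult h (inv\<^bsub>SU2\<^esub> g)" g] SU2.l_inv[OF assms(1)] SU2.r_one[OF h(1)]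
    by (simp add: qmult_assoc)
  then have "n = quad_conj (qmult h (inv\<^bsub>SU2\<^esub> g)) (quad_conj g m)"
    using assms h by (simp add: quad_conj_quad_conj qmult_SU2)
  then show "n \<in> q_proj (quad_conj g m)" unfolding q_proj_def using assms h by (simp add: qmult_SU2)
qed

lemma q_proj_eqE:
  assumes "m' \<in> M_space" "q_proj m = q_proj m'" obtains g where "g \<in> carrier SU2" "m' = quad_conj g m"
  using q_proj_self[OF assms(1)] assms(2) unfolding q_proj_def by blast

lemma pair_point_M:
  "\<theta> \<in> {0<..<pi} \<Longrightarrow> a \<in> carrier SU2 \<Longrightarrow> b \<in> carrier SU2 \<Longrightarrow> pair_point \<theta> a b \<in> M_space"
  unfolding pair_point_def by (rule quad_of_in_M[of _ \<theta>]) (auto intro: Phi_inv_rep_in_X_space)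

definition quad_trace :: "quad \<Rightarrow> real" where
  "quad_trace = (\<lambda>(x, y, x', y'). comm_trace (x, y))"

lemma quad_trace_quad_of: "quad_trace (quad_of p p') = comm_trace p"
  by (simp add: quad_trace_def quad_of_def)

lemma quad_trace_quad_conj:
  "g \<in> carrier SU2 \<Longrightarrow> m \<in> M_space \<Longrightarrow> quad_trace (quad_conj g m) = quad_trace m"
  by (metis quad_of_cases quad_of_M quad_conj_quad_of quad_trace_quad_of comm_trace_pair_conj)

lemma quad_trace_pair_point:
  assumes "\<theta> \<in> {0<..<pi}" "b \<in> carrier SU2" shows "quad_trace (pair_point \<theta> a b) = cos \<theta>"
  using assms by (auto simp: pair_point_def quad_trace_quad_of intro!: comm_trace_X_space Phi_inv_rep_in_X_space)

lemma quad_trace_W: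
  assumes "(x, y, x', y') \<in> M_space" "(x, y) \<in> W_space \<theta>" shows "quad_trace (x, y, x', y') = cos \<theta>"
  using assms by (auto simp: quad_trace_def W_space_def comm_trace_commutator Re_fst_conj_by)

text \<open>Dividing the imaginary part of c by sin \<theta> gives a unit imaginary quaternion, the
  first entry of some pair in the space at \<pi>. By surjectivity of the parametrization at \<pi>,
  that entry is a conjugate of i, and the same g conjugates cis \<theta> to c.\<close>

lemma conj_by_cis_exists:
  assumes "c \<in> carrier SU2" "Re (fst c) = cos \<theta>" "\<theta> \<in> {0<..<pi}"
  obtains g where "g \<in> carrier SU2" "c = conj_by g (cis \<theta>, 0)"
proof -
  obtain z w where c: "c = (z, w)" by (cases c)
  have s: "sin \<theta> > 0" using assms(3) by (intro sin_gt_zero) auto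
  have "(Re z)\<^sup>2 + (Im z)\<^sup>2 + (cmod w)\<^sup>2 = 1" using assms(1) by (simp add: c SU2_iff cmod_power2)
  then have n: "(Im z)\<^sup>2 + (cmod w)\<^sup>2 = (sin \<theta>)\<^sup>2" using assms(2) by (simp add: c sin_squared_eq)
  define P where "P = Im z / sin \<theta>"
  define v where "v = w / of_real (sin \<theta>)"
  have "P\<^sup>2 + (cmod v)\<^sup>2 = 1"
    using s n by (simp add: P_def v_def norm_divide power_divide add_divide_distrib[symmetric])
  then have "P\<^sup>2 \<le> 1" and v: "sqrt (1 - P\<^sup>2) = cmod v"
    using zero_le_power2[of "cmod v"] by (linarith, simp add: real_sqrt_unique eq_diff_eq add.commute)
  then have P: "P \<in> {-1..1}" by (simp add: abs_square_le_1 abs_le_iff)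
  define a where "a = (if v = 0 then 1 else v / of_real (cmod v))"
  have "cmod a = 1" by (simp add: a_def norm_divide)
  then have X: "X_curve pi P a 0 \<in> X_space pi" using P by (intro X_curve_in_X_space) auto
  have "pi \<in> {0<..pi}" by simp
  then obtain g where g: "g \<in> carrier SU2" "X_curve pi P a 0 = Phi_inv_rep pi g"
    using X_space_Phi_inv_rep X by metis
  then have "conj_by g (\<i>, 0) = fst (X_curve pi P a 0)" by (simp add: Phi_inv_rep_pi)
  also have "\<dots> = (of_real P * \<i>, v)" unfolding X_curve_def v by (simp add: a_def cis_pi_half)
  finally have gi: "conj_by g (\<i>, 0) = (of_real P * \<i>, v)" .
  obtain p q where ge: "g = (p, q)" by (cases g)
  have "(cmod p)\<^sup>2 + (cmod q)\<^sup>2 = 1" using g by (simp add: ge SU2_iff)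
  then have pq: "p * cnj p + q * cnj q = 1"
    unfolding complex_norm_square[symmetric] of_real_add[symmetric] by simp
  have i: "p * \<i> * cnj p + q * cnj \<i> * cnj q = of_real P * \<i>" "- (p * \<i> * q) + q * cnj \<i> * p = v"
    using gi unfolding conj_by_eq[OF g(1)] by (auto simp: ge qmult_def)
  have cis: "cis \<theta> = of_real (cos \<theta>) + of_real (sin \<theta>) * \<i>" by (simp add: complex_eq_iff)
  have "fst (conj_by g (cis \<theta>, 0)) = of_real (cos \<theta>) * (p * cnj p + q * cnj q)
      + of_real (sin \<theta>) * (p * \<i> * cnj p + q * cnj \<i> * cnj q)"
    unfolding conj_by_eq[OF g(1)] by (simp add: ge qmult_def cis algebra_simps)
  also have "\<dots> = z" unfolding pq i(1) using s assms(2) by (simp add: P_def c complex_eq_iff)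
  finally have 1: "fst (conj_by g (cis \<theta>, 0)) = z" .
  have "snd (conj_by g (cis \<theta>, 0)) = of_real (sin \<theta>) * (- (p * \<i> * q) + q * cnj \<i> * p)"
    unfolding conj_by_eq[OF g(1)] by (simp add: ge qmult_def cis algebra_simps)
  also have "\<dots> = w" unfolding i(2) using s by (simp add: v_def)
  finally have "conj_by g (cis \<theta>, 0) = c" using 1 by (simp add: c prod_eq_iff)
  then show ?thesis using that g(1) by metis
qed

text \<open>Conjugating back by k makes the first commutator equal to cis \<theta>; the equation of
  M then forces the second to be cis (\<pi> - \<theta>).\<close>

lemma W_space_pair_point:
  assumes m: "(x, y, x', y') \<in> M_space" and W: "(x, y) \<in> W_space \<theta>" and \<theta>: "\<theta> \<in> {0<..<pi}"
  obtains g a b where "g \<in> carrier SU2" "a \<in> carrier SU2" "b \<in> carrier SU2"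
    "(x, y, x', y') = quad_conj g (pair_point \<theta> a b)"
proof -
  have s: "x \<in> carrier SU2" "y \<in> carrier SU2" "x' \<in> carrier SU2" "y' \<in> carrier SU2"
    using m by (auto simp: M_space_def)
  obtain k where k: "k \<in> carrier SU2" "commutator x y = conj_by k (cis \<theta>, 0)" using W by (auto simp: W_space_def)
  define k' where "k' = inv\<^bsub>SU2\<^esub> k"
  have k': "k' \<in> carrier SU2" using k by (simp add: k'_def)
  define p where "p = pair_conj k' (x, y)"
  define p' where "p' = pair_conj k' (x', y')"
  have q: "quad_of p p' = quad_conj k' (x, y, x', y')" by (simp add: p_def p'_def quad_of_def pair_conj_def quad_conj_def)
  have c1: "commutator (conj_by k' x) (conj_by k' y) = (cis \<theta>, 0)"
    using s k k' conj_by_inv(1)[of k "(cis \<theta>, 0)"] by (simp add: commutator_conj_by k'_def)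
  then have p: "p \<in> X_space \<theta>" using s k' by (simp add: p_def pair_conj_def X_space_def conj_by_SU2)
  define c' where "c' = commutator (conj_by k' x') (conj_by k' y')"
  have c': "c' \<in> carrier SU2" using s k' by (simp add: c'_def commutator_SU2 conj_by_SU2)
  have "quad_of p p' \<in> M_space" unfolding q by (rule quad_conj_M[OF k' m])
  then have "qmult (cis \<theta>, 0) c' = (-1, 0)"
    using c1 by (simp add: q quad_conj_def M_space_def c'_def)
  then have "qmult (cis \<theta>, 0) c' = qmult (cis \<theta>, 0) (cis (pi - \<theta>), 0)" by (simp only: cis_mult_complement)
  moreover have "qmult (cis (- \<theta>), 0) (qmult (cis \<theta>, 0) v) = v" for v
    by (cases v) (simp add: qmult_def mult.assoc[symmetric] cis_mult)
  ultimately have "c' = (cis (pi - \<theta>), 0)" by metis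
  then have p': "p' \<in> X_space (pi - \<theta>)" using s k' by (simp add: p'_def c'_def pair_conj_def X_space_def conj_by_SU2)
  have r: "\<theta> \<in> {0<..pi}" "pi - \<theta> \<in> {0<..pi}" using \<theta> by auto
  obtain b where b: "b \<in> carrier SU2" "p = Phi_inv_rep \<theta> b" using X_space_Phi_inv_rep[OF r(1) p] .
  obtain a where a: "a \<in> carrier SU2" "p' = Phi_inv_rep (pi - \<theta>) a" using X_space_Phi_inv_rep[OF r(2) p'] .
  have "(x, y, x', y') = quad_conj k (quad_of p p')"
    unfolding q using k k' m SU2.r_inv[OF k(1)] by (simp add: quad_conj_quad_conj k'_def quad_conj_one)
  then show ?thesis using that[OF k(1) a(1) b(1)] by (simp add: pair_point_def a b)
qed

lemma A_at_pair_point: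
  assumes "\<theta> \<in> {0<..<pi}" "c \<in> A_at \<theta>"
  obtains a b where "a \<in> carrier SU2" "b \<in> carrier SU2" "c = q_proj (pair_point \<theta> a b)"
proof -
  obtain x y x' y' where m: "(x, y, x', y') \<in> M_space" "(x, y) \<in> W_space \<theta>" and c: "c = q_proj (x, y, x', y')"
    using assms(2) by (auto simp: A_at_def)
  obtain g a b where g: "g \<in> carrier SU2" "a \<in> carrier SU2" "b \<in> carrier SU2"
    "(x, y, x', y') = quad_conj g (pair_point \<theta> a b)" using W_space_pair_point[OF m assms(1)] .
  then have "c = q_proj (pair_point \<theta> a b)" using c assms(1) by (simp add: q_proj_quad_conj pair_point_M)
  then show ?thesis using that g by blast
qed

lemma pair_point_in_A_at:
  assumes "\<theta> \<in> {0<..<pi}" "a \<in> carrier SU2" "b \<in> carrier SU2"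
  shows "q_proj (pair_point \<theta> a b) \<in> A_at \<theta>" "q_proj (pair_point \<theta> a b) \<in> U_set \<inter> V_set"
proof -
  obtain x y where p: "Phi_inv_rep \<theta> b = (x, y)" by (cases "Phi_inv_rep \<theta> b")
  obtain x' y' where p': "Phi_inv_rep (pi - \<theta>) a = (x', y')" by (cases "Phi_inv_rep (pi - \<theta>) a")
  have e: "pair_point \<theta> a b = (x, y, x', y')" by (simp add: pair_point_def quad_of_def p p')
  have X: "(x, y) \<in> X_space \<theta>" using Phi_inv_rep_in_X_space[of \<theta> b] assms p by auto
  then have W: "(x, y) \<in> W_space \<theta>"
    using conj_by_one[of "(cis \<theta>, 0)"] by (auto simp: X_space_def W_space_def intro!: bexI[of _ "(1, 0)"])
  show A: "q_proj (pair_point \<theta> a b) \<in> A_at \<theta>"    unfolding A_at_def e by (rule CollectI) (use pair_point_M[OF assms, unfolded e] W in blast)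
  then show "q_proj (pair_point \<theta> a b) \<in> U_set \<inter> V_set" using assms(1) by (auto simp: U_set_def V_set_def)
qed

text \<open>Membership in U and in V may be witnessed by two angles. Both have the invariant trace
  as cosine, so they agree, and the common angle avoids 0 and \<pi>.\<close>

lemma UV_pair_point:
  assumes "c \<in> U_set \<inter> V_set"
  obtains \<theta> a b where "\<theta> \<in> {0<..<pi}" "a \<in> carrier SU2" "b \<in> carrier SU2" "c = q_proj (pair_point \<theta> a b)"
proof -
  obtain \<theta>1 \<theta>2 where t: "\<theta>1 \<in> {0..<pi}" "c \<in> A_at \<theta>1" "\<theta>2 \<in> {0<..pi}" "c \<in> A_at \<theta>2"
    using assms by (auto simp: U_set_def V_set_def)
  obtain m1 where m1: "m1 \<in> M_space" "quad_trace m1 = cos \<theta>1" "c = q_proj m1"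
    using t(2) quad_trace_W by (auto simp: A_at_def)
  obtain m2 where m2: "m2 \<in> M_space" "quad_trace m2 = cos \<theta>2" "c = q_proj m2"
    using t(4) quad_trace_W by (auto simp: A_at_def)
  obtain g where "g \<in> carrier SU2" "m2 = quad_conj g m1" using q_proj_eqE[of m2 m1] m1 m2 by metis
  then have "cos \<theta>1 = cos \<theta>2" using m1 m2 quad_trace_quad_conj by metis
  then have "\<theta>1 = \<theta>2" using t cos_inj_pi[of \<theta>1 \<theta>2] by auto
  then have "\<theta>1 \<in> {0<..<pi}" using t by auto
  then show ?thesis using A_at_pair_point[OF _ t(2)] that by blast
qed

lemma quad_trace_pair_point_exists:
  assumes m: "m \<in> M_space" and t: "quad_trace m = cos \<theta>" "\<theta> \<in> {0<..<pi}"
  obtains g a b where "g \<in> carrier SU2" "a \<in> carrier SU2" "b \<in> carrier SU2" "m = quad_conj g (pair_point \<theta> a b)"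
proof -
  obtain x y x' y' where e: "m = (x, y, x', y')" by (metis prod_cases4)
  have s: "x \<in> carrier SU2" "y \<in> carrier SU2" using m by (auto simp: e M_space_def)
  then have "Re (fst (commutator x y)) = cos \<theta>" using t by (simp add: e quad_trace_def comm_trace_commutator)
  then obtain k where "k \<in> carrier SU2" "commutator x y = conj_by k (cis \<theta>, 0)"
    using conj_by_cis_exists[OF commutator_SU2[OF s] _ t(2)] by metis
  then have "(x, y) \<in> W_space \<theta>" using s by (auto simp: W_space_def)
  then show ?thesis using W_space_pair_point[OF m[unfolded e] _ t(2)] that unfolding e by metis
qed

text \<open>Two representatives differ by a conjugation. The trace gives equality of angles, and the
  conjugating element then centralizes cis \<theta>, so the representatives form one
  T-orbit.\<close>

lemma pair_point_representatives:
  assumes \<theta>: "\<theta> \<in> {0<..<pi}" "\<theta>' \<in> {0..pi}" and ab: "a \<in> carrier SU2" "b \<in> carrier SU2"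
    and p: "quad_of p p' \<in> q_proj (pair_point \<theta> a b)" "p \<in> X_space \<theta>'"
  obtains t where "\<theta>' = \<theta>" "t \<in> torus" "p = Phi_inv_rep \<theta> (qmult t b)" "p' = Phi_inv_rep (pi - \<theta>) (qmult t a)"
proof -
  have r: "\<theta> \<in> {0<..pi}" "pi - \<theta> \<in> {0<..pi}" using \<theta> by auto
  obtain g where g: "g \<in> carrier SU2" "quad_of p p' = quad_conj g (pair_point \<theta> a b)"
    using p(1) by (auto simp: q_proj_def)
  then have pp: "p = pair_conj g (Phi_inv_rep \<theta> b)" "p' = pair_conj g (Phi_inv_rep (pi - \<theta>) a)"
    by (simp_all add: pair_point_def quad_conj_quad_of)
  have X: "Phi_inv_rep \<theta> b \<in> X_space \<theta>" using r ab by (simp add: Phi_inv_rep_in_X_space)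
  have "cos \<theta>' = cos \<theta>"
    using comm_trace_pair_conj[OF g(1)] X_space_subset X comm_trace_X_space[OF X] comm_trace_X_space[OF p(2)] pp(1)
    by (metis subsetD)
  then have t: "\<theta>' = \<theta>" using \<theta> cos_inj_pi[of \<theta>' \<theta>] by auto
  have "g \<in> torus" using torus_centralizer[OF g(1) \<theta>(1) X] p(2) pp(1) t by simp
  then show ?thesis using that[OF t, of g] pp Phi_inv_rep_torus r ab by (simp add: pair_conj_def)
qed

lemma pair_point_torus:
  assumes "\<theta> \<in> {0<..<pi}" "a \<in> carrier SU2" "b \<in> carrier SU2" "t \<in> torus"
  shows "q_proj (pair_point \<theta> (qmult t a) (qmult t b)) = q_proj (pair_point \<theta> a b)"
proof -
  have "pair_point \<theta> (qmult t a) (qmult t b) = quad_conj t (pair_point \<theta> a b)"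
    using assms Phi_inv_rep_torus by (simp add: pair_point_def quad_conj_quad_of pair_conj_def)
  then show ?thesis using q_proj_quad_conj torus_SU2 pair_point_M assms by simp
qed

lemma pair_point_psu_class:
  assumes "\<theta> \<in> {0<..<pi}" "a \<in> carrier SU2" "b \<in> carrier SU2" "psu_class a' = psu_class a" "psu_class b' = psu_class b"
  shows "pair_point \<theta> a' b' = pair_point \<theta> a b"
proof -
  have r: "\<theta> \<in> {0<..pi}" "pi - \<theta> \<in> {0<..pi}" using assms by auto
  have "a' \<in> carrier SU2" "b' \<in> carrier SU2" using assms by (auto simp: psu_class_eq_iff)
  then have "Phi_inv_rep \<theta> b' = Phi_inv_rep \<theta> b" "Phi_inv_rep (pi - \<theta>) a' = Phi_inv_rep (pi - \<theta>) a"
    using assms Phi_inv_rep_eq_iff[OF r(1)] Phi_inv_rep_eq_iff[OF r(2)] by (simp_all add: psu_class_eq_iff)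
  then show ?thesis by (simp add: pair_point_def)
qed

lemma q_proj_pair_point_eqE:
  assumes \<theta>: "\<theta> \<in> {0<..<pi}" "\<theta>' \<in> {0<..<pi}"
    and ab: "a \<in> carrier SU2" "b \<in> carrier SU2" "a' \<in> carrier SU2" "b' \<in> carrier SU2"
    and eq: "q_proj (pair_point \<theta> a b) = q_proj (pair_point \<theta>' a' b')"
  obtains t where "\<theta>' = \<theta>" "t \<in> torus" "psu_class a' = psu_class (qmult t a)" "psu_class b' = psu_class (qmult t b)"
proof -
  have 1: "pair_point \<theta>' a' b' \<in> q_proj (pair_point \<theta> a b)"
    unfolding eq by (rule q_proj_self[OF pair_point_M[OF \<theta>(2) ab(3,4)]])
  have 2: "\<theta>' \<in> {0..pi}" using \<theta> by auto
  have "Phi_inv_rep \<theta>' b' \<in> X_space \<theta>'" using \<theta> ab by (auto intro: Phi_inv_rep_in_X_space)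
  then obtain t where t: "\<theta>' = \<theta>" "t \<in> torus" "Phi_inv_rep \<theta>' b' = Phi_inv_rep \<theta> (qmult t b)"
    "Phi_inv_rep (pi - \<theta>') a' = Phi_inv_rep (pi - \<theta>) (qmult t a)"
    by (rule pair_point_representatives[OF \<theta>(1) 2 ab(1,2) 1[unfolded pair_point_def[of \<theta>']]])
  have r: "\<theta> \<in> {0<..pi}" "pi - \<theta> \<in> {0<..pi}" using \<theta> by auto
  have "qmult t a \<in> carrier SU2" "qmult t b \<in> carrier SU2" using t(2) ab torus_SU2 qmult_SU2 by auto
  then have "psu_class a' = psu_class (qmult t a)" "psu_class b' = psu_class (qmult t b)"
    using t ab Phi_inv_rep_eq_iff[OF r(1)] Phi_inv_rep_eq_iff[OF r(2)] by (simp_all add: psu_class_eq_iff)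
  then show ?thesis using that t by blast
qed

section \<open>Quotient topologies\<close>

text \<open>If H acts transitively on the fibres, the saturation of an open set is the union of its
  preimages under H, hence open. Openness is wanted because it survives products.\<close>

lemma open_map_quotient_by_maps:
  assumes q: "quotient_map X Y f"
    and h: "\<And>h. h \<in> H \<Longrightarrow> continuous_map X X h" "\<And>h x. h \<in> H \<Longrightarrow> x \<in> topspace X \<Longrightarrow> f (h x) = f x"
    and t: "\<And>x y. x \<in> topspace X \<Longrightarrow> y \<in> topspace X \<Longrightarrow> f x = f y \<Longrightarrow> \<exists>h\<in>H. h x = y"
  shows "open_map X Y f"
  unfolding open_map_def
proof (intro allI impI)
  fix O' assume O: "openin X O'"
  then have OX: "O' \<subseteq> topspace X" by (rule openin_subset)
  have "{x \<in> topspace X. f x \<in> f ` O'} = (\<Union>h\<in>H. {x \<in> topspace X. h x \<in> O'})" (is "?L = ?R")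
  proof (intro equalityI subsetI)
    fix x assume x: "x \<in> ?L"
    then obtain y where y: "y \<in> O'" "f x = f y" by auto
    then have "y \<in> topspace X" using OX by blast
    then obtain k where "k \<in> H" "k x = y" using t[of x y] x y by auto
    then show "x \<in> ?R" using x y by auto
  next
    fix x assume "x \<in> ?R"
    then obtain k where k: "k \<in> H" "x \<in> topspace X" "k x \<in> O'" by auto
    then have "f x = f (k x)" using h(2) by simp
    then show "x \<in> ?L" using k by auto
  qed
  moreover have "openin X ?R" using h(1) O openin_continuous_map_preimage by (intro openin_Union) fastforce
  ultimately have "openin X {x \<in> topspace X. f x \<in> f ` O'}" by simp
  moreover have "f ` O' \<subseteq> topspace Y" using q OX by (auto simp: quotient_map_def)
  ultimately show "openin Y (f ` O')" using q unfolding quotient_map_def by blast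
qed

lemma open_map_map_prod:
  assumes "open_map X X' f" "open_map Y Y' g"
  shows "open_map (prod_topology X Y) (prod_topology X' Y') (map_prod f g)"
  unfolding open_map_def
proof (intro allI impI)
  fix W assume W: "openin (prod_topology X Y) W"
  show "openin (prod_topology X' Y') (map_prod f g ` W)" unfolding openin_prod_topology_alt
  proof (intro allI impI)
    fix x y assume "(x, y) \<in> map_prod f g ` W"
    then obtain a b where ab: "(a, b) \<in> W" "x = f a" "y = g b" by auto
    then obtain S T where "openin X S" "openin Y T" "a \<in> S" "b \<in> T" "S \<times> T \<subseteq> W"
      using W unfolding openin_prod_topology_alt by meson
    then show "\<exists>U V. openin X' U \<and> openin Y' V \<and> x \<in> U \<and> y \<in> V \<and> U \<times> V \<subseteq> map_prod f g ` W"
      using assms ab unfolding open_map_def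
      by (intro exI[of _ "f ` S"] exI[of _ "g ` T"]) auto
  qed
qed

text \<open>Without openness a product of quotient maps need not be a quotient map.\<close>

lemma quotient_map_map_prod_open:
  assumes "quotient_map X X' f" "open_map X X' f" "quotient_map Y Y' g" "open_map Y Y' g"
  shows "quotient_map (prod_topology X Y) (prod_topology X' Y') (map_prod f g)"
proof (rule continuous_open_imp_quotient_map)
  show "continuous_map (prod_topology X Y) (prod_topology X' Y') (map_prod f g)"
    using assms unfolding map_prod_def continuous_map_prod_top by (simp add: quotient_imp_continuous_map)
  show "open_map (prod_topology X Y) (prod_topology X' Y') (map_prod f g)"
    using assms by (intro open_map_map_prod)
  show "map_prod f g ` topspace (prod_topology X Y) = topspace (prod_topology X' Y')"
    using assms by (simp add: map_prod_surj_on quotient_map_def)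
qed

section \<open>Topology of PSU(2) and of pairs modulo T\<close>

lemma continuous_on_qmult:
  "continuous_on S f \<Longrightarrow> continuous_on S g \<Longrightarrow> continuous_on S (\<lambda>x. qmult (f x) (g x))"
  unfolding qmult_def by (intro continuous_intros)

lemma compact_SU2: "compact (carrier SU2)"
proof -
  have e: "carrier SU2 = {x. (cmod (fst x))\<^sup>2 + (cmod (snd x))\<^sup>2 = 1}" by (auto simp: SU2_def)
  have "closed (carrier SU2)" unfolding e by (intro closed_Collect_eq continuous_intros)
  moreover have "bounded (carrier SU2)"
  proof (rule boundedI)
    fix x assume "x \<in> carrier SU2"
    then show "norm x \<le> 1" by (cases x) (simp add: SU2_iff norm_Pair)
  qed
  ultimately show ?thesis by (simp add: compact_eq_bounded_closed)
qed

lemma quotient_map_psu_class: "quotient_map (top_of_set (carrier SU2)) PSU2_top psu_class"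
  unfolding PSU2_top_def by (rule quotient_map_quot_topology)

lemma open_map_psu_class: "open_map (top_of_set (carrier SU2)) PSU2_top psu_class"
proof (rule open_map_quotient_by_maps[OF quotient_map_psu_class, where H = "{id, uminus}"])
  fix h :: "quat \<Rightarrow> quat" assume "h \<in> {id, uminus}"
  then show "continuous_map (top_of_set (carrier SU2)) (top_of_set (carrier SU2)) h"
    by (auto simp: continuous_map_in_subtopology intro!: continuous_intros simp del: uminus_Pair)
qed (auto simp: psu_class_eq_iff minus_equation_iff)

lemma quotient_map_psu_class_pair:
  "quotient_map (top_of_set (carrier SU2 \<times> carrier SU2)) (prod_topology PSU2_top PSU2_top) (map_prod psu_class psu_class)"
  using quotient_map_map_prod_open[OF quotient_map_psu_class open_map_psu_class quotient_map_psu_class open_map_psu_class]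
  by simp

lemma continuous_map_psu_class: "continuous_map (top_of_set (carrier SU2)) PSU2_top psu_class"
  using quotient_map_psu_class quotient_imp_continuous_map by blast

lemma continuous_map_PSU2_division:
  "continuous_map (prod_topology PSU2_top PSU2_top) PSU2_top (\<lambda>(g, h). inv\<^bsub>PSU2\<^esub> g \<otimes>\<^bsub>PSU2\<^esub> h)"
proof (rule continuous_compose_quotient_map[OF quotient_map_psu_class_pair])
  let ?S = "carrier SU2 \<times> carrier SU2"
  let ?f = "\<lambda>x. qmult (cnj (fst (fst x)), - snd (fst x)) (snd x)"
  have "continuous_on ?S ?f" by (intro continuous_on_qmult continuous_intros)
  moreover have "?f \<in> ?S \<rightarrow> carrier SU2" by (auto intro!: qmult_SU2 simp: SU2_iff)
  ultimately have "continuous_map (top_of_set ?S) (top_of_set (carrier SU2)) ?f"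
    by (simp add: continuous_map_in_subtopology)
  from continuous_map_compose[OF this continuous_map_psu_class]
  have "continuous_map (top_of_set ?S) PSU2_top (psu_class \<circ> ?f)" .
  then show "continuous_map (top_of_set ?S) PSU2_top ((\<lambda>(g, h). inv\<^bsub>PSU2\<^esub> g \<otimes>\<^bsub>PSU2\<^esub> h) \<circ> map_prod psu_class psu_class)"
  proof (rule continuous_map_eq)
    fix x assume "x \<in> topspace (top_of_set ?S)"
    then obtain a b where x: "x = (a, b)" "a \<in> carrier SU2" "b \<in> carrier SU2" by auto
    have "(cnj (fst a), - snd a) \<in> carrier SU2" using SU2.inv_closed[OF x(2)] SU2_inv[OF x(2)] by simp
    then show "(psu_class \<circ> ?f) x = ((\<lambda>(g, h). inv\<^bsub>PSU2\<^esub> g \<otimes>\<^bsub>PSU2\<^esub> h) \<circ> map_prod psu_class psu_class) x"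
      using x by (simp add: psu_class_inv SU2_inv psu_class_mult)
  qed
qed

definition orbit_of :: "quat \<Rightarrow> quat \<Rightarrow> (quat set \<times> quat set) set" where
  "orbit_of a b = torus_orbit (psu_class a, psu_class b)"

lemma quotient_map_orbit_of:
  "quotient_map (top_of_set (carrier SU2 \<times> carrier SU2)) PP_T_top (\<lambda>(a, b). orbit_of a b)"
proof -
  have "quotient_map (top_of_set (carrier SU2 \<times> carrier SU2)) PP_T_top (torus_orbit \<circ> map_prod psu_class psu_class)"
    unfolding PP_T_top_def using quotient_map_psu_class_pair quotient_map_quot_topology by (rule quotient_map_compose)
  moreover have "torus_orbit \<circ> map_prod psu_class psu_class = (\<lambda>(a, b). orbit_of a b)"
    by (auto simp: orbit_of_def)
  ultimately show ?thesis by simp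
qed

lemma orbit_of_eq:
  assumes "a \<in> carrier SU2" "b \<in> carrier SU2"
  shows "orbit_of a b = (\<lambda>t. (psu_class (qmult t a), psu_class (qmult t b))) ` torus"
  using assms by (auto simp: orbit_of_def torus_orbit_def psu_class_mult torus_SU2 image_iff intro!: bexI)

lemma torus_qmult: "s \<in> torus \<Longrightarrow> t \<in> torus \<Longrightarrow> qmult s t \<in> torus"
  by (auto simp: torus_def qmult_def cis_mult)

lemma torus_inverse:
  assumes "t \<in> torus" obtains s where "s \<in> torus" "\<And>x. qmult s (qmult t x) = x" "\<And>x. qmult t (qmult s x) = x"
proof -
  obtain \<tau> where t: "t = (cis \<tau>, 0)" using assms by (auto simp: torus_def)
  have "qmult (cis (- \<tau>), 0) (qmult t x) = x" "qmult t (qmult (cis (- \<tau>), 0) x) = x" for x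
    by (cases x; simp add: t qmult_def mult.assoc[symmetric] cis_mult)+
  moreover have "(cis (- \<tau>), 0) \<in> torus" by (auto simp: torus_def)
  ultimately show ?thesis using that by blast
qed

lemma orbit_of_torus:
  assumes "a \<in> carrier SU2" "b \<in> carrier SU2" "t \<in> torus"
  shows "orbit_of (qmult t a) (qmult t b) = orbit_of a b"
proof -
  have c: "qmult t a \<in> carrier SU2" "qmult t b \<in> carrier SU2" using assms torus_SU2 qmult_SU2 by auto
  obtain t' where t': "t' \<in> torus" "\<And>x. qmult t' (qmult t x) = x" using torus_inverse[OF assms(3)] by metis
  show ?thesis unfolding orbit_of_eq[OF assms(1,2)] orbit_of_eq[OF c]
  proof (intro equalityI image_subsetI)
    fix s assume s: "s \<in> torus"
    show "(psu_class (qmult s (qmult t a)), psu_class (qmult s (qmult t b)))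
        \<in> (\<lambda>t. (psu_class (qmult t a), psu_class (qmult t b))) ` torus"
      using s assms(3) by (intro image_eqI[of _ _ "qmult s t"]) (auto simp: qmult_assoc torus_qmult)
    show "(psu_class (qmult s a), psu_class (qmult s b))
        \<in> (\<lambda>s. (psu_class (qmult s (qmult t a)), psu_class (qmult s (qmult t b)))) ` torus"
      using s t' by (intro image_eqI[of _ _ "qmult s t'"]) (auto simp: qmult_assoc torus_qmult)
  qed
qed

lemma orbit_of_eqE:
  assumes "a \<in> carrier SU2" "b \<in> carrier SU2" "a' \<in> carrier SU2" "b' \<in> carrier SU2" "orbit_of a b = orbit_of a' b'"
  obtains t where "t \<in> torus" "psu_class a' = psu_class (qmult t a)" "psu_class b' = psu_class (qmult t b)"
proof -
  have "(1, 0) \<in> torus" unfolding torus_def by (rule CollectI, rule exI[of _ 0]) simp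
  moreover have "qmult (1, 0) x = x" for x by (cases x) (simp add: qmult_def)
  ultimately have "(psu_class a', psu_class b') \<in> orbit_of a' b'"
    unfolding orbit_of_eq[OF assms(3,4)] by (intro image_eqI[of _ _ "(1, 0)"]) simp_all
  then show ?thesis using that unfolding assms(5)[symmetric] orbit_of_eq[OF assms(1,2)] by auto
qed

lemma continuous_on_quad_trace: "continuous_on S quad_trace"
proof -
  have "continuous_on S (\<lambda>m. comm_trace (fst m, fst (snd m)))"
    by (intro continuous_on_compose2[OF continuous_on_comm_trace[of UNIV]] continuous_intros) auto
  then show ?thesis by (simp add: quad_trace_def case_prod_beta)
qed

section \<open>Parametrizing U \<inter> V\<close>

abbreviation UV :: "quad set set" where "UV \<equiv> U_set \<inter> V_set"

text \<open>The part of M over U \<inter> V, described by a strict inequality for a continuous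
  function and so visibly open in M.\<close>

definition M_open :: "quad set" where
  "M_open = {m \<in> M_space. \<bar>quad_trace m\<bar> < 1}"

lemma abs_cos_less_1: "\<theta> \<in> {0<..<pi} \<Longrightarrow> \<bar>cos \<theta>\<bar> < 1"
proof -
  assume "\<theta> \<in> {0<..<pi}"
  then have "sin \<theta> > 0" by (intro sin_gt_zero) auto
  then have "(cos \<theta>)\<^sup>2 < 1" by (simp add: cos_squared_eq)
  then show ?thesis by (simp add: abs_square_less_1)
qed

lemma M_open_angle:
  assumes "m \<in> M_open" obtains \<theta> where "\<theta> \<in> {0<..<pi}" "quad_trace m = cos \<theta>"
proof
  have t: "\<bar>quad_trace m\<bar> < 1" using assms by (simp add: M_open_def)
  then show "quad_trace m = cos (arccos (quad_trace m))" by (simp add: abs_less_iff)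
  show "arccos (quad_trace m) \<in> {0<..<pi}" using t arccos_lt_bounded[of "quad_trace m"] by (auto simp: abs_less_iff)
qed

lemma M_open_eq: "{m \<in> M_space. q_proj m \<in> UV} = M_open"
proof (intro equalityI subsetI)
  fix m assume "m \<in> {m \<in> M_space. q_proj m \<in> UV}"
  then have m: "m \<in> M_space" "q_proj m \<in> UV" by auto
  obtain \<theta> a b where ab: "\<theta> \<in> {0<..<pi}" "a \<in> carrier SU2" "b \<in> carrier SU2" "q_proj m = q_proj (pair_point \<theta> a b)"
    using UV_pair_point[OF m(2)] .
  obtain g where "g \<in> carrier SU2" "m = quad_conj g (pair_point \<theta> a b)"
    using q_proj_eqE[OF m(1), of "pair_point \<theta> a b"] ab by metis
  then have "quad_trace m = cos \<theta>"
    using ab quad_trace_quad_conj pair_point_M quad_trace_pair_point by simp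
  then show "m \<in> M_open" using m abs_cos_less_1[OF ab(1)] by (simp add: M_open_def)
next
  fix m assume m: "m \<in> M_open"
  then have M: "m \<in> M_space" by (simp add: M_open_def)
  obtain \<theta> where \<theta>: "\<theta> \<in> {0<..<pi}" "quad_trace m = cos \<theta>" using M_open_angle[OF m] .
  obtain g a b where "g \<in> carrier SU2" "a \<in> carrier SU2" "b \<in> carrier SU2" "m = quad_conj g (pair_point \<theta> a b)"
    using quad_trace_pair_point_exists[OF M \<theta>(2,1)] .
  then show "m \<in> {m \<in> M_space. q_proj m \<in> UV}"
    using M \<theta>(1) pair_point_in_A_at(2) by (simp add: q_proj_quad_conj pair_point_M)
qed

lemma quotient_map_q_proj: "quotient_map (top_of_set M_space) A_top q_proj"
  unfolding A_top_def by (rule quotient_map_quot_topology)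

lemma UV_subset: "UV \<subseteq> topspace A_top"
proof
  fix c assume "c \<in> UV"
  then obtain \<theta> a b where "\<theta> \<in> {0<..<pi}" "a \<in> carrier SU2" "b \<in> carrier SU2" "c = q_proj (pair_point \<theta> a b)"
    by (rule UV_pair_point)
  then have "c \<in> q_proj ` M_space" using pair_point_M by blast
  moreover have "q_proj ` M_space = topspace A_top" using quotient_map_q_proj by (simp add: quotient_map_def)
  ultimately show "c \<in> topspace A_top" by simp
qed

lemma quotient_map_M_open:
  "quotient_map (top_of_set M_open) (subtopology A_top UV) q_proj"
  "open_map (top_of_set M_open) (subtopology A_top UV) q_proj"
proof -
  have e: "M_open = M_space \<inter> {m. \<bar>quad_trace m\<bar> < 1}" by (auto simp: M_open_def)
  have "open {m. \<bar>quad_trace m\<bar> < 1}"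
    by (intro open_Collect_less continuous_intros continuous_on_quad_trace)
  then have "openin (top_of_set M_space) M_open" unfolding e by (rule openin_open_Int)
  moreover have "openin (top_of_set M_space) {m \<in> topspace (top_of_set M_space). q_proj m \<in> UV} = openin A_top UV"
    using quotient_map_q_proj UV_subset unfolding quotient_map_def by blast
  ultimately have "openin A_top UV" unfolding topspace_euclidean_subtopology M_open_eq by blast
  moreover have "M_open \<subseteq> M_space" by (auto simp: M_open_def)
  then have "subtopology (top_of_set M_space) M_open = top_of_set M_open"
    by (simp add: subtopology_subtopology inf.absorb2)
  ultimately show q: "quotient_map (top_of_set M_open) (subtopology A_top UV) q_proj"
    using quotient_map_restriction[OF quotient_map_q_proj, of UV M_open] M_open_eq by simp
  show "open_map (top_of_set M_open) (subtopology A_top UV) q_proj"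
  proof (rule open_map_quotient_by_maps[OF q, where H = "quad_conj ` carrier SU2"])
    fix h assume "h \<in> quad_conj ` carrier SU2"
    then obtain g where g: "g \<in> carrier SU2" "h = quad_conj g" by auto
    have "quad_conj g = (\<lambda>(x, y, x', y'). (qmult (qmult g x) (cnj (fst g), - snd g), qmult (qmult g y) (cnj (fst g), - snd g),
        qmult (qmult g x') (cnj (fst g), - snd g), qmult (qmult g y') (cnj (fst g), - snd g)))"
      using g(1) by (simp add: quad_conj_def conj_by_eq)
    then have "continuous_on M_open h" unfolding g(2) case_prod_beta
      by (simp only:) (intro continuous_on_qmult continuous_intros)
    moreover have "h \<in> M_open \<rightarrow> M_open"
      using g by (auto simp: M_open_def quad_conj_M quad_trace_quad_conj)
    ultimately show "continuous_map (top_of_set M_open) (top_of_set M_open) h"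
      by (simp add: continuous_map_in_subtopology)
    show "q_proj (h x) = q_proj x" if "x \<in> topspace (top_of_set M_open)" for x
      using that g by (simp add: M_open_def q_proj_quad_conj)
  next
    fix x y assume "x \<in> topspace (top_of_set M_open)" "y \<in> topspace (top_of_set M_open)" "q_proj x = q_proj y"
    then show "\<exists>h\<in>quad_conj ` carrier SU2. h x = y"
      using q_proj_eqE[of y x] by (auto simp: M_open_def)
  qed
qed

lemma continuous_on_pair_point:
  "continuous_on ({0<..<pi} \<times> carrier SU2 \<times> carrier SU2) (\<lambda>(\<theta>, a, b). pair_point \<theta> a b)"
proof -
  let ?S = "{0<..<pi} \<times> carrier SU2 \<times> carrier SU2"
  have "continuous_on ?S (\<lambda>z. (\<lambda>(\<theta>, x). Phi_inv_rep \<theta> x) (fst z, snd (snd z)))"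
    "continuous_on ?S (\<lambda>z. (\<lambda>(\<theta>, x). Phi_inv_rep \<theta> x) (pi - fst z, fst (snd z)))"
    by (intro continuous_on_compose2[OF continuous_on_Phi_inv_rep] continuous_intros; auto)+
  then show ?thesis unfolding pair_point_def quad_of_def case_prod_beta by (intro continuous_intros) auto
qed

text \<open>The parameter g is there to reach every point of M, not just the normalized
  representatives. The map onto [0, 1] times that part of M is handled by compact pieces, and the
  projection to classes by openness, which allows the factor [0, 1].\<close>

lemma quotient_map_UV:
  "quotient_map (top_of_set ({0..1::real} \<times> {0<..<pi} \<times> carrier SU2 \<times> carrier SU2 \<times> carrier SU2))
     (prod_topology (top_of_set {0..1::real}) (subtopology A_top UV))
     (\<lambda>(t, \<theta>, a, b, g). (t, q_proj (pair_point \<theta> a b)))"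
proof -
  let ?S = "carrier SU2"
  let ?D = "{0..1::real} \<times> {0<..<pi} \<times> ?S \<times> ?S \<times> ?S"
  let ?f = "\<lambda>(t, \<theta>, a, b, g). (t::real, quad_conj g (pair_point \<theta> a b))"
  have "quotient_map (top_of_set ?D) (top_of_set ({0..1} \<times> M_open)) ?f"
  proof (rule quotient_map_compact_cover)
    let ?c = "\<lambda>g x. qmult (qmult g x) (cnj (fst g), - snd g)"
    let ?f' = "\<lambda>(t, \<theta>, a, b, g). (t::real, case pair_point \<theta> a b of (x, y, x', y') \<Rightarrow> (?c g x, ?c g y, ?c g x', ?c g y'))"
    have "continuous_on ?D (\<lambda>z. (\<lambda>(\<theta>, a, b). pair_point \<theta> a b) (fst (snd z), fst (snd (snd z)), fst (snd (snd (snd z)))))"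
      by (intro continuous_on_compose2[OF continuous_on_pair_point] continuous_intros) auto
    then have "continuous_on ?D (\<lambda>z. pair_point (fst (snd z)) (fst (snd (snd z))) (fst (snd (snd (snd z)))))" by simp
    then have "continuous_on ?D ?f'" unfolding case_prod_beta by (intro continuous_on_qmult continuous_intros)
    then show "continuous_on ?D ?f" by (rule continuous_on_eq) (auto simp: quad_conj_def conj_by_eq)
    have M: "?f z \<in> {0..1} \<times> M_open" if z: "z \<in> ?D" for z
    proof -
      obtain t \<theta> a b g where "z = (t, \<theta>, a, b, g)" by (metis prod_cases5)
      then show ?thesis using z abs_cos_less_1[of \<theta>]
        by (simp add: M_open_def quad_conj_M pair_point_M quad_trace_quad_conj quad_trace_pair_point)
    qed
    have onto: "y \<in> ?f ` ({0..1} \<times> {\<theta>} \<times> ?S \<times> ?S \<times> ?S)"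
      if y: "y \<in> {0..1::real} \<times> M_open" and \<theta>: "\<theta> \<in> {0<..<pi}" "quad_trace (snd y) = cos \<theta>" for y \<theta>
    proof -
      have "snd y \<in> M_space" using y by (auto simp: M_open_def mem_Times_iff)
      then obtain g a b where "g \<in> ?S" "a \<in> ?S" "b \<in> ?S" "snd y = quad_conj g (pair_point \<theta> a b)"
        by (rule quad_trace_pair_point_exists[OF _ \<theta>(2,1)])
      then show ?thesis using y \<theta>
        by (intro image_eqI[of _ _ "(fst y, \<theta>, a, b, g)"]) (auto simp: mem_Times_iff prod_eq_iff)
    qed
    show "?f ` ?D = {0..1} \<times> M_open"
    proof (intro equalityI subsetI)
      fix y assume y: "y \<in> {0..1::real} \<times> M_open"
      then obtain \<theta> where \<theta>: "\<theta> \<in> {0<..<pi}" "quad_trace (snd y) = cos \<theta>" 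
        using M_open_angle[of "snd y"] by (auto simp: mem_Times_iff)
      then have "{0..1::real} \<times> {\<theta>} \<times> ?S \<times> ?S \<times> ?S \<subseteq> ?D" by auto
      then show "y \<in> ?f ` ?D" using onto[OF y \<theta>] by blast
    qed (use M in blast)
    fix y assume y: "y \<in> {0..1::real} \<times> M_open"
    then obtain \<theta> where \<theta>: "\<theta> \<in> {0<..<pi}" "quad_trace (snd y) = cos \<theta>"
      using M_open_angle[of "snd y"] by (auto simp: mem_Times_iff)
    \<comment> \<open>The angle is enclosed in a compact subinterval on both sides, and the trace
      inequalities in \<open>?N\<close> confine nearby points to it.\<close>
    define l where "l = \<theta>/2"
    define u where "u = (\<theta> + pi)/2"
    have lu: "0 < l" "l < \<theta>" "\<theta> < u" "u < pi" using \<theta> by (auto simp: l_def u_def)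
    let ?K = "{0..1::real} \<times> {l..u} \<times> ?S \<times> ?S \<times> ?S"
    let ?N = "(UNIV :: real set) \<times> {m. cos u < quad_trace m} \<inter> UNIV \<times> {m. quad_trace m < cos l}"
    have "compact ?K" by (intro compact_Times compact_Icc compact_SU2)
    moreover have "?K \<subseteq> ?D" using lu by auto
    moreover have "open ?N"
      by (intro open_Int open_Times open_UNIV open_Collect_less continuous_on_const continuous_on_quad_trace)
    moreover have "cos u < cos \<theta>" "cos \<theta> < cos l" using lu by (auto intro: cos_monotone_0_pi)
    then have "y \<in> ?N" using \<theta> by (auto simp: mem_Times_iff)
    moreover have "({0..1} \<times> M_open) \<inter> ?N \<subseteq> ?f ` ?K"
    proof
      fix v assume v: "v \<in> ({0..1} \<times> M_open) \<inter> ?N"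
      then obtain \<theta>' where \<theta>': "\<theta>' \<in> {0<..<pi}" "quad_trace (snd v) = cos \<theta>'"
        using M_open_angle[of "snd v"] by (auto simp: mem_Times_iff)
      then have "cos u < cos \<theta>'" "cos \<theta>' < cos l" using v by (auto simp: mem_Times_iff)
      then have "\<theta>' < u" "l < \<theta>'"
        using \<theta>'(1) lu cos_mono_less_eq[of u \<theta>'] cos_mono_less_eq[of \<theta>' l] by auto
      then have "{0..1::real} \<times> {\<theta>'} \<times> ?S \<times> ?S \<times> ?S \<subseteq> ?K" by auto
      moreover have "v \<in> {0..1} \<times> M_open" using v by blast
      ultimately show "v \<in> ?f ` ?K" using onto[OF _ \<theta>'] by blast
    qed
    ultimately show "\<exists>K N. compact K \<and> K \<subseteq> ?D \<and> open N \<and> y \<in> N \<and> ({0..1} \<times> M_open) \<inter> N \<subseteq> ?f ` K"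
      by blast
  qed
  moreover have "quotient_map (top_of_set ({0..1::real} \<times> M_open)) (prod_topology (top_of_set {0..1}) (subtopology A_top UV))
      (map_prod id q_proj)"
  proof -
    have o: "open_map (top_of_set {0..1::real}) (top_of_set {0..1}) id" by (simp add: open_map_def)
    then have "quotient_map (top_of_set {0..1::real}) (top_of_set {0..1}) id"
      by (intro continuous_open_imp_quotient_map) auto
    from quotient_map_map_prod_open[OF this o quotient_map_M_open] show ?thesis by simp
  qed
  ultimately have "quotient_map (top_of_set ?D) (prod_topology (top_of_set {0..1}) (subtopology A_top UV))
      (map_prod id q_proj \<circ> ?f)" by (rule quotient_map_compose)
  then show ?thesis
    by (rule quotient_map_eq) (auto simp: q_proj_quad_conj pair_point_M)
qed

lemma continuous_map_from_UV_homotopy: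
  assumes "continuous_map (top_of_set ({0..1::real} \<times> {0<..<pi} \<times> carrier SU2 \<times> carrier SU2)) Y
    (\<lambda>(t, \<theta>, a, b). F (t, q_proj (pair_point \<theta> a b)))"
  shows "continuous_map (prod_topology (top_of_set {0..1}) (subtopology A_top UV)) Y F"
proof (rule continuous_compose_quotient_map[OF quotient_map_UV])
  let ?S = "carrier SU2"
  let ?D = "{0..1::real} \<times> {0<..<pi} \<times> ?S \<times> ?S \<times> ?S" and ?E = "{0..1::real} \<times> {0<..<pi} \<times> ?S \<times> ?S"
  let ?p = "\<lambda>z. (fst z, fst (snd z), fst (snd (snd z)), fst (snd (snd (snd z))))"
  have "continuous_on ?D ?p" by (intro continuous_intros)
  then have "continuous_map (top_of_set ?D) (top_of_set ?E) ?p"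
    by (auto simp: continuous_map_in_subtopology)
  from continuous_map_compose[OF this assms]
  show "continuous_map (top_of_set ?D) Y (F \<circ> (\<lambda>(t, \<theta>, a, b, g). (t, q_proj (pair_point \<theta> a b))))"
    by (simp add: comp_def case_prod_unfold)
qed

text \<open>A map is read as a homotopy that is constant in t and then restricted to t = 0.\<close>

lemma continuous_map_from_UV:
  assumes "continuous_map (top_of_set ({0<..<pi} \<times> carrier SU2 \<times> carrier SU2)) Y
    (\<lambda>(\<theta>, a, b). f (q_proj (pair_point \<theta> a b)))"
  shows "continuous_map (subtopology A_top UV) Y f"
proof -
  let ?E = "{0..1::real} \<times> {0<..<pi} \<times> carrier SU2 \<times> carrier SU2" and ?E' = "{0<..<pi} \<times> carrier SU2 \<times> carrier SU2"
  have "continuous_map (top_of_set ?E) (top_of_set ?E') snd"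
    by (auto simp: continuous_map_in_subtopology intro!: continuous_intros)
  from continuous_map_compose[OF this assms]
  have 1: "continuous_map (prod_topology (top_of_set {0..1::real}) (subtopology A_top UV)) Y (f \<circ> snd)"
    by (intro continuous_map_from_UV_homotopy) (simp add: comp_def case_prod_unfold)
  have "continuous_map (subtopology A_top UV) (prod_topology (top_of_set {0..1::real}) (subtopology A_top UV)) (\<lambda>c. (0, c))"
    by (intro continuous_map_pairedI) auto
  from continuous_map_compose[OF this 1] show ?thesis by (simp add: comp_def)
qed

section \<open>Deformed classes and their quotients\<close>

lemma Phi_PSU2:
  assumes "\<theta> \<in> {0<..pi}" "p \<in> X_space \<theta>" shows "Phi \<theta> p \<in> carrier PSU2"
  using X_space_Phi_inv_rep[OF assms] Phi_Phi_inv_rep[OF assms(1)] by (metis psu_class_PSU2)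

lemma Phi_torus:
  assumes "\<theta> \<in> {0<..pi}" "p \<in> X_space \<theta>" "s \<in> torus"
  shows "Phi \<theta> (pair_conj s p) = psu_class s \<otimes>\<^bsub>PSU2\<^esub> Phi \<theta> p"
proof -
  obtain x where x: "x \<in> carrier SU2" "p = Phi_inv_rep \<theta> x" using X_space_Phi_inv_rep[OF assms(1,2)] .
  have "pair_conj s p = Phi_inv_rep \<theta> (qmult s x)"
    using Phi_inv_rep_torus[OF assms(1) x(1) assms(3)] by (simp add: pair_conj_def x)
  then show ?thesis using x assms torus_SU2 by (simp add: Phi_Phi_inv_rep qmult_SU2 psu_class_mult)
qed

lemma Phi_pi_equivariant:
  assumes "p \<in> X_space pi" "g \<in> carrier SU2"
  shows "Phi pi (pair_conj g p) = psu_class g \<otimes>\<^bsub>PSU2\<^esub> Phi pi p"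
proof -
  have pi: "pi \<in> {0<..pi}" by simp
  obtain x where x: "x \<in> carrier SU2" "p = Phi_inv_rep pi x" using X_space_Phi_inv_rep[OF pi assms(1)] .
  have "pair_conj g p = Phi_inv_rep pi (qmult g x)"
    using Phi_inv_rep_pi_equivariant[OF assms(2) x(1)] by (simp add: pair_conj_def x)
  then show ?thesis using x assms pi by (simp add: Phi_Phi_inv_rep qmult_SU2 psu_class_mult)
qed

lemma PSU2_division_cancel:
  assumes "s \<in> carrier PSU2" "g \<in> carrier PSU2" "h \<in> carrier PSU2"
  shows "inv\<^bsub>PSU2\<^esub> (s \<otimes>\<^bsub>PSU2\<^esub> g) \<otimes>\<^bsub>PSU2\<^esub> (s \<otimes>\<^bsub>PSU2\<^esub> h) = inv\<^bsub>PSU2\<^esub> g \<otimes>\<^bsub>PSU2\<^esub> h"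
proof -
  have "inv\<^bsub>PSU2\<^esub> s \<otimes>\<^bsub>PSU2\<^esub> (s \<otimes>\<^bsub>PSU2\<^esub> h) = h"
    using assms by (simp add: PSU2.m_assoc[symmetric])
  then show ?thesis using assms by (simp add: PSU2.inv_mult_group PSU2.m_assoc)
qed

text \<open>Two descriptions of the same pair differ by an element k that preserves the space at
  \<theta>. For \<theta> < \<pi> it lies in T, and r' commutes with T, so both describe the same
  deformed pair.\<close>

lemma r_W_conj:
  assumes \<theta>: "\<theta> \<in> {0<..<pi}" and p: "p \<in> X_space \<theta>" and g: "g \<in> carrier SU2" and t: "t \<in> {0..1}"
  shows "r_W (pair_conj g p) t = pair_conj g (r_deform p t)"
  unfolding r_W_def pair_conj_def[symmetric]
proof (rule the_equality)
  have r: "\<theta> \<in> {0<..pi}" using \<theta> by auto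
  then have "p \<in> X_union {0<..pi}" using p by (auto simp: X_union_def)
  then show "\<exists>ga\<in>carrier SU2. \<exists>p0\<in>X_union {0<..pi}. pair_conj g p = pair_conj ga p0 \<and>
      pair_conj g (r_deform p t) = pair_conj ga (r_deform p0 t)" using g by blast
  fix p' assume "\<exists>ga\<in>carrier SU2. \<exists>p0\<in>X_union {0<..pi}. pair_conj g p = pair_conj ga p0 \<and> p' = pair_conj ga (r_deform p0 t)"
  then obtain h p0 where h: "h \<in> carrier SU2" "p0 \<in> X_union {0<..pi}" "pair_conj g p = pair_conj h p0"
    "p' = pair_conj h (r_deform p0 t)" by blast
  obtain \<theta>0 where \<theta>0: "\<theta>0 \<in> {0<..pi}" "p0 \<in> X_space \<theta>0" using h(2) by (auto simp: X_union_def)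
  have pS: "p \<in> carrier SU2 \<times> carrier SU2" "p0 \<in> carrier SU2 \<times> carrier SU2" using p \<theta>0 X_space_subset by blast+
  have "cos \<theta>0 = cos \<theta>"
    using comm_trace_pair_conj[OF g pS(1)] comm_trace_pair_conj[OF h(1) pS(2)] h(3)
      comm_trace_X_space[OF p] comm_trace_X_space[OF \<theta>0(2)] by simp
  then have e: "\<theta>0 = \<theta>" using \<theta> \<theta>0 cos_inj_pi[of \<theta>0 \<theta>] by auto
  define k where "k = qmult (inv\<^bsub>SU2\<^esub> h) g"
  have k: "k \<in> carrier SU2" using g h by (simp add: k_def qmult_SU2)
  have "pair_conj k p = pair_conj (inv\<^bsub>SU2\<^esub> h) (pair_conj h p0)"
    unfolding h(3)[symmetric] k_def using g h(1) pS by (simp add: pair_conj_pair_conj)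
  then have p0: "p0 = pair_conj k p" using pair_conj_inv(1)[OF h(1) pS(2)] by simp
  have "k \<in> torus" using torus_centralizer[OF k \<theta> p] \<theta>0(2) p0 e by simp
  then have "r_deform p0 t = pair_conj k (r_deform p t)"
    using r_deform_torus[OF r p t] by (simp add: p0 pair_conj_def)
  moreover have R: "r_deform p t \<in> carrier SU2 \<times> carrier SU2"
    using r_deform_in_X_space[OF r p t] X_space_subset by blast
  moreover have "qmult h k = g"
  proof -
    have e: "qmult h (inv\<^bsub>SU2\<^esub> h) = (1, 0)" using SU2.r_inv[OF h(1)] by simp
    have "qmult h k = qmult (qmult h (inv\<^bsub>SU2\<^esub> h)) g" by (simp only: k_def qmult_assoc)
    then show ?thesis unfolding e by (cases g) (simp add: qmult_def)
  qed
  ultimately show "p' = pair_conj g (r_deform p t)" using h(1,4) k by (simp add: pair_conj_pair_conj)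
qed

text \<open>The deformation read in PSU(2): at t = 1 it is the class of x, and at t = 0 it is the
  value used by the trivializations.\<close>

definition deformed_class :: "real \<Rightarrow> real \<Rightarrow> quat \<Rightarrow> quat set" where
  "deformed_class t \<theta> x = Phi (theta_at \<theta> t) (r_deform (Phi_inv_rep \<theta> x) t)"

definition deformed_ratio :: "real \<Rightarrow> real \<Rightarrow> quat \<Rightarrow> quat \<Rightarrow> quat set" where
  "deformed_ratio t \<theta> a b = inv\<^bsub>PSU2\<^esub> (deformed_class t (pi - \<theta>) a) \<otimes>\<^bsub>PSU2\<^esub> deformed_class t \<theta> b"

lemma deformed_class_PSU2:
  assumes "\<theta> \<in> {0<..pi}" "x \<in> carrier SU2" "t \<in> {0..1}" shows "deformed_class t \<theta> x \<in> carrier PSU2"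
  unfolding deformed_class_def
  using assms by (intro Phi_PSU2 theta_at_range r_deform_in_X_space Phi_inv_rep_in_X_space)

lemma deformed_class_1: "\<theta> \<in> {0<..pi} \<Longrightarrow> x \<in> carrier SU2 \<Longrightarrow> deformed_class 1 \<theta> x = psu_class x"
  using r_deform_1[OF _ Phi_inv_rep_in_X_space] by (simp add: deformed_class_def theta_at_1 Phi_Phi_inv_rep)

lemma deformed_class_torus:
  assumes "\<theta> \<in> {0<..pi}" "x \<in> carrier SU2" "t \<in> {0..1}" "s \<in> torus"
  shows "deformed_class t \<theta> (qmult s x) = psu_class s \<otimes>\<^bsub>PSU2\<^esub> deformed_class t \<theta> x"
proof -
  note X = Phi_inv_rep_in_X_space[OF assms(1,2)]
  have "r_deform (Phi_inv_rep \<theta> (qmult s x)) t = pair_conj s (r_deform (Phi_inv_rep \<theta> x) t)"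
    using Phi_inv_rep_torus[OF assms(1,2,4)] r_deform_torus[OF assms(1) X assms(3,4)] by (simp add: pair_conj_def)
  then show ?thesis unfolding deformed_class_def
    using Phi_torus theta_at_range r_deform_in_X_space X assms by simp
qed

lemma deformed_class_cong:
  assumes "\<theta> \<in> {0<..pi}" "x \<in> carrier SU2" "psu_class y = psu_class x"
  shows "deformed_class t \<theta> y = deformed_class t \<theta> x"
proof -
  have "y = x \<or> y = - x" using assms(3) by (simp add: psu_class_eq_iff)
  then have "Phi_inv_rep \<theta> y = Phi_inv_rep \<theta> x" using Phi_inv_rep_eq_iff[OF assms(1), of y x] assms(2) by auto
  then show ?thesis by (simp add: deformed_class_def)
qed

text \<open>Both classes acquire the same left factor, which cancels in the quotient; this lets the
  homotopy descend to classes of quadruples.\<close>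

lemma deformed_ratio_torus:
  assumes "\<theta> \<in> {0<..<pi}" "t \<in> {0..1}" "a \<in> carrier SU2" "b \<in> carrier SU2" "s \<in> torus"
    "psu_class a' = psu_class (qmult s a)" "psu_class b' = psu_class (qmult s b)"
  shows "deformed_ratio t \<theta> a' b' = deformed_ratio t \<theta> a b"
proof -
  have r: "\<theta> \<in> {0<..pi}" "pi - \<theta> \<in> {0<..pi}" using assms by auto
  have s: "s \<in> carrier SU2" using assms torus_SU2 by blast
  have "deformed_class t (pi - \<theta>) a' = psu_class s \<otimes>\<^bsub>PSU2\<^esub> deformed_class t (pi - \<theta>) a"
    "deformed_class t \<theta> b' = psu_class s \<otimes>\<^bsub>PSU2\<^esub> deformed_class t \<theta> b"
    using assms r s deformed_class_cong qmult_SU2 deformed_class_torus by metis+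
  then show ?thesis unfolding deformed_ratio_def
    using assms r s by (simp add: PSU2_division_cancel deformed_class_PSU2)
qed

lemma Phi_inv_rep_in_X_union:
  "\<theta> \<in> {0<..pi} \<Longrightarrow> x \<in> carrier SU2 \<Longrightarrow> Phi_inv_rep \<theta> x \<in> X_union {0<..pi}"
  using Phi_inv_rep_in_X_space unfolding X_union_def by blast

text \<open>All angles are treated at once by reading \<theta> off the point, as arccos of the
  trace. On parameters (\<theta>, x) the composite is just the class of x, and the parametrization
  is a quotient map.\<close>

lemma continuous_map_Phi:
  "continuous_map (top_of_set (X_union {0<..pi})) PSU2_top (\<lambda>p. Phi (arccos (comm_trace p)) p)"
proof -
  let ?D = "{0<..pi} \<times> carrier SU2" and ?S = "X_union {0<..pi}"
  let ?f = "\<lambda>(\<theta>, x). Phi_inv_rep \<theta> x"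
  have "quotient_map (top_of_set ?D) (top_of_set ?S) ?f"
  proof (rule quotient_map_compact_cover)
    show "continuous_on ?D ?f" by (rule continuous_on_Phi_inv_rep)
    have onto: "p \<in> ?f ` ({\<theta>} \<times> carrier SU2)" if "\<theta> \<in> {0<..pi}" "p \<in> X_space \<theta>" for p \<theta>
      using X_space_Phi_inv_rep[OF that] by auto
    show "?f ` ?D = ?S"
    proof (intro equalityI subsetI)
      fix p assume "p \<in> ?S"
      then obtain \<theta> where \<theta>: "\<theta> \<in> {0<..pi}" "p \<in> X_space \<theta>" by (auto simp: X_union_def)
      then have "{\<theta>} \<times> carrier SU2 \<subseteq> ?D" by auto
      then show "p \<in> ?f ` ?D" using onto[OF \<theta>] by blast
    qed (auto intro!: Phi_inv_rep_in_X_union)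
    fix p assume "p \<in> ?S"
    then obtain \<theta> where \<theta>: "\<theta> \<in> {0<..pi}" "p \<in> X_space \<theta>" by (auto simp: X_union_def)
    let ?K = "{\<theta>/2..pi} \<times> carrier SU2" and ?N = "{p. comm_trace p < cos (\<theta>/2)}"
    have "compact ?K" by (intro compact_Times compact_Icc compact_SU2)
    moreover have "?K \<subseteq> ?D" using \<theta> by auto
    moreover have "open ?N" by (intro open_Collect_less continuous_on_const continuous_on_comm_trace)
    moreover have "cos \<theta> < cos (\<theta>/2)" using \<theta>(1) by (intro cos_monotone_0_pi) auto
    then have "p \<in> ?N" using comm_trace_X_space[OF \<theta>(2)] by simp
    moreover have "?S \<inter> ?N \<subseteq> ?f ` ?K"
    proof
      fix v assume v: "v \<in> ?S \<inter> ?N"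
      then obtain \<theta>' where v': "v \<in> X_space \<theta>'" "\<theta>' \<in> {0<..pi}" by (auto simp: X_union_def)
      then have "cos \<theta>' < cos (\<theta>/2)" using v comm_trace_X_space[OF v'(1)] by simp
      then have "\<theta>/2 < \<theta>'" using v'(2) \<theta>(1) cos_mono_less_eq[of \<theta>' "\<theta>/2"] by auto
      then have "{\<theta>'} \<times> carrier SU2 \<subseteq> ?K" using v' by auto
      then show "v \<in> ?f ` ?K" using onto[OF v'(2,1)] by blast
    qed
    ultimately show "\<exists>K N. compact K \<and> K \<subseteq> ?D \<and> open N \<and> p \<in> N \<and> ?S \<inter> N \<subseteq> ?f ` K" by blast
  qed
  moreover have "continuous_map (top_of_set ?D) PSU2_top ((\<lambda>p. Phi (arccos (comm_trace p)) p) \<circ> ?f)"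
  proof -
    have "continuous_map (top_of_set ?D) (top_of_set (carrier SU2)) snd"
      by (auto simp: continuous_map_in_subtopology intro!: continuous_intros)
    from continuous_map_compose[OF this continuous_map_psu_class]
    show ?thesis
    proof (rule continuous_map_eq)
      fix z assume "z \<in> topspace (top_of_set ?D)"
      then obtain \<theta> x where z: "z = (\<theta>, x)" "\<theta> \<in> {0<..pi}" "x \<in> carrier SU2" by auto
      have "arccos (comm_trace (Phi_inv_rep \<theta> x)) = \<theta>"
        using comm_trace_X_space[OF Phi_inv_rep_in_X_space[OF z(2,3)]] z by (simp add: arccos_cos)
      then show "(psu_class \<circ> snd) z = ((\<lambda>p. Phi (arccos (comm_trace p)) p) \<circ> ?f) z"
        using z by (simp add: Phi_Phi_inv_rep)
    qed
  qed
  ultimately show ?thesis by (rule continuous_compose_quotient_map)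
qed

lemma continuous_map_deformed_class:
  "continuous_map (top_of_set ({0..1} \<times> {0<..pi} \<times> carrier SU2)) PSU2_top (\<lambda>(t, \<theta>, x). deformed_class t \<theta> x)"
proof -
  let ?D = "{0..1::real} \<times> {0<..pi} \<times> carrier SU2"
  let ?r = "\<lambda>z. r_deform (Phi_inv_rep (fst (snd z)) (snd (snd z))) (fst z)"
  have "continuous_on ?D (\<lambda>z. (\<lambda>(\<theta>, x). Phi_inv_rep \<theta> x) (snd z))"
    by (intro continuous_on_compose2[OF continuous_on_Phi_inv_rep] continuous_intros) auto
  then have "continuous_on ?D (\<lambda>z. Phi_inv_rep (fst (snd z)) (snd (snd z)))" by (simp add: case_prod_beta)
  then have "continuous_on ?D (\<lambda>z. (\<lambda>(p, t). r_deform p t) (Phi_inv_rep (fst (snd z)) (snd (snd z)), fst z))"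
    by (intro continuous_on_compose2[OF continuous_on_r_deform] continuous_intros)
      (auto intro!: Phi_inv_rep_in_X_union)
  moreover have X: "?r z \<in> X_space (theta_at (fst (snd z)) (fst z))" "theta_at (fst (snd z)) (fst z) \<in> {0<..pi}"
    if "z \<in> ?D" for z
    using that by (auto intro!: r_deform_in_X_space Phi_inv_rep_in_X_space theta_at_range simp del: greaterThanAtMost_iff)
  then have "?r \<in> ?D \<rightarrow> X_union {0<..pi}" unfolding X_union_def by blast
  ultimately have "continuous_map (top_of_set ?D) (top_of_set (X_union {0<..pi})) ?r"
    by (simp add: continuous_map_in_subtopology)
  from continuous_map_compose[OF this continuous_map_Phi]
  show ?thesis
  proof (rule continuous_map_eq)
    fix z assume "z \<in> topspace (top_of_set ?D)"
    then have z: "z \<in> ?D" by simp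
    have "arccos (comm_trace (?r z)) = theta_at (fst (snd z)) (fst z)"
      using comm_trace_X_space[OF X(1)[OF z]] X(2)[OF z] by (simp add: arccos_cos)
    then show "((\<lambda>p. Phi (arccos (comm_trace p)) p) \<circ> ?r) z = (\<lambda>(t, \<theta>, x). deformed_class t \<theta> x) z"
      by (simp add: case_prod_beta deformed_class_def)
  qed
qed

lemma continuous_map_deformed_ratio:
  "continuous_map (top_of_set ({0..1} \<times> {0<..<pi} \<times> carrier SU2 \<times> carrier SU2)) PSU2_top
     (\<lambda>(t, \<theta>, a, b). deformed_ratio t \<theta> a b)"
proof -
  let ?D = "{0..1::real} \<times> {0<..<pi} \<times> carrier SU2 \<times> carrier SU2" and ?E = "{0..1::real} \<times> {0<..pi} \<times> carrier SU2"
  let ?f = "\<lambda>z. (fst z, pi - fst (snd z), fst (snd (snd z)))" and ?g = "\<lambda>z. (fst z, fst (snd z), snd (snd (snd z)))"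
  have "continuous_map (top_of_set ?D) (top_of_set ?E) ?f" "continuous_map (top_of_set ?D) (top_of_set ?E) ?g"
    by (auto simp: continuous_map_in_subtopology intro!: continuous_intros)
  from this[THEN continuous_map_compose, OF continuous_map_deformed_class]
  have "continuous_map (top_of_set ?D) (prod_topology PSU2_top PSU2_top)
      (\<lambda>z. (((\<lambda>(t, \<theta>, x). deformed_class t \<theta> x) \<circ> ?f) z, ((\<lambda>(t, \<theta>, x). deformed_class t \<theta> x) \<circ> ?g) z))"
    by (intro continuous_map_pairedI)
  from continuous_map_compose[OF this continuous_map_PSU2_division]
  show ?thesis by (simp add: comp_def case_prod_unfold deformed_ratio_def)
qed

section \<open>The transition function\<close>

lemma the_elem_singletonI: "x \<in> A \<Longrightarrow> (\<And>y. y \<in> A \<Longrightarrow> y = x) \<Longrightarrow> the_elem A = x"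
  by (metis is_singletonI' is_singleton_the_elem empty_iff singletonD)

lemma pair_point_Phi:
  assumes \<theta>: "\<theta> \<in> {0<..<pi}" "\<theta>' \<in> {0<..<pi}" and ab: "a \<in> carrier SU2" "b \<in> carrier SU2"
    and p: "quad_of p p' \<in> q_proj (pair_point \<theta> a b)" "p \<in> X_space \<theta>'"
  obtains t where "\<theta>' = \<theta>" "t \<in> torus" "Phi \<theta>' p = psu_class (qmult t b)" "Phi (pi - \<theta>') p' = psu_class (qmult t a)"
proof -
  have r: "\<theta> \<in> {0<..pi}" "pi - \<theta> \<in> {0<..pi}" "\<theta>' \<in> {0..pi}" using \<theta> by auto
  obtain t where t: "\<theta>' = \<theta>" "t \<in> torus" "p = Phi_inv_rep \<theta> (qmult t b)" "p' = Phi_inv_rep (pi - \<theta>) (qmult t a)"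
    by (rule pair_point_representatives[OF \<theta>(1) r(3) ab p])
  then have "qmult t a \<in> carrier SU2" "qmult t b \<in> carrier SU2" using ab torus_SU2 qmult_SU2 by auto
  then show ?thesis using that[OF t(1,2)] t r by (simp add: Phi_Phi_inv_rep)
qed

lemma pair_point_representative:
  assumes "\<theta> \<in> {0<..<pi}" "a \<in> carrier SU2" "b \<in> carrier SU2"
  obtains x y x' y' where "(x, y, x', y') \<in> q_proj (pair_point \<theta> a b)" "(x, y) \<in> X_space \<theta>"
    "(x', y') \<in> X_space (pi - \<theta>)" "Phi \<theta> (x, y) = psu_class b" "Phi (pi - \<theta>) (x', y') = psu_class a"
proof -
  have r: "\<theta> \<in> {0<..pi}" "pi - \<theta> \<in> {0<..pi}" using assms by auto
  obtain x y where p: "Phi_inv_rep \<theta> b = (x, y)" by (cases "Phi_inv_rep \<theta> b")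
  obtain x' y' where p': "Phi_inv_rep (pi - \<theta>) a = (x', y')" by (cases "Phi_inv_rep (pi - \<theta>) a")
  have e: "pair_point \<theta> a b = (x, y, x', y')" by (simp add: pair_point_def quad_of_def p p')
  show ?thesis
    using that[of x y x' y'] q_proj_self[OF pair_point_M[OF assms]] e p p' r assms
      Phi_inv_rep_in_X_space[OF r(1) assms(3)] Phi_inv_rep_in_X_space[OF r(2) assms(2)]
      Phi_Phi_inv_rep[OF r(1) assms(3)] Phi_Phi_inv_rep[OF r(2) assms(2)] by simp
qed

text \<open>Representatives of the required form are unique up to T, so the set in
  \<open>comparison\<close> is the singleton of one orbit.\<close>

lemma comparison_pair_point:
  assumes "\<theta> \<in> {0<..<pi}" "a \<in> carrier SU2" "b \<in> carrier SU2"
  shows "comparison (q_proj (pair_point \<theta> a b)) = orbit_of a b"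
  unfolding comparison_def
proof (rule the_elem_singletonI)
  let ?c = "q_proj (pair_point \<theta> a b)"
  let ?A = "{torus_orbit (Phi (pi - \<theta>) (x', y'), Phi \<theta> (x, y)) |\<theta> x y x' y'.
     \<theta> \<in> {0<..<pi} \<and> (x, y, x', y') \<in> ?c \<and> (x, y) \<in> X_space \<theta> \<and> (x', y') \<in> X_space (pi - \<theta>)}"
  obtain x y x' y' where "(x, y, x', y') \<in> ?c" "(x, y) \<in> X_space \<theta>"
    "(x', y') \<in> X_space (pi - \<theta>)" "Phi \<theta> (x, y) = psu_class b" "Phi (pi - \<theta>) (x', y') = psu_class a"
    using pair_point_representative[OF assms] .
  then show "orbit_of a b \<in> ?A" unfolding orbit_of_def using assms(1) by (intro CollectI) metis
  fix d assume "d \<in> ?A"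
  then obtain \<theta>' x y x' y' where d: "d = torus_orbit (Phi (pi - \<theta>') (x', y'), Phi \<theta>' (x, y))" "\<theta>' \<in> {0<..<pi}"
    "(x, y, x', y') \<in> ?c" "(x, y) \<in> X_space \<theta>'" by blast
  have "quad_of (x, y) (x', y') \<in> ?c" using d(3) by (simp add: quad_of_def)
  then obtain t where "t \<in> torus" "Phi \<theta>' (x, y) = psu_class (qmult t b)" "Phi (pi - \<theta>') (x', y') = psu_class (qmult t a)"
    using pair_point_Phi[OF assms(1) d(2) assms(2,3) _ d(4)] by metis
  then show "d = orbit_of a b" using d(1) orbit_of_torus[OF assms(2,3)] by (simp add: orbit_of_def)
qed

lemma slice_map_pair_point:
  assumes "\<theta> \<in> {0<..<pi}" "a \<in> carrier SU2" "b \<in> carrier SU2"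
  shows "slice_map \<theta> (q_proj (pair_point \<theta> a b)) = inv\<^bsub>PSU2\<^esub> (psu_class a) \<otimes>\<^bsub>PSU2\<^esub> psu_class b"
  unfolding slice_map_def
proof (rule the_elem_singletonI)
  let ?c = "q_proj (pair_point \<theta> a b)"
  let ?A = "{inv\<^bsub>PSU2\<^esub> (Phi (pi - \<theta>) (x', y')) \<otimes>\<^bsub>PSU2\<^esub> Phi \<theta> (x, y) |x y x' y'.
     (x, y, x', y') \<in> ?c \<and> (x, y) \<in> X_space \<theta> \<and> (x', y') \<in> X_space (pi - \<theta>)}"
  obtain x y x' y' where "(x, y, x', y') \<in> ?c" "(x, y) \<in> X_space \<theta>"
    "(x', y') \<in> X_space (pi - \<theta>)" "Phi \<theta> (x, y) = psu_class b" "Phi (pi - \<theta>) (x', y') = psu_class a"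
    using pair_point_representative[OF assms] .
  then show "inv\<^bsub>PSU2\<^esub> (psu_class a) \<otimes>\<^bsub>PSU2\<^esub> psu_class b \<in> ?A" by (intro CollectI) metis
  fix d assume "d \<in> ?A"
  then obtain x y x' y' where d: "d = inv\<^bsub>PSU2\<^esub> (Phi (pi - \<theta>) (x', y')) \<otimes>\<^bsub>PSU2\<^esub> Phi \<theta> (x, y)"
    "(x, y, x', y') \<in> ?c" "(x, y) \<in> X_space \<theta>" by blast
  have "quad_of (x, y) (x', y') \<in> ?c" using d(2) by (simp add: quad_of_def)
  then obtain t where t: "t \<in> torus" "Phi \<theta> (x, y) = psu_class (qmult t b)" "Phi (pi - \<theta>) (x', y') = psu_class (qmult t a)"
    using pair_point_Phi[OF assms(1,1,2,3) _ d(3)] by metis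
  then show "d = inv\<^bsub>PSU2\<^esub> (psu_class a) \<otimes>\<^bsub>PSU2\<^esub> psu_class b"
    using d(1) assms torus_SU2 PSU2_division_cancel[of "psu_class t" "psu_class a" "psu_class b"]
    by (simp add: psu_class_mult)
qed

lemma quotient_division_orbit_of:
  assumes "a \<in> carrier SU2" "b \<in> carrier SU2"
  shows "quotient_division (orbit_of a b) = inv\<^bsub>PSU2\<^esub> (psu_class a) \<otimes>\<^bsub>PSU2\<^esub> psu_class b"
  unfolding quotient_division_def
proof (rule the_elem_singletonI)
  let ?f = "\<lambda>(g, h). inv\<^bsub>PSU2\<^esub> g \<otimes>\<^bsub>PSU2\<^esub> h"
  have *: "?f (psu_class (qmult t a), psu_class (qmult t b)) = inv\<^bsub>PSU2\<^esub> (psu_class a) \<otimes>\<^bsub>PSU2\<^esub> psu_class b"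
    if "t \<in> torus" for t
    using assms torus_SU2[OF that] PSU2_division_cancel[of "psu_class t" "psu_class a" "psu_class b"]
    by (simp add: psu_class_mult)
  have "(1, 0) \<in> torus" unfolding torus_def by (rule CollectI, rule exI[of _ 0]) simp
  then show "inv\<^bsub>PSU2\<^esub> (psu_class a) \<otimes>\<^bsub>PSU2\<^esub> psu_class b \<in> ?f ` orbit_of a b"
    unfolding orbit_of_eq[OF assms] image_image using * by force
  show "y = inv\<^bsub>PSU2\<^esub> (psu_class a) \<otimes>\<^bsub>PSU2\<^esub> psu_class b" if "y \<in> ?f ` orbit_of a b" for y
    using that * unfolding orbit_of_eq[OF assms] by auto
qed

text \<open>By equivariance of \<Phi> at \<pi>, conjugating the quadruple by g multiplies both
  trivializations by g on the left. The factor cancels, so every element of the class gives the same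
  value.\<close>

lemma transition_pair_point:
  assumes "\<theta> \<in> {0<..<pi}" "a \<in> carrier SU2" "b \<in> carrier SU2"
  shows "transition (q_proj (pair_point \<theta> a b)) = deformed_ratio 0 \<theta> a b"
proof -
  let ?c = "q_proj (pair_point \<theta> a b)"
  let ?f = "\<lambda>m. inv\<^bsub>PSU2\<^esub> (triv_U m) \<otimes>\<^bsub>PSU2\<^esub> triv_V m"
  have \<theta>: "\<theta> \<in> {0<..pi}" "pi - \<theta> \<in> {0<..pi}" "pi - \<theta> \<in> {0<..<pi}" using assms by auto
  have W: "Phi pi (r_W (pair_conj g (Phi_inv_rep \<theta> x)) 0) = psu_class g \<otimes>\<^bsub>PSU2\<^esub> deformed_class 0 \<theta> x"
    if "\<theta> \<in> {0<..<pi}" "x \<in> carrier SU2" "g \<in> carrier SU2" for \<theta> x g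
  proof -
    have r: "\<theta> \<in> {0<..pi}" using that by auto
    note X = Phi_inv_rep_in_X_space[OF r that(2)]
    have "r_deform (Phi_inv_rep \<theta> x) 0 \<in> X_space pi" using r_deform_in_X_space[OF r X, of 0] by (simp add: theta_at_0)
    then show ?thesis using r_W_conj[OF that(1) X that(3), of 0] that(3)
      by (simp add: Phi_pi_equivariant deformed_class_def theta_at_0)
  qed
  have f: "?f (quad_conj g (pair_point \<theta> a b)) = deformed_ratio 0 \<theta> a b" if "g \<in> carrier SU2" for g
  proof -
    have "triv_U (quad_of p p') = Phi pi (r_W p' 0)" "triv_V (quad_of p p') = Phi pi (r_W p 0)" for p p'
      by (simp_all add: triv_U_def triv_V_def quad_of_def)
    then show ?thesis using that assms \<theta>
      by (simp add: pair_point_def quad_conj_quad_of W PSU2_division_cancel deformed_class_PSU2 deformed_ratio_def)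
  qed
  show ?thesis unfolding transition_def
  proof (rule the_elem_singletonI)
    have "(1, 0) \<in> carrier SU2" by simp
    then show "deformed_ratio 0 \<theta> a b \<in> ?f ` ?c"
      unfolding q_proj_def image_image using f by (intro image_eqI[of _ _ "(1, 0)"]) simp_all
    show "y = deformed_ratio 0 \<theta> a b" if "y \<in> ?f ` ?c" for y using that f by (auto simp: q_proj_def)
  qed
qed

text \<open>An arbitrary choice, made without any continuity; it is evaluated only through functions
  that do not depend on it.\<close>

definition coords :: "quad set \<Rightarrow> real \<times> quat \<times> quat" where
  "coords c = (SOME (\<theta>, a, b). \<theta> \<in> {0<..<pi} \<and> a \<in> carrier SU2 \<and> b \<in> carrier SU2 \<and> c = q_proj (pair_point \<theta> a b))"

lemma coords_invariant:
  assumes "\<theta> \<in> {0<..<pi}" "a \<in> carrier SU2" "b \<in> carrier SU2"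
    and inv: "\<And>s a' b'. s \<in> torus \<Longrightarrow> psu_class a' = psu_class (qmult s a) \<Longrightarrow> psu_class b' = psu_class (qmult s b)
      \<Longrightarrow> f \<theta> a' b' = f \<theta> a b"
  shows "(case coords (q_proj (pair_point \<theta> a b)) of (\<theta>, a, b) \<Rightarrow> f \<theta> a b) = f \<theta> a b"
proof -
  let ?c = "q_proj (pair_point \<theta> a b)"
  obtain \<theta>' a' b' where co: "coords ?c = (\<theta>', a', b')" by (metis prod_cases3)
  have "case coords ?c of (\<theta>, a, b) \<Rightarrow> \<theta> \<in> {0<..<pi} \<and> a \<in> carrier SU2 \<and> b \<in> carrier SU2 \<and> ?c = q_proj (pair_point \<theta> a b)"
    unfolding coords_def
    by (rule someI[of "\<lambda>(\<theta>, a, b). \<theta> \<in> {0<..<pi} \<and> a \<in> carrier SU2 \<and> b \<in> carrier SU2 \<and> ?c = q_proj (pair_point \<theta> a b)" "(\<theta>, a, b)"])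
      (use assms in simp)
  then have c: "\<theta>' \<in> {0<..<pi}" "a' \<in> carrier SU2" "b' \<in> carrier SU2" "?c = q_proj (pair_point \<theta>' a' b')"
    by (simp_all add: co)
  obtain s where "\<theta>' = \<theta>" "s \<in> torus" "psu_class a' = psu_class (qmult s a)" "psu_class b' = psu_class (qmult s b)"
    using q_proj_pair_point_eqE[OF assms(1) c(1) assms(2,3) c(2,3,4)] .
  then show ?thesis using inv by (simp add: co)
qed

lemma continuous_map_q_proj_pair_point:
  "continuous_map (top_of_set ({0<..<pi} \<times> carrier SU2 \<times> carrier SU2)) (subtopology A_top UV)
     (\<lambda>(\<theta>, a, b). q_proj (pair_point \<theta> a b))"
proof -
  let ?E = "{0<..<pi} \<times> carrier SU2 \<times> carrier SU2"
  have "continuous_map (top_of_set ?E) (top_of_set M_space) (\<lambda>(\<theta>, a, b). pair_point \<theta> a b)"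
    using continuous_on_pair_point by (auto simp: continuous_map_in_subtopology pair_point_M)
  from continuous_map_compose[OF this quotient_imp_continuous_map[OF quotient_map_q_proj]]
  have "continuous_map (top_of_set ?E) A_top (\<lambda>(\<theta>, a, b). q_proj (pair_point \<theta> a b))"
    by (simp add: comp_def case_prod_unfold)
  then show ?thesis using pair_point_in_A_at(2) by (auto simp: continuous_map_in_subtopology)
qed

lemma continuous_map_comparison: "continuous_map (subtopology A_top UV) PP_T_top comparison"
proof (rule continuous_map_from_UV)
  let ?E = "{0<..<pi} \<times> carrier SU2 \<times> carrier SU2"
  have "continuous_map (top_of_set ?E) (top_of_set (carrier SU2 \<times> carrier SU2)) snd"
    by (auto simp: continuous_map_in_subtopology intro!: continuous_intros)
  from continuous_map_compose[OF this quotient_imp_continuous_map[OF quotient_map_orbit_of]]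
  show "continuous_map (top_of_set ?E) PP_T_top (\<lambda>(\<theta>, a, b). comparison (q_proj (pair_point \<theta> a b)))"
    by (rule continuous_map_eq) (auto simp: comparison_pair_point)
qed

lemma topspace_UV: "topspace (subtopology A_top UV) = UV"
  using UV_subset by auto

lemma topspace_PP_T: "topspace PP_T_top = {orbit_of a b |a b. a \<in> carrier SU2 \<and> b \<in> carrier SU2}"
proof -
  have "topspace PP_T_top = (\<lambda>(a, b). orbit_of a b) ` (carrier SU2 \<times> carrier SU2)"
    using quotient_map_orbit_of by (simp add: quotient_map_def)
  then show ?thesis by auto
qed

text \<open>The inverse J places an orbit at the angle \<pi>/2. One composite is the identity; the
  other moves the angle of a class to \<pi>/2 and is deformed to the identity by sliding the angle,
  with a and b fixed.\<close>

lemma homotopy_equivalence_comparison: "homotopy_equivalence (subtopology A_top UV) PP_T_top comparison"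
proof -
  define J where "J d = (case SOME (a, b). a \<in> carrier SU2 \<and> b \<in> carrier SU2 \<and> d = orbit_of a b of
      (a, b) \<Rightarrow> q_proj (pair_point (pi/2) a b))" for d
  have inv: "q_proj (pair_point \<theta> a' b') = q_proj (pair_point \<theta> a b)"
    if "\<theta> \<in> {0<..<pi}" "a \<in> carrier SU2" "b \<in> carrier SU2" "s \<in> torus"
      "psu_class a' = psu_class (qmult s a)" "psu_class b' = psu_class (qmult s b)" for \<theta> a b s a' b'
    using that pair_point_psu_class[of \<theta> "qmult s a" "qmult s b" a' b'] pair_point_torus[of \<theta> a b s]
    by (simp add: qmult_SU2 torus_SU2)
  have h: "pi/2 \<in> {0<..<pi}" by simp
  have J: "J (orbit_of a b) = q_proj (pair_point (pi/2) a b)" if ab: "a \<in> carrier SU2" "b \<in> carrier SU2" for a b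
  proof -
    let ?P = "\<lambda>(a', b'). a' \<in> carrier SU2 \<and> b' \<in> carrier SU2 \<and> orbit_of a b = orbit_of a' b'"
    obtain a' b' where e: "Eps ?P = (a', b')" by (cases "Eps ?P")
    have "?P (Eps ?P)" by (rule someI[of ?P "(a, b)"]) (use ab in simp)
    then have c: "a' \<in> carrier SU2" "b' \<in> carrier SU2" "orbit_of a b = orbit_of a' b'" by (simp_all add: e)
    obtain s where "s \<in> torus" "psu_class a' = psu_class (qmult s a)" "psu_class b' = psu_class (qmult s b)"
      using orbit_of_eqE[OF ab c] .
    then show ?thesis using inv[OF h ab] by (simp add: J_def e)
  qed
  have J_cont: "continuous_map PP_T_top (subtopology A_top UV) J"
  proof (rule continuous_compose_quotient_map[OF quotient_map_orbit_of])
    let ?S = "carrier SU2 \<times> carrier SU2"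
    have "continuous_map (top_of_set ?S) (top_of_set ({0<..<pi} \<times> ?S)) (\<lambda>z. (pi/2, z))"
      by (auto simp: continuous_map_in_subtopology intro!: continuous_intros)
    from continuous_map_compose[OF this continuous_map_q_proj_pair_point]
    show "continuous_map (top_of_set ?S) (subtopology A_top UV) (J \<circ> (\<lambda>(a, b). orbit_of a b))"
      by (rule continuous_map_eq) (auto simp: J)
  qed
  \<comment> \<open>At t = 0 the angle is \<pi>/2, as produced by J, and at t = 1 it is the original
    one.\<close>
  let ?h = "\<lambda>t \<theta>. t * \<theta> + (1 - t) * (pi/2)"
  have hr: "?h t \<theta> \<in> {0<..<pi}" if "t \<in> {0..1}" "\<theta> \<in> {0<..<pi}" for t \<theta>
    using convexD_alt[OF convex_real_interval(8)[of 0 pi], of "pi/2" \<theta> t] that by (simp add: add.commute)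
  define K where "K = (\<lambda>(t, c). case coords c of (\<theta>, a, b) \<Rightarrow> q_proj (pair_point (?h t \<theta>) a b))"
  have K: "K (t, q_proj (pair_point \<theta> a b)) = q_proj (pair_point (?h t \<theta>) a b)"
    if "t \<in> {0..1}" "\<theta> \<in> {0<..<pi}" "a \<in> carrier SU2" "b \<in> carrier SU2" for t \<theta> a b
    unfolding K_def prod.case using that hr[OF that(1,2)] inv
    by (intro coords_invariant[of \<theta> a b "\<lambda>\<theta> a b. q_proj (pair_point (?h t \<theta>) a b)"]) auto
  have "homotopic_with (\<lambda>_. True) (subtopology A_top UV) (subtopology A_top UV) (J \<circ> comparison) id"
  proof (subst homotopic_with, simp, intro exI[of _ K] conjI ballI)
    let ?E = "{0..1::real} \<times> {0<..<pi} \<times> carrier SU2 \<times> carrier SU2"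
    show "continuous_map (prod_topology (top_of_set {0..1}) (subtopology A_top UV)) (subtopology A_top UV) K"
    proof (rule continuous_map_from_UV_homotopy)
      have "continuous_map (top_of_set ?E) (top_of_set ({0<..<pi} \<times> carrier SU2 \<times> carrier SU2))
          (\<lambda>z. (?h (fst z) (fst (snd z)), snd (snd z)))"
        using hr by (auto simp: continuous_map_in_subtopology simp del: greaterThanLessThan_iff intro!: continuous_intros)
      from continuous_map_compose[OF this continuous_map_q_proj_pair_point]
      show "continuous_map (top_of_set ?E) (subtopology A_top UV) (\<lambda>(t, \<theta>, a, b). K (t, q_proj (pair_point \<theta> a b)))"
        by (rule continuous_map_eq) (auto simp: K)
    qed
    fix c assume "c \<in> topspace (subtopology A_top UV)"
    then obtain \<theta> a b where c: "\<theta> \<in> {0<..<pi}" "a \<in> carrier SU2" "b \<in> carrier SU2" "c = q_proj (pair_point \<theta> a b)"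
      unfolding topspace_UV by (rule UV_pair_point)
    show "K (0, c) = (J \<circ> comparison) c" "K (1, c) = id c" using c by (simp_all add: K comparison_pair_point J)
  qed simp
  moreover have "homotopic_with (\<lambda>_. True) PP_T_top PP_T_top (comparison \<circ> J) id"
  proof (rule homotopic_with_equal)
    show "continuous_map PP_T_top PP_T_top (comparison \<circ> J)"
      by (rule continuous_map_compose[OF J_cont continuous_map_comparison])
    show "(comparison \<circ> J) d = id d" if "d \<in> topspace PP_T_top" for d
      using that h by (auto simp: topspace_PP_T J comparison_pair_point)
  qed auto
  ultimately show ?thesis unfolding homotopy_equivalence_def using continuous_map_comparison J_cont by blast
qed

definition transition_homotopy :: "real \<times> quad set \<Rightarrow> quat set" where
  "transition_homotopy = (\<lambda>(t, c). case coords c of (\<theta>, a, b) \<Rightarrow> deformed_ratio t \<theta> a b)"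

lemma transition_homotopy_pair_point:
  assumes "t \<in> {0..1}" "\<theta> \<in> {0<..<pi}" "a \<in> carrier SU2" "b \<in> carrier SU2"
  shows "transition_homotopy (t, q_proj (pair_point \<theta> a b)) = deformed_ratio t \<theta> a b"
  unfolding transition_homotopy_def prod.case
  by (rule coords_invariant[OF assms(2-4)], rule deformed_ratio_torus[OF assms(2,1,3,4)])

lemma continuous_map_transition_homotopy:
  "continuous_map (prod_topology (top_of_set {0..1}) (subtopology A_top UV)) PSU2_top transition_homotopy"
  by (rule continuous_map_from_UV_homotopy, rule continuous_map_eq[OF continuous_map_deformed_ratio])
    (auto simp: transition_homotopy_pair_point)

lemma deformed_ratio_1:
  assumes "\<theta> \<in> {0<..<pi}" "a \<in> carrier SU2" "b \<in> carrier SU2"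
  shows "deformed_ratio 1 \<theta> a b = inv\<^bsub>PSU2\<^esub> (psu_class a) \<otimes>\<^bsub>PSU2\<^esub> psu_class b"
  using assms by (simp add: deformed_ratio_def deformed_class_1)

theorem theorem7p2:
  shows "(\<forall>\<theta>\<in>{0<..<pi}.
            homotopic_with (\<lambda>_. True) (subtopology A_top (A_at \<theta>)) PSU2_top
              transition (slice_map \<theta>)) \<and>
         homotopy_equivalence (subtopology A_top (U_set \<inter> V_set)) PP_T_top comparison \<and>
         homotopic_with (\<lambda>_. True) (subtopology A_top (U_set \<inter> V_set)) PSU2_top
           transition (quotient_division \<circ> comparison)"
proof (intro conjI ballI)
  show "homotopy_equivalence (subtopology A_top UV) PP_T_top comparison"
    by (rule homotopy_equivalence_comparison)
  show "homotopic_with (\<lambda>_. True) (subtopology A_top UV) PSU2_top transition (quotient_division \<circ> comparison)"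
  proof (subst homotopic_with, simp, intro exI[of _ transition_homotopy] conjI ballI)
    fix c assume "c \<in> topspace (subtopology A_top UV)"
    then obtain \<theta> a b where c: "\<theta> \<in> {0<..<pi}" "a \<in> carrier SU2" "b \<in> carrier SU2" "c = q_proj (pair_point \<theta> a b)"
      unfolding topspace_UV by (rule UV_pair_point)
    then show "transition_homotopy (0, c) = transition c" "transition_homotopy (1, c) = (quotient_division \<circ> comparison) c"
      by (simp_all add: transition_homotopy_pair_point transition_pair_point comparison_pair_point
          quotient_division_orbit_of deformed_ratio_1)
  qed (simp_all add: continuous_map_transition_homotopy)
  fix \<theta> :: real assume \<theta>: "\<theta> \<in> {0<..<pi}"
  \<comment> \<open>The homotopy on U \<inter> V is restricted to one slice, where its final map is
    \<open>slice_map\<close>.\<close>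
  have sub: "A_at \<theta> \<subseteq> UV" using A_at_pair_point[OF \<theta>] pair_point_in_A_at(2)[OF \<theta>] by blast
  show "homotopic_with (\<lambda>_. True) (subtopology A_top (A_at \<theta>)) PSU2_top transition (slice_map \<theta>)"
  proof (subst homotopic_with, simp, intro exI[of _ transition_homotopy] conjI ballI)
    have "subtopology A_top (A_at \<theta>) = subtopology (subtopology A_top UV) (A_at \<theta>)"
      using sub by (simp add: subtopology_subtopology inf.absorb2)
    then have "continuous_map (subtopology A_top (A_at \<theta>)) (subtopology A_top UV) id"
      by (metis continuous_map_from_subtopology continuous_map_id)
    then have "continuous_map (prod_topology (top_of_set {0..1::real}) (subtopology A_top (A_at \<theta>)))
        (prod_topology (top_of_set {0..1}) (subtopology A_top UV)) (\<lambda>(t, c). (id t, id c))"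
      unfolding continuous_map_prod_top by (simp add: id_def)
    from continuous_map_compose[OF this continuous_map_transition_homotopy]
    show "continuous_map (prod_topology (top_of_set {0..1}) (subtopology A_top (A_at \<theta>))) PSU2_top transition_homotopy"
      by (simp add: comp_def)
    fix c assume "c \<in> topspace (subtopology A_top (A_at \<theta>))"
    then have "c \<in> A_at \<theta>" by simp
    then obtain a b where "a \<in> carrier SU2" "b \<in> carrier SU2" "c = q_proj (pair_point \<theta> a b)"
      by (rule A_at_pair_point[OF \<theta>])
    then show "transition_homotopy (0, c) = transition c" "transition_homotopy (1, c) = slice_map \<theta> c"
      using \<theta> by (simp_all add: transition_homotopy_pair_point transition_pair_point slice_map_pair_point deformed_ratio_1)
  qed simp
qed

end
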